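(* Let $k$ be a finite field and let $(\mathscr C,\mathbb E,\mathfrak s)$ be an extriangulated category, where $\mathscr C$ is an essentially small Krull–Schmidt additive $k$-linear category and $\mathbb E$ is $k$-bilinear, such that for all $X,Y\in\mathscr C$ one has $\dim_k\mathbb E^i(X,Y)<\infty$ for every $i\ge 0$ and $\sum_{i\ge 0}\dim_k\mathbb E^i(X,Y)<\infty$. Then for all $X,Y,L\in\mathscr C$, $$\frac{|{}_X(L,Y)|}{|\mathrm{Aut}\,Y|}\,\frac{[L,Y]}{[Y,Y]}=\frac{|(X,L)_Y|}{|\mathrm{Aut}\,X|}\,\frac{[X,L]}{[X,X]}.$$
   Context: An extriangulated category (Nakaoka–Palu) is a triple $(\mathscr C,\mathbb E,\mathfrak s)$ as follows. (ET1) $\mathscr C$ is additive and $\mathbb E:\mathscr C^{op}\times\mathscr C\to Ab$ is a biadditive functor; elements $\delta\in\mathbb E(C,A)$ are called extensions; for $a:A\to A'$, $c:C'\to C$ put $a_*\delta=\mathbb E(C,a)(\delta)$, $c^*\delta=\mathbb E(c,A)(\delta)$; a morphism from $\delta\in\mathbb E(C,A)$ to $\delta'\in\mathbb E(C',A')$ is a pair $(a:A\to A',c:C\to C')$ with $a_*\delta=c^*\delta'$. (ET2) $\mathfrak s$ assigns to each $\delta\in\mathbb E(C,A)$ an equivalence class $[A\to B\to C]$ of sequences (two sequences $A\to B\to C$ and $A\to B'\to C$ are equivalent if there is an isomorphism $B\cong B'$ compatible with the identities of $A$ and $C$), such that every morphism $(a,c):\delta\to\delta'$ is realized by some $(a,b,c)$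 making both squares between representing sequences commute, $\mathfrak s(0)$ is the class of the split sequence $A\to A\oplus C\to C$, and $\mathfrak s(\delta\oplus\delta')=\mathfrak s(\delta)\oplus\mathfrak s(\delta')$. (ET3) If $\mathfrak s(\delta)=[A\xrightarrow{x}B\xrightarrow{y}C]$, $\mathfrak s(\delta')=[A'\xrightarrow{x'}B'\xrightarrow{y'}C']$ and $bx=x'a$, there is $c$ with $cy=y'b$ and $a_*\delta=c^*\delta'$. (ET4) If $\delta\in\mathbb E(D,A)$, $\delta'\in\mathbb E(F,B)$ are realized by $A\xrightarrow{f}B\xrightarrow{f'}D$ and $B\xrightarrow{g}C\xrightarrow{g'}F$, there are an object $E$, an extension $\delta''\in\mathbb E(E,A)$ realized by $A\xrightarrow{h}C\xrightarrow{h'}E$ with $h=gf$, and a sequence $D\xrightarrow{d}E\xrightarrow{e}F$ realizing $f'_*\delta'$, with $h'g=df'$, $eh'=g'$, $d^*\delta''=\delta$, $f_*\delta''=e^*\delta'$. The duals of (ET3) and (ET4) also hold. If $\mathfrak s(\delta)=[A\xrightarrow{x}B\xrightarrow{y}C]$, then $A\xrightarrow{x}B\xrightarrow{y}C\overset{\delta}{\dashrightarrow}$ is called an $\mathbb E$-triangle, $x$ an inflation, $y$ a deflation, $C=\mathrm{cone}(x)$ and $A=\mathrm{cocone}(y)$ (well defined up to isomorphism). Higher extensions: $\mathbb E^0=\mathrm{Hom}$, $\mathbb E^1=\mathbb E$, and $\mathbb E^n(C,A)=\int^{M\in\mathscr C}\mathbb E^{n-1}(M,A)\otimes_k\mathbb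 E(C,M)$ for $n\ge2$ (Yoneda-type coend). Notation: $(X,L)_Y$ is the set of inflations $f:X\to L$ with $\mathrm{cone}(f)\cong Y$; ${}_X(L,Y)$ is the set of deflations $g:L\to Y$ with $\mathrm{cocone}(g)\cong X$. Further $\{X,Y\}':=\prod_{i>0}|\mathbb E^i(X,Y)|^{(-1)^i}$ and $[X,Y]:=\dfrac{1}{\{X,Y\}'\,|\mathrm{Hom}(X,Y)|}$. *)

theory Defs
  imports
    "HOL-Analysis.Infinite_Products"
    "Jordan_Normal_Form.Missing_VectorSpace"
begin

section \<open>Linear categories\<close>

text \<open>
  The Hom-sets are \<open>K\<close>-modules in the sense of HOL-Algebra; the fields \<open>mult\<close> and \<open>one\<close>
  of the module record play no role. Composition does not mention objects: morphisms may be
  thought of as carrying their domain and codomain. Objects form a set \<open>Ob\<close> in a HOL type, so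
  essential smallness holds automatically.
\<close>

record ('o, 'k, 'm) lin_cat =
  Ob :: "'o set"
  Hom :: "'o \<Rightarrow> 'o \<Rightarrow> ('k, 'm) module"
  comp :: "'m \<Rightarrow> 'm \<Rightarrow> 'm"  (infixl \<open>\<cdot>\<index>\<close> 70)
  ident :: "'o \<Rightarrow> 'm"

abbreviation mor :: "('o, 'k, 'm, 'z) lin_cat_scheme \<Rightarrow> 'o \<Rightarrow> 'o \<Rightarrow> 'm set"
  where "mor \<C> X Y \<equiv> carrier (Hom \<C> X Y)"

definition iso_mor :: "('o, 'k, 'm, 'z) lin_cat_scheme \<Rightarrow> 'o \<Rightarrow> 'o \<Rightarrow> 'm set"
  where "iso_mor \<C> X Y =
    {f \<in> mor \<C> X Y. \<exists>g \<in> mor \<C> Y X. g \<cdot>\<^bsub>\<C>\<^esub> f = ident \<C> X \<and> f \<cdot>\<^bsub>\<C>\<^esub> g = ident \<C> Y}"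

definition isomorphic :: "('o, 'k, 'm, 'z) lin_cat_scheme \<Rightarrow> 'o \<Rightarrow> 'o \<Rightarrow> bool"
  where "isomorphic \<C> X Y \<longleftrightarrow> iso_mor \<C> X Y \<noteq> {}"

definition Aut :: "('o, 'k, 'm, 'z) lin_cat_scheme \<Rightarrow> 'o \<Rightarrow> 'm set"
  where "Aut \<C> X = iso_mor \<C> X X"

definition zero_object :: "('o, 'k, 'm, 'z) lin_cat_scheme \<Rightarrow> 'o \<Rightarrow> bool"
  where "zero_object \<C> Z \<longleftrightarrow> Z \<in> Ob \<C> \<and>
    (\<forall>X \<in> Ob \<C>. (\<exists>!f. f \<in> mor \<C> X Z) \<and> (\<exists>!f. f \<in> mor \<C> Z X))"

definition biproduct ::
  "('o, 'k, 'm, 'z) lin_cat_scheme \<Rightarrow> 'o \<Rightarrow> 'o \<Rightarrow> 'o \<Rightarrow> 'm \<Rightarrow> 'm \<Rightarrow> 'm \<Rightarrow> 'm \<Rightarrow> bool"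
  where "biproduct \<C> X Y P i\<^sub>1 i\<^sub>2 p\<^sub>1 p\<^sub>2 \<longleftrightarrow>
    P \<in> Ob \<C> \<and>
    i\<^sub>1 \<in> mor \<C> X P \<and> i\<^sub>2 \<in> mor \<C> Y P \<and> p\<^sub>1 \<in> mor \<C> P X \<and> p\<^sub>2 \<in> mor \<C> P Y \<and>
    p\<^sub>1 \<cdot>\<^bsub>\<C>\<^esub> i\<^sub>1 = ident \<C> X \<and> p\<^sub>2 \<cdot>\<^bsub>\<C>\<^esub> i\<^sub>2 = ident \<C> Y \<and>
    p\<^sub>2 \<cdot>\<^bsub>\<C>\<^esub> i\<^sub>1 = \<zero>\<^bsub>Hom \<C> X Y\<^esub> \<and> p\<^sub>1 \<cdot>\<^bsub>\<C>\<^esub> i\<^sub>2 = \<zero>\<^bsub>Hom \<C> Y X\<^esub> \<and>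
    (i\<^sub>1 \<cdot>\<^bsub>\<C>\<^esub> p\<^sub>1) \<oplus>\<^bsub>Hom \<C> P P\<^esub> (i\<^sub>2 \<cdot>\<^bsub>\<C>\<^esub> p\<^sub>2) = ident \<C> P"

locale linear_additive_category = field K
  for K :: "('k, 'r) ring_scheme" and \<C> :: "('o, 'k, 'm, 'z) lin_cat_scheme" (structure) +
  assumes Hom_vectorspace:
      "\<lbrakk>X \<in> Ob \<C>; Y \<in> Ob \<C>\<rbrakk> \<Longrightarrow> vectorspace K (Hom \<C> X Y)"
    and ident_mor: "X \<in> Ob \<C> \<Longrightarrow> ident \<C> X \<in> mor \<C> X X"
    and comp_linear_left:
      "\<lbrakk>X \<in> Ob \<C>; Y \<in> Ob \<C>; Z \<in> Ob \<C>; f \<in> mor \<C> X Y\<rbrakk>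
        \<Longrightarrow> (\<lambda>g. g \<cdot> f) \<in> LinearCombinations.module_hom K (Hom \<C> Y Z) (Hom \<C> X Z)"
    and comp_linear_right:
      "\<lbrakk>X \<in> Ob \<C>; Y \<in> Ob \<C>; Z \<in> Ob \<C>; g \<in> mor \<C> Y Z\<rbrakk>
        \<Longrightarrow> (\<lambda>f. g \<cdot> f) \<in> LinearCombinations.module_hom K (Hom \<C> X Y) (Hom \<C> X Z)"
    and comp_assoc:
      "\<lbrakk>W \<in> Ob \<C>; X \<in> Ob \<C>; Y \<in> Ob \<C>; Z \<in> Ob \<C>;
        f \<in> mor \<C> W X; g \<in> mor \<C> X Y; h \<in> mor \<C> Y Z\<rbrakk>
        \<Longrightarrow> (h \<cdot> g) \<cdot> f = h \<cdot> (g \<cdot> f)"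
    and comp_ident_left: "\<lbrakk>X \<in> Ob \<C>; Y \<in> Ob \<C>; f \<in> mor \<C> X Y\<rbrakk> \<Longrightarrow> ident \<C> Y \<cdot> f = f"
    and comp_ident_right: "\<lbrakk>X \<in> Ob \<C>; Y \<in> Ob \<C>; f \<in> mor \<C> X Y\<rbrakk> \<Longrightarrow> f \<cdot> ident \<C> X = f"
    and ex_zero_object: "\<exists>Z. zero_object \<C> Z"
    and ex_biproduct:
      "\<lbrakk>X \<in> Ob \<C>; Y \<in> Ob \<C>\<rbrakk> \<Longrightarrow> \<exists>P i\<^sub>1 i\<^sub>2 p\<^sub>1 p\<^sub>2. biproduct \<C> X Y P i\<^sub>1 i\<^sub>2 p\<^sub>1 p\<^sub>2"


section \<open>Krull--Schmidt categories\<close>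

definition End_ring :: "('o, 'k, 'm, 'z) lin_cat_scheme \<Rightarrow> 'o \<Rightarrow> 'm ring"
  where "End_ring \<C> X =
    \<lparr>carrier = mor \<C> X X, mult = comp \<C>, one = ident \<C> X,
     zero = \<zero>\<^bsub>Hom \<C> X X\<^esub>, add = add (Hom \<C> X X)\<rparr>"

definition local_ring :: "('a, 'b) ring_scheme \<Rightarrow> bool"
  where "local_ring R \<longleftrightarrow> ring R \<and> \<one>\<^bsub>R\<^esub> \<noteq> \<zero>\<^bsub>R\<^esub> \<and>
    (\<forall>a \<in> carrier R - Units R. \<forall>b \<in> carrier R - Units R. a \<oplus>\<^bsub>R\<^esub> b \<notin> Units R)"

definition direct_sum_decomp ::
  "('o, 'k, 'm, 'z) lin_cat_scheme \<Rightarrow> nat \<Rightarrow> (nat \<Rightarrow> 'o) \<Rightarrow> 'o \<Rightarrow> (nat \<Rightarrow> 'm) \<Rightarrow> (nat \<Rightarrow> 'm) \<Rightarrow> bool"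
  where "direct_sum_decomp \<C> n S X i p \<longleftrightarrow>
    (\<forall>j<n. S j \<in> Ob \<C> \<and> i j \<in> mor \<C> (S j) X \<and> p j \<in> mor \<C> X (S j)) \<and>
    (\<forall>j<n. \<forall>l<n. p j \<cdot>\<^bsub>\<C>\<^esub> i l =
       (if j = l then ident \<C> (S j) else \<zero>\<^bsub>Hom \<C> (S l) (S j)\<^esub>)) \<and>
    (\<Oplus>\<^bsub>Hom \<C> X X\<^esub>j\<in>{..<n}. i j \<cdot>\<^bsub>\<C>\<^esub> p j) = ident \<C> X"

definition Krull_Schmidt :: "('o, 'k, 'm, 'z) lin_cat_scheme \<Rightarrow> bool"
  where "Krull_Schmidt \<C> \<longleftrightarrow>
    (\<forall>X \<in> Ob \<C>. \<exists>n S i p. direct_sum_decomp \<C> n S X i p \<and>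
       (\<forall>j<n. local_ring (End_ring \<C> (S j))))"


section \<open>Extriangulated categories\<close>

text \<open>
  \<open>Ext1 \<C> C A\<close> is \<open>\<E>(C, A)\<close>, contravariant in \<open>C\<close> and covariant in \<open>A\<close>; \<open>push \<C> a \<delta>\<close> is
  \<open>a\<^sub>* \<delta>\<close> and \<open>pull \<C> c \<delta>\<close> is \<open>c\<^sup>* \<delta>\<close>. For \<open>\<delta> \<in> \<E>(C, A)\<close>, \<open>realn \<C> C A \<delta>\<close> is the class
  \<open>\<s>(\<delta>)\<close>, a set of triples \<open>(B, x, y)\<close> standing for sequences from \<open>A\<close> via \<open>x\<close> to \<open>B\<close> and
  via \<open>y\<close> to \<open>C\<close>.
\<close>

record ('o, 'k, 'm, 'e) extri_cat = "('o, 'k, 'm) lin_cat" +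
  Ext1 :: "'o \<Rightarrow> 'o \<Rightarrow> ('k, 'e) module"
  push :: "'m \<Rightarrow> 'e \<Rightarrow> 'e"
  pull :: "'m \<Rightarrow> 'e \<Rightarrow> 'e"
  realn :: "'o \<Rightarrow> 'o \<Rightarrow> 'e \<Rightarrow> ('o \<times> 'm \<times> 'm) set"

definition sequences :: "('o, 'k, 'm, 'z) lin_cat_scheme \<Rightarrow> 'o \<Rightarrow> 'o \<Rightarrow> ('o \<times> 'm \<times> 'm) set"
  where "sequences \<C> A C = {(B, x, y). B \<in> Ob \<C> \<and> x \<in> mor \<C> A B \<and> y \<in> mor \<C> B C}"

definition seq_equiv ::
  "('o, 'k, 'm, 'z) lin_cat_scheme \<Rightarrow> 'o \<Rightarrow> 'o \<Rightarrow> (('o \<times> 'm \<times> 'm) \<times> ('o \<times> 'm \<times> 'm)) set"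
  where "seq_equiv \<C> A C =
    {((B, x, y), (B', x', y')).
       (B, x, y) \<in> sequences \<C> A C \<and> (B', x', y') \<in> sequences \<C> A C \<and>
       (\<exists>b \<in> iso_mor \<C> B B'. b \<cdot>\<^bsub>\<C>\<^esub> x = x' \<and> y' \<cdot>\<^bsub>\<C>\<^esub> b = y)}"

definition etriangle ::
  "('o, 'k, 'm, 'e, 'z) extri_cat_scheme \<Rightarrow> 'o \<Rightarrow> 'm \<Rightarrow> 'o \<Rightarrow> 'm \<Rightarrow> 'o \<Rightarrow> 'e \<Rightarrow> bool"
  where "etriangle \<C> A x B y C \<delta> \<longleftrightarrow>
    A \<in> Ob \<C> \<and> C \<in> Ob \<C> \<and> \<delta> \<in> carrier (Ext1 \<C> C A) \<and> (B, x, y) \<in> realn \<C> C A \<delta>"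

locale linear_extriangulated_category = linear_additive_category K \<C>
  for K :: "('k, 'r) ring_scheme"
  and \<C> :: "('o, 'k, 'm, 'e, 'z) extri_cat_scheme" (structure) +
  assumes ET1_vectorspace:
      "\<lbrakk>C \<in> Ob \<C>; A \<in> Ob \<C>\<rbrakk> \<Longrightarrow> vectorspace K (Ext1 \<C> C A)"
    and ET1_push_linear:
      "\<lbrakk>C \<in> Ob \<C>; A \<in> Ob \<C>; A' \<in> Ob \<C>; a \<in> mor \<C> A A'\<rbrakk>
        \<Longrightarrow> push \<C> a \<in> LinearCombinations.module_hom K (Ext1 \<C> C A) (Ext1 \<C> C A')"
    and ET1_pull_linear:
      "\<lbrakk>C \<in> Ob \<C>; C' \<in> Ob \<C>; A \<in> Ob \<C>; c \<in> mor \<C> C' C\<rbrakk>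
        \<Longrightarrow> pull \<C> c \<in> LinearCombinations.module_hom K (Ext1 \<C> C A) (Ext1 \<C> C' A)"
    and ET1_push_bilinear:
      "\<lbrakk>C \<in> Ob \<C>; A \<in> Ob \<C>; A' \<in> Ob \<C>; \<delta> \<in> carrier (Ext1 \<C> C A)\<rbrakk>
        \<Longrightarrow> (\<lambda>a. push \<C> a \<delta>) \<in> LinearCombinations.module_hom K (Hom \<C> A A') (Ext1 \<C> C A')"
    and ET1_pull_bilinear:
      "\<lbrakk>C \<in> Ob \<C>; C' \<in> Ob \<C>; A \<in> Ob \<C>; \<delta> \<in> carrier (Ext1 \<C> C A)\<rbrakk>
        \<Longrightarrow> (\<lambda>c. pull \<C> c \<delta>) \<in> LinearCombinations.module_hom K (Hom \<C> C' C) (Ext1 \<C> C' A)"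
    and ET1_push_ident:
      "\<lbrakk>C \<in> Ob \<C>; A \<in> Ob \<C>; \<delta> \<in> carrier (Ext1 \<C> C A)\<rbrakk> \<Longrightarrow> push \<C> (ident \<C> A) \<delta> = \<delta>"
    and ET1_pull_ident:
      "\<lbrakk>C \<in> Ob \<C>; A \<in> Ob \<C>; \<delta> \<in> carrier (Ext1 \<C> C A)\<rbrakk> \<Longrightarrow> pull \<C> (ident \<C> C) \<delta> = \<delta>"
    and ET1_push_comp:
      "\<lbrakk>C \<in> Ob \<C>; A \<in> Ob \<C>; A' \<in> Ob \<C>; A'' \<in> Ob \<C>; \<delta> \<in> carrier (Ext1 \<C> C A);
        a \<in> mor \<C> A A'; a' \<in> mor \<C> A' A''\<rbrakk>
        \<Longrightarrow> push \<C> (a' \<cdot> a) \<delta> = push \<C> a' (push \<C> a \<delta>)"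
    and ET1_pull_comp:
      "\<lbrakk>C \<in> Ob \<C>; C' \<in> Ob \<C>; C'' \<in> Ob \<C>; A \<in> Ob \<C>; \<delta> \<in> carrier (Ext1 \<C> C A);
        c \<in> mor \<C> C' C; c' \<in> mor \<C> C'' C'\<rbrakk>
        \<Longrightarrow> pull \<C> (c \<cdot> c') \<delta> = pull \<C> c' (pull \<C> c \<delta>)"
    and ET1_push_pull:
      "\<lbrakk>C \<in> Ob \<C>; C' \<in> Ob \<C>; A \<in> Ob \<C>; A' \<in> Ob \<C>; \<delta> \<in> carrier (Ext1 \<C> C A);
        a \<in> mor \<C> A A'; c \<in> mor \<C> C' C\<rbrakk>
        \<Longrightarrow> push \<C> a (pull \<C> c \<delta>) = pull \<C> c (push \<C> a \<delta>)"
    and ET2_class: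
      "\<lbrakk>C \<in> Ob \<C>; A \<in> Ob \<C>; \<delta> \<in> carrier (Ext1 \<C> C A)\<rbrakk>
        \<Longrightarrow> realn \<C> C A \<delta> \<in> sequences \<C> A C // seq_equiv \<C> A C"
    and ET2_morphism:
      "\<lbrakk>etriangle \<C> A x B y C \<delta>; etriangle \<C> A' x' B' y' C' \<delta>';
        a \<in> mor \<C> A A'; c \<in> mor \<C> C C'; push \<C> a \<delta> = pull \<C> c \<delta>'\<rbrakk>
        \<Longrightarrow> \<exists>b \<in> mor \<C> B B'. b \<cdot> x = x' \<cdot> a \<and> y' \<cdot> b = c \<cdot> y"
    and ET2_zero:
      "\<lbrakk>A \<in> Ob \<C>; C \<in> Ob \<C>; biproduct \<C> A C P i\<^sub>1 i\<^sub>2 p\<^sub>1 p\<^sub>2\<rbrakk>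
        \<Longrightarrow> (P, i\<^sub>1, p\<^sub>2) \<in> realn \<C> C A \<zero>\<^bsub>Ext1 \<C> C A\<^esub>"
    \<comment> \<open>\<open>\<delta> \<oplus> \<delta>'\<close> is the extension of \<open>C \<oplus> C'\<close> by \<open>A \<oplus> A'\<close> with matrix \<open>(\<delta>, 0, 0, \<delta>')\<close>,
        i.e. the sum of the images of \<open>\<delta>\<close> and \<open>\<delta>'\<close> along inclusions and projections.\<close>
    and ET2_sum:
      "\<lbrakk>etriangle \<C> A x B y C \<delta>; etriangle \<C> A' x' B' y' C' \<delta>';
        biproduct \<C> A A' SA iA iA' pA pA';
        biproduct \<C> B B' SB iB iB' pB pB';
        biproduct \<C> C C' SC iC iC' pC pC'\<rbrakk>
        \<Longrightarrow> etriangle \<C>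
              SA ((iB \<cdot> x \<cdot> pA) \<oplus>\<^bsub>Hom \<C> SA SB\<^esub> (iB' \<cdot> x' \<cdot> pA'))
              SB ((iC \<cdot> y \<cdot> pB) \<oplus>\<^bsub>Hom \<C> SB SC\<^esub> (iC' \<cdot> y' \<cdot> pB'))
              SC (push \<C> iA (pull \<C> pC \<delta>) \<oplus>\<^bsub>Ext1 \<C> SC SA\<^esub> push \<C> iA' (pull \<C> pC' \<delta>'))"
    and ET3:
      "\<lbrakk>etriangle \<C> A x B y C \<delta>; etriangle \<C> A' x' B' y' C' \<delta>';
        a \<in> mor \<C> A A'; b \<in> mor \<C> B B'; b \<cdot> x = x' \<cdot> a\<rbrakk>
        \<Longrightarrow> \<exists>c \<in> mor \<C> C C'. c \<cdot> y = y' \<cdot> b \<and> push \<C> a \<delta> = pull \<C> c \<delta>'"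
    and ET3_op:
      "\<lbrakk>etriangle \<C> A x B y C \<delta>; etriangle \<C> A' x' B' y' C' \<delta>';
        b \<in> mor \<C> B B'; c \<in> mor \<C> C C'; c \<cdot> y = y' \<cdot> b\<rbrakk>
        \<Longrightarrow> \<exists>a \<in> mor \<C> A A'. b \<cdot> x = x' \<cdot> a \<and> push \<C> a \<delta> = pull \<C> c \<delta>'"
    and ET4:
      "\<lbrakk>etriangle \<C> A f B f' D \<delta>; etriangle \<C> B g C g' F \<delta>'\<rbrakk>
        \<Longrightarrow> \<exists>E \<in> Ob \<C>. \<exists>h' d e \<delta>''.
              d \<in> mor \<C> D E \<and> e \<in> mor \<C> E F \<and>
              etriangle \<C> A (g \<cdot> f) C h' E \<delta>'' \<and>
              etriangle \<C> D d E e F (push \<C> f' \<delta>') \<and>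
              h' \<cdot> g = d \<cdot> f' \<and> e \<cdot> h' = g' \<and>
              pull \<C> d \<delta>'' = \<delta> \<and> push \<C> f \<delta>'' = pull \<C> e \<delta>'"
    and ET4_op:
      "\<lbrakk>etriangle \<C> D f' B f A \<delta>; etriangle \<C> F g' C g B \<delta>'\<rbrakk>
        \<Longrightarrow> \<exists>E \<in> Ob \<C>. \<exists>h' d e \<delta>''.
              d \<in> mor \<C> E D \<and> e \<in> mor \<C> F E \<and>
              etriangle \<C> E h' C (f \<cdot> g) A \<delta>'' \<and>
              etriangle \<C> F e E d D (pull \<C> f' \<delta>') \<and>
              g \<cdot> h' = f' \<cdot> d \<and> h' \<cdot> e = g' \<and>
              push \<C> d \<delta>'' = \<delta> \<and> pull \<C> f \<delta>'' = push \<C> e \<delta>'"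

definition inflations_cone ::
  "('o, 'k, 'm, 'e, 'z) extri_cat_scheme \<Rightarrow> 'o \<Rightarrow> 'o \<Rightarrow> 'o \<Rightarrow> 'm set"
  where "inflations_cone \<C> X L Y =
    {f \<in> mor \<C> X L. \<exists>C y \<delta>. etriangle \<C> X f L y C \<delta> \<and> isomorphic \<C> C Y}"

definition deflations_cocone ::
  "('o, 'k, 'm, 'e, 'z) extri_cat_scheme \<Rightarrow> 'o \<Rightarrow> 'o \<Rightarrow> 'o \<Rightarrow> 'm set"
  where "deflations_cocone \<C> X L Y =
    {g \<in> mor \<C> L Y. \<exists>A x \<delta>. etriangle \<C> A x L g Y \<delta> \<and> isomorphic \<C> A X}"


section \<open>Higher extensions\<close>

text \<open>
  Since the element type of the coend \<open>\<integral>\<^sup>M \<E>\<^sup>n\<^sup>-\<^sup>1(M, A) \<otimes> \<E>(C, M)\<close> is built from that of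
  \<open>\<E>\<^sup>n\<^sup>-\<^sup>1\<close>, all \<open>\<E>\<^sup>n\<close> are represented in one type, as quotients of sets of formal expressions.
  \<open>Tens \<xi> M \<delta>\<close> stands for the image in the coend of \<open>\<xi> \<otimes> \<delta>\<close> with \<open>\<xi> \<in> \<E>\<^sup>n\<^sup>-\<^sup>1(M, A)\<close> and
  \<open>\<delta> \<in> \<E>(C, M)\<close>.
\<close>

datatype ('o, 'k, 'e) yterm =
    Base 'e
  | Zero
  | Add "('o, 'k, 'e) yterm" "('o, 'k, 'e) yterm"
  | Scale 'k "('o, 'k, 'e) yterm"
  | Tens "('o, 'k, 'e) yterm" 'o 'e

primrec ypull ::
  "('o, 'k, 'm, 'e, 'z) extri_cat_scheme \<Rightarrow> 'm \<Rightarrow> ('o, 'k, 'e) yterm \<Rightarrow> ('o, 'k, 'e) yterm"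
  where
    "ypull \<C> c (Base \<delta>) = Base (pull \<C> c \<delta>)"
  | "ypull \<C> c Zero = Zero"
  | "ypull \<C> c (Add s t) = Add (ypull \<C> c s) (ypull \<C> c t)"
  | "ypull \<C> c (Scale r s) = Scale r (ypull \<C> c s)"
  | "ypull \<C> c (Tens \<xi> M \<delta>) = Tens \<xi> M (pull \<C> c \<delta>)"

text \<open>
  \<open>yeq K \<C> n C A s t\<close> says that \<open>s\<close> and \<open>t\<close> are well-formed and denote the same element of
  \<open>\<E>\<^sup>n(C, A)\<close>, where \<open>n \<ge> 1\<close>. It is a partial equivalence relation, whose field consists of
  the well-formed expressions. It is generated by the vector space axioms, by the
  identification of level \<open>1\<close> with \<open>\<E>(C, A)\<close>, by \<open>K\<close>-bilinearity of the tensors, and by the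
  coend relation (rule \<open>coend\<close>) for all morphisms \<open>f\<close> from \<open>M\<close> to \<open>N\<close>.
\<close>

inductive yeq ::
  "('k, 'r) ring_scheme \<Rightarrow> ('o, 'k, 'm, 'e, 'z) extri_cat_scheme \<Rightarrow> nat \<Rightarrow> 'o \<Rightarrow> 'o \<Rightarrow>
   ('o, 'k, 'e) yterm \<Rightarrow> ('o, 'k, 'e) yterm \<Rightarrow> bool"
  for K :: "('k, 'r) ring_scheme" and \<C> :: "('o, 'k, 'm, 'e, 'z) extri_cat_scheme"
  where
    base: "\<lbrakk>C \<in> Ob \<C>; A \<in> Ob \<C>; \<delta> \<in> carrier (Ext1 \<C> C A)\<rbrakk>
      \<Longrightarrow> yeq K \<C> 1 C A (Base \<delta>) (Base \<delta>)"
  | zero: "\<lbrakk>C \<in> Ob \<C>; A \<in> Ob \<C>; 1 \<le> n\<rbrakk> \<Longrightarrow> yeq K \<C> n C A Zero Zero"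
  | add: "\<lbrakk>yeq K \<C> n C A s s'; yeq K \<C> n C A t t'\<rbrakk>
      \<Longrightarrow> yeq K \<C> n C A (Add s t) (Add s' t')"
  | scale: "\<lbrakk>r \<in> carrier K; yeq K \<C> n C A s s'\<rbrakk>
      \<Longrightarrow> yeq K \<C> n C A (Scale r s) (Scale r s')"
  | tens: "\<lbrakk>C \<in> Ob \<C>; M \<in> Ob \<C>; \<delta> \<in> carrier (Ext1 \<C> C M); yeq K \<C> n M A \<xi> \<xi>'\<rbrakk>
      \<Longrightarrow> yeq K \<C> (Suc n) C A (Tens \<xi> M \<delta>) (Tens \<xi>' M \<delta>)"
  | sym: "yeq K \<C> n C A s t \<Longrightarrow> yeq K \<C> n C A t s"
  | trans: "\<lbrakk>yeq K \<C> n C A s t; yeq K \<C> n C A t u\<rbrakk> \<Longrightarrow> yeq K \<C> n C A s u"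
  | add_assoc: "\<lbrakk>yeq K \<C> n C A s s; yeq K \<C> n C A t t; yeq K \<C> n C A u u\<rbrakk>
      \<Longrightarrow> yeq K \<C> n C A (Add (Add s t) u) (Add s (Add t u))"
  | add_comm: "\<lbrakk>yeq K \<C> n C A s s; yeq K \<C> n C A t t\<rbrakk>
      \<Longrightarrow> yeq K \<C> n C A (Add s t) (Add t s)"
  | add_zero: "yeq K \<C> n C A s s \<Longrightarrow> yeq K \<C> n C A (Add Zero s) s"
  | scale_zero: "yeq K \<C> n C A s s \<Longrightarrow> yeq K \<C> n C A (Scale \<zero>\<^bsub>K\<^esub> s) Zero"
  | scale_one: "yeq K \<C> n C A s s \<Longrightarrow> yeq K \<C> n C A (Scale \<one>\<^bsub>K\<^esub> s) s"
  | scale_scale: "\<lbrakk>q \<in> carrier K; r \<in> carrier K; yeq K \<C> n C A s s\<rbrakk>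
      \<Longrightarrow> yeq K \<C> n C A (Scale (q \<otimes>\<^bsub>K\<^esub> r) s) (Scale q (Scale r s))"
  | scale_add_left: "\<lbrakk>q \<in> carrier K; r \<in> carrier K; yeq K \<C> n C A s s\<rbrakk>
      \<Longrightarrow> yeq K \<C> n C A (Scale (q \<oplus>\<^bsub>K\<^esub> r) s) (Add (Scale q s) (Scale r s))"
  | scale_add_right: "\<lbrakk>r \<in> carrier K; yeq K \<C> n C A s s; yeq K \<C> n C A t t\<rbrakk>
      \<Longrightarrow> yeq K \<C> n C A (Scale r (Add s t)) (Add (Scale r s) (Scale r t))"
  | base_add: "\<lbrakk>C \<in> Ob \<C>; A \<in> Ob \<C>; \<delta> \<in> carrier (Ext1 \<C> C A); \<epsilon> \<in> carrier (Ext1 \<C> C A)\<rbrakk>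
      \<Longrightarrow> yeq K \<C> 1 C A (Base (\<delta> \<oplus>\<^bsub>Ext1 \<C> C A\<^esub> \<epsilon>)) (Add (Base \<delta>) (Base \<epsilon>))"
  | base_scale: "\<lbrakk>C \<in> Ob \<C>; A \<in> Ob \<C>; r \<in> carrier K; \<delta> \<in> carrier (Ext1 \<C> C A)\<rbrakk>
      \<Longrightarrow> yeq K \<C> 1 C A (Base (r \<odot>\<^bsub>Ext1 \<C> C A\<^esub> \<delta>)) (Scale r (Base \<delta>))"
  | tens_add_left: "\<lbrakk>C \<in> Ob \<C>; M \<in> Ob \<C>; \<delta> \<in> carrier (Ext1 \<C> C M);
        yeq K \<C> n M A \<xi> \<xi>; yeq K \<C> n M A \<eta> \<eta>\<rbrakk>
      \<Longrightarrow> yeq K \<C> (Suc n) C A (Tens (Add \<xi> \<eta>) M \<delta>) (Add (Tens \<xi> M \<delta>) (Tens \<eta> M \<delta>))"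
  | tens_add_right: "\<lbrakk>C \<in> Ob \<C>; M \<in> Ob \<C>; \<delta> \<in> carrier (Ext1 \<C> C M);
        \<epsilon> \<in> carrier (Ext1 \<C> C M); yeq K \<C> n M A \<xi> \<xi>\<rbrakk>
      \<Longrightarrow> yeq K \<C> (Suc n) C A (Tens \<xi> M (\<delta> \<oplus>\<^bsub>Ext1 \<C> C M\<^esub> \<epsilon>)) (Add (Tens \<xi> M \<delta>) (Tens \<xi> M \<epsilon>))"
  | tens_scale_left: "\<lbrakk>C \<in> Ob \<C>; M \<in> Ob \<C>; \<delta> \<in> carrier (Ext1 \<C> C M); r \<in> carrier K;
        yeq K \<C> n M A \<xi> \<xi>\<rbrakk>
      \<Longrightarrow> yeq K \<C> (Suc n) C A (Tens (Scale r \<xi>) M \<delta>) (Scale r (Tens \<xi> M \<delta>))"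
  | tens_scale_right: "\<lbrakk>C \<in> Ob \<C>; M \<in> Ob \<C>; \<delta> \<in> carrier (Ext1 \<C> C M); r \<in> carrier K;
        yeq K \<C> n M A \<xi> \<xi>\<rbrakk>
      \<Longrightarrow> yeq K \<C> (Suc n) C A (Tens \<xi> M (r \<odot>\<^bsub>Ext1 \<C> C M\<^esub> \<delta>)) (Scale r (Tens \<xi> M \<delta>))"
  | coend: "\<lbrakk>C \<in> Ob \<C>; M \<in> Ob \<C>; N \<in> Ob \<C>; f \<in> mor \<C> M N; \<delta> \<in> carrier (Ext1 \<C> C M);
        yeq K \<C> n N A \<xi> \<xi>\<rbrakk>
      \<Longrightarrow> yeq K \<C> (Suc n) C A (Tens (ypull \<C> f \<xi>) M \<delta>) (Tens \<xi> N (push \<C> f \<delta>))"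

definition higher_ext ::
  "('k, 'r) ring_scheme \<Rightarrow> ('o, 'k, 'm, 'e, 'z) extri_cat_scheme \<Rightarrow> nat \<Rightarrow> 'o \<Rightarrow> 'o \<Rightarrow>
   ('k, ('o, 'k, 'e) yterm set) module"
  where "higher_ext K \<C> n C A =
    \<lparr>carrier = {t. yeq K \<C> n C A t t} // {(s, t). yeq K \<C> n C A s t},
     mult = undefined, one = undefined,
     zero = {u. yeq K \<C> n C A Zero u},
     add = (\<lambda>S T. {u. \<exists>s\<in>S. \<exists>t\<in>T. yeq K \<C> n C A (Add s t) u}),
     smult = (\<lambda>r S. {u. \<exists>s\<in>S. yeq K \<C> n C A (Scale r s) u})\<rparr>"

text \<open>
  \<open>\<E>\<^sup>0 = Hom\<close> and \<open>\<E>\<^sup>1 = \<E>\<close> have element types different from those of the coends, so the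
  numerical invariants are defined by cases on the degree.
\<close>

fun ext_fin_dim ::
  "('k, 'r) ring_scheme \<Rightarrow> ('o, 'k, 'm, 'e, 'z) extri_cat_scheme \<Rightarrow> nat \<Rightarrow> 'o \<Rightarrow> 'o \<Rightarrow> bool"
  where
    "ext_fin_dim K \<C> 0 X Y = vectorspace.fin_dim K (Hom \<C> X Y)"
  | "ext_fin_dim K \<C> (Suc 0) X Y = vectorspace.fin_dim K (Ext1 \<C> X Y)"
  | "ext_fin_dim K \<C> (Suc (Suc n)) X Y = vectorspace.fin_dim K (higher_ext K \<C> (Suc (Suc n)) X Y)"

fun ext_dim ::
  "('k, 'r) ring_scheme \<Rightarrow> ('o, 'k, 'm, 'e, 'z) extri_cat_scheme \<Rightarrow> nat \<Rightarrow> 'o \<Rightarrow> 'o \<Rightarrow> nat"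
  where
    "ext_dim K \<C> 0 X Y = vectorspace.dim K (Hom \<C> X Y)"
  | "ext_dim K \<C> (Suc 0) X Y = vectorspace.dim K (Ext1 \<C> X Y)"
  | "ext_dim K \<C> (Suc (Suc n)) X Y = vectorspace.dim K (higher_ext K \<C> (Suc (Suc n)) X Y)"

fun ext_card ::
  "('k, 'r) ring_scheme \<Rightarrow> ('o, 'k, 'm, 'e, 'z) extri_cat_scheme \<Rightarrow> nat \<Rightarrow> 'o \<Rightarrow> 'o \<Rightarrow> nat"
  where
    "ext_card K \<C> 0 X Y = card (mor \<C> X Y)"
  | "ext_card K \<C> (Suc 0) X Y = card (carrier (Ext1 \<C> X Y))"
  | "ext_card K \<C> (Suc (Suc n)) X Y = card (carrier (higher_ext K \<C> (Suc (Suc n)) X Y))"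

text \<open>The factor of index \<open>n\<close> in the product below is the one of degree \<open>i = n + 1\<close>.\<close>

definition euler_curly ::
  "('k, 'r) ring_scheme \<Rightarrow> ('o, 'k, 'm, 'e, 'z) extri_cat_scheme \<Rightarrow> 'o \<Rightarrow> 'o \<Rightarrow> real"
  where "euler_curly K \<C> X Y =
    (\<Prod>n. real (ext_card K \<C> (Suc n) X Y) powi ((-1) ^ Suc n))"

definition euler_square ::
  "('k, 'r) ring_scheme \<Rightarrow> ('o, 'k, 'm, 'e, 'z) extri_cat_scheme \<Rightarrow> 'o \<Rightarrow> 'o \<Rightarrow> real"
  where "euler_square K \<C> X Y = 1 / (euler_curly K \<C> X Y * real (card (mor \<C> X Y)))"

end

theory Submission
  imports Defs
begin

text \<open>
  Let \<open>\<delta>\<close> be realized by \<open>f : X \<rightarrow> L\<close> and \<open>g : L \<rightarrow> Y\<close>. The group \<open>Aut X\<close> acts transitively on the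
  triangles from \<open>X\<close> to \<open>Y\<close> with the same \<open>g\<close>, and the stabilizer consists of all \<open>1 + u\<close> with
  \<open>f u = 0\<close> and \<open>u\<^sub>* \<delta> = 0\<close>: such a \<open>u\<close> factors through \<open>f\<close>, so \<open>u\<^sup>2 = 0\<close>. Dually for \<open>Aut Y\<close>.
  By (ET3) and its dual, the elements \<open>u\<^sub>* \<delta>\<close> with \<open>f u = 0\<close> are the elements \<open>v\<^sup>* \<delta>\<close> with
  \<open>v g = 0\<close>. Hence the orders of the two stabilizers are proportional to the numbers of
  \<open>u \<in> End X\<close> with \<open>f u = 0\<close> and of \<open>v \<in> End Y\<close> with \<open>v g = 0\<close>, and the long exact sequences of
  \<open>\<E>(X, -)\<close> and \<open>\<E>(-, Y)\<close> express these numbers by Euler forms.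

  The long exact sequences rest on the fact that \<open>\<xi> \<otimes> \<delta> = 0\<close> in \<open>\<E>\<^sup>n\<^sup>+\<^sup>1\<close>, \<open>n \<ge> 1\<close>, if and only
  if \<open>\<delta> = a\<^sub>* \<epsilon>\<close> and \<open>a\<^sup>* \<xi> = 0\<close> for some \<open>a\<close> and \<open>\<epsilon>\<close>. This holds because every element of
  \<open>\<E>\<^sup>n\<close> is killed by pulling it back along some deflation. Exactness then passes from degree
  \<open>n\<close> to degree \<open>n + 1\<close>.
\<close>

section \<open>Exact sequences of low degree\<close>

text \<open>The obstacle is the hard direction of the criterion for tensors: \<open>yeq\<close> is a
  generated relation, so an equation may rest on a long chain of rules through unrelated
  intermediate objects. Such chains are collapsed by \<open>yrel\<close>, agreement at one stage,
  where a stage is an extension \<open>\<epsilon>\<close> over a fixed object from which the right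
  factors of all tensors involved are pushed forward. Biproducts give common refinements of stages.
  Representatives at a stage are not unique, and this is where killing elements by deflations
  enters: what refinement equalizes is not two maps with the same pushforward of
  \<open>\<epsilon>\<close>, but their effect on a given element.

  In the final count the fibres of the projections from triangles to deflations or inflations vary
  in size. Both counts are therefore written as sums over the same triangles, weighted by stabilizer
  orders, and compared summand by summand. The Euler form of (X, Y) occurs in both kernel orders and
  cancels.\<close>

lemma module_hom_zero:
  assumes "vectorspace K V" "vectorspace K W" "f \<in> LinearCombinations.module_hom K V W"
  shows "f \<zero>\<^bsub>V\<^esub> = \<zero>\<^bsub>W\<^esub>"
proof -
  interpret mod_hom K V W f
    using assms by (simp add: mod_hom_def mod_hom_axioms_def vectorspace_def)
  show ?thesis by simp
qed

lemma module_hom_uminus: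
  assumes V: "vectorspace K V" and W: "vectorspace K W"
    and f: "f \<in> LinearCombinations.module_hom K V W" and v: "v \<in> carrier V"
  shows "f (\<ominus>\<^bsub>V\<^esub> v) = \<ominus>\<^bsub>W\<^esub> f v"
proof -
  interpret V: vectorspace K V by fact
  interpret W: vectorspace K W by fact
  have closed: "f u \<in> carrier W" if "u \<in> carrier V" for u
    using module_hom_closed[OF f] that by blast
  have "f (\<ominus>\<^bsub>V\<^esub> v) \<oplus>\<^bsub>W\<^esub> f v = \<zero>\<^bsub>W\<^esub>"
    using module_hom_add[OF f, of "\<ominus>\<^bsub>V\<^esub> v" v] module_hom_zero[OF V W f] v
    by (simp add: V.M.l_neg)
  then show ?thesis
    using closed v by (metis V.M.a_inv_closed W.M.minus_equality)
qed

lemma module_hom_minus: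
  assumes V: "vectorspace K V" and W: "vectorspace K W"
    and f: "f \<in> LinearCombinations.module_hom K V W" and "v \<in> carrier V" "w \<in> carrier V"
  shows "f (v \<ominus>\<^bsub>V\<^esub> w) = f v \<ominus>\<^bsub>W\<^esub> f w"
proof -
  interpret V: vectorspace K V by fact
  show ?thesis
    using module_hom_add[OF f, of v "\<ominus>\<^bsub>V\<^esub> w"] module_hom_uminus[OF V W f, of w] assms
    by (simp add: a_minus_def)
qed

section \<open>Arithmetic of morphisms and criteria for invertibility\<close>

context linear_additive_category
begin

abbreviation "obj \<equiv> Ob \<C>"
abbreviation "arr X Y \<equiv> mor \<C> X Y"
abbreviation "zhom X Y \<equiv> \<zero>\<^bsub>Hom \<C> X Y\<^esub>"
abbreviation "idn X \<equiv> ident \<C> X"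
abbreviation "isos X Y \<equiv> iso_mor \<C> X Y"
abbreviation "auts X \<equiv> Aut \<C> X"

lemma comp_closed:
  "\<lbrakk>f \<in> arr X Y; g \<in> arr Y Z; X \<in> obj; Y \<in> obj; Z \<in> obj\<rbrakk> \<Longrightarrow> g \<cdot> f \<in> arr X Z"
  using module_hom_closed[OF comp_linear_left] by blast

lemma comp_assoc':
  "\<lbrakk>f \<in> arr W X; g \<in> arr X Y; h \<in> arr Y Z; W \<in> obj; X \<in> obj; Y \<in> obj; Z \<in> obj\<rbrakk>
    \<Longrightarrow> (h \<cdot> g) \<cdot> f = h \<cdot> (g \<cdot> f)"
  using comp_assoc by blast

lemma Hom_abelian_group: "\<lbrakk>X \<in> obj; Y \<in> obj\<rbrakk> \<Longrightarrow> abelian_group (Hom \<C> X Y)"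
  using Hom_vectorspace by (simp add: vectorspace_def module_def)

lemma comp_add_left:
  "\<lbrakk>f \<in> arr X Y; g \<in> arr Y Z; g' \<in> arr Y Z; X \<in> obj; Y \<in> obj; Z \<in> obj\<rbrakk>
    \<Longrightarrow> (g \<oplus>\<^bsub>Hom \<C> Y Z\<^esub> g') \<cdot> f = (g \<cdot> f) \<oplus>\<^bsub>Hom \<C> X Z\<^esub> (g' \<cdot> f)"
  using module_hom_add[OF comp_linear_left] by blast

lemma comp_add_right:
  "\<lbrakk>g \<in> arr Y Z; f \<in> arr X Y; f' \<in> arr X Y; X \<in> obj; Y \<in> obj; Z \<in> obj\<rbrakk>
    \<Longrightarrow> g \<cdot> (f \<oplus>\<^bsub>Hom \<C> X Y\<^esub> f') = (g \<cdot> f) \<oplus>\<^bsub>Hom \<C> X Z\<^esub> (g \<cdot> f')"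
  using module_hom_add[OF comp_linear_right] by blast

lemma comp_minus_left:
  "\<lbrakk>f \<in> arr X Y; g \<in> arr Y Z; g' \<in> arr Y Z; X \<in> obj; Y \<in> obj; Z \<in> obj\<rbrakk>
    \<Longrightarrow> (g \<ominus>\<^bsub>Hom \<C> Y Z\<^esub> g') \<cdot> f = (g \<cdot> f) \<ominus>\<^bsub>Hom \<C> X Z\<^esub> (g' \<cdot> f)"
  using module_hom_minus[OF Hom_vectorspace Hom_vectorspace comp_linear_left] by blast

lemma comp_minus_right:
  "\<lbrakk>g \<in> arr Y Z; f \<in> arr X Y; f' \<in> arr X Y; X \<in> obj; Y \<in> obj; Z \<in> obj\<rbrakk>
    \<Longrightarrow> g \<cdot> (f \<ominus>\<^bsub>Hom \<C> X Y\<^esub> f') = (g \<cdot> f) \<ominus>\<^bsub>Hom \<C> X Z\<^esub> (g \<cdot> f')"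
  using module_hom_minus[OF Hom_vectorspace Hom_vectorspace comp_linear_right] by blast

lemma comp_zero_left:
  "\<lbrakk>f \<in> arr X Y; X \<in> obj; Y \<in> obj; Z \<in> obj\<rbrakk>
    \<Longrightarrow> (zhom Y Z) \<cdot> f = zhom X Z"
  using module_hom_zero[OF Hom_vectorspace Hom_vectorspace comp_linear_left] by blast

lemma comp_zero_right:
  "\<lbrakk>g \<in> arr Y Z; X \<in> obj; Y \<in> obj; Z \<in> obj\<rbrakk>
    \<Longrightarrow> g \<cdot> (zhom X Y) = zhom X Z"
  using module_hom_zero[OF Hom_vectorspace Hom_vectorspace comp_linear_right] by blast

lemma zero_mor: "\<lbrakk>X \<in> obj; Y \<in> obj\<rbrakk> \<Longrightarrow> (zhom X Y) \<in> arr X Y"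
  using abelian_groupE(2)[OF Hom_abelian_group] .

lemma add_mor:
  "\<lbrakk>f \<in> arr X Y; g \<in> arr X Y; X \<in> obj; Y \<in> obj\<rbrakk> \<Longrightarrow> f \<oplus>\<^bsub>Hom \<C> X Y\<^esub> g \<in> arr X Y"
  using abelian_groupE(1)[OF Hom_abelian_group] by blast

lemma minus_mor:
  "\<lbrakk>f \<in> arr X Y; g \<in> arr X Y; X \<in> obj; Y \<in> obj\<rbrakk> \<Longrightarrow> f \<ominus>\<^bsub>Hom \<C> X Y\<^esub> g \<in> arr X Y"
  using abelian_group.minus_closed[OF Hom_abelian_group] by blast

lemma zero_objectD:
  assumes "zero_object \<C> Z"
  shows "Z \<in> obj"
    and "\<lbrakk>f \<in> arr X Z; X \<in> obj\<rbrakk> \<Longrightarrow> f = zhom X Z"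
    and "\<lbrakk>f \<in> arr Z X; X \<in> obj\<rbrakk> \<Longrightarrow> f = zhom Z X"
  using assms zero_mor unfolding zero_object_def by blast+

lemma iso_mor_ident: "X \<in> obj \<Longrightarrow> idn X \<in> isos X X"
  by (auto simp: iso_mor_def comp_ident_left ident_mor)

lemma iso_mor_comp:
  assumes "f \<in> isos X Y" "g \<in> isos Y Z" "X \<in> obj" "Y \<in> obj" "Z \<in> obj"
  shows "g \<cdot> f \<in> isos X Z"
proof -
  obtain f' where f: "f \<in> arr X Y" "f' \<in> arr Y X" "f' \<cdot> f = idn X" "f \<cdot> f' = idn Y"
    using assms(1) by (auto simp: iso_mor_def)
  obtain g' where g: "g \<in> arr Y Z" "g' \<in> arr Z Y" "g' \<cdot> g = idn Y" "g \<cdot> g' = idn Z"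
    using assms(2) by (auto simp: iso_mor_def)
  have gf: "g \<cdot> f \<in> arr X Z" and fg': "f' \<cdot> g' \<in> arr Z X"
    using f g assms by (auto intro: comp_closed)
  have "(f' \<cdot> g') \<cdot> (g \<cdot> f) = f' \<cdot> (g' \<cdot> (g \<cdot> f))"
    using comp_assoc'[OF gf g(2) f(2)] assms by simp
  also have "\<dots> = idn X"
    using comp_assoc'[OF f(1) g(1) g(2)] f g assms by (simp add: comp_ident_left)
  finally have 1: "(f' \<cdot> g') \<cdot> (g \<cdot> f) = idn X" .
  have "(g \<cdot> f) \<cdot> (f' \<cdot> g') = g \<cdot> (f \<cdot> (f' \<cdot> g'))"
    using comp_assoc'[OF fg' f(1) g(1)] assms by simp
  also have "\<dots> = idn Z"
    using comp_assoc'[OF g(2) f(2) f(1)] f g assms by (simp add: comp_ident_left)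
  finally show ?thesis using 1 gf fg' by (auto simp: iso_mor_def)
qed

lemma iso_mor_imp_mor: "f \<in> isos X Y \<Longrightarrow> f \<in> arr X Y"
  by (auto simp: iso_mor_def)

text \<open>The composites \<open>h \<cdot> g\<close> and \<open>g \<cdot> k\<close> are a left and
  a right inverse of \<open>f\<close>, hence equal. Comparison maps between triangles are shown to
  be invertible in this way, since only their round trips are under control.\<close>

lemma iso_morI_two_sided:
  assumes f: "f \<in> arr X Y" and g: "g \<in> arr Y X"
    and gf: "g \<cdot> f \<in> isos X X" and fg: "f \<cdot> g \<in> isos Y Y"
    and ob: "X \<in> obj" "Y \<in> obj"
  shows "f \<in> isos X Y"
proof -
  obtain h where h: "h \<in> arr X X" "h \<cdot> (g \<cdot> f) = idn X"
    using gf by (auto simp: iso_mor_def)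
  obtain k where k: "k \<in> arr Y Y" "(f \<cdot> g) \<cdot> k = idn Y"
    using fg by (auto simp: iso_mor_def)
  define l where "l = h \<cdot> g"
  define r where "r = g \<cdot> k"
  have l: "l \<in> arr Y X" "l \<cdot> f = idn X"
    using comp_assoc'[OF f g h(1)] h g ob by (auto simp: l_def intro: comp_closed)
  have r: "r \<in> arr Y X" "f \<cdot> r = idn Y"
    using comp_assoc'[OF k(1) g f] k g ob by (auto simp: r_def intro: comp_closed)
  have "l = r"
    using comp_assoc'[OF r(1) f l(1)] l r ob by (simp add: comp_ident_left comp_ident_right)
  then show ?thesis using f l r by (auto simp: iso_mor_def)
qed

text \<open>The inverse is the truncated geometric series 1 - \<open>u\<close>.\<close>

lemma ident_add_square_zero_iso:
  assumes u: "u \<in> arr X X" and sq: "u \<cdot> u = zhom X X" and X: "X \<in> obj"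
  shows "idn X \<oplus>\<^bsub>Hom \<C> X X\<^esub> u \<in> isos X X"
proof -
  interpret H: abelian_group "Hom \<C> X X" by (rule Hom_abelian_group[OF X X])
  let ?i = "idn X"
  have i: "?i \<in> arr X X" by (rule ident_mor[OF X])
  have p: "?i \<oplus>\<^bsub>Hom \<C> X X\<^esub> u \<in> arr X X" and m: "?i \<ominus>\<^bsub>Hom \<C> X X\<^esub> u \<in> arr X X"
    using i u by auto
  have z: "\<ominus>\<^bsub>Hom \<C> X X\<^esub> (zhom X X) = zhom X X"
    by (metis H.a_inv_closed H.l_zero H.r_neg H.zero_closed)
  have 1: "(?i \<ominus>\<^bsub>Hom \<C> X X\<^esub> u) \<cdot> (?i \<oplus>\<^bsub>Hom \<C> X X\<^esub> u) = ?i"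
    using comp_minus_left[OF p i u X X X] comp_add_right[OF u i u X X X]
      comp_ident_left[OF X X p] comp_ident_right[OF X X u] sq i u
    by (simp add: a_minus_def H.a_assoc H.r_neg)
  have 2: "(?i \<oplus>\<^bsub>Hom \<C> X X\<^esub> u) \<cdot> (?i \<ominus>\<^bsub>Hom \<C> X X\<^esub> u) = ?i"
    using comp_add_left[OF m i u X X X] comp_minus_right[OF u i u X X X]
      comp_ident_left[OF X X m] comp_ident_right[OF X X u] sq i u
    by (simp add: a_minus_def H.a_assoc H.l_neg z)
  show ?thesis using 1 2 p m by (auto simp: iso_mor_def)
qed

lemma finite_Aut: "finite (arr X X) \<Longrightarrow> finite (auts X)"
  by (simp add: Aut_def iso_mor_def)

end

context linear_extriangulated_category
begin

abbreviation "ext C A \<equiv> carrier (Ext1 \<C> C A)"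
abbreviation "zext C A \<equiv> \<zero>\<^bsub>Ext1 \<C> C A\<^esub>"
abbreviation "psh a \<delta> \<equiv> push \<C> a \<delta>"
abbreviation "pll c \<delta> \<equiv> pull \<C> c \<delta>"
abbreviation "etri A x B y C \<delta> \<equiv> etriangle \<C> A x B y C \<delta>"

lemma Ext1_abelian_group: "\<lbrakk>C \<in> obj; A \<in> obj\<rbrakk> \<Longrightarrow> abelian_group (Ext1 \<C> C A)"
  using ET1_vectorspace by (simp add: vectorspace_def module_def)

lemma zero_Ext1: "\<lbrakk>C \<in> obj; A \<in> obj\<rbrakk> \<Longrightarrow> (zext C A) \<in> ext C A"
  using abelian_groupE(2)[OF Ext1_abelian_group] .

lemma push_closed:
  "\<lbrakk>\<delta> \<in> ext C A; a \<in> arr A A'; C \<in> obj; A \<in> obj; A' \<in> obj\<rbrakk>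
    \<Longrightarrow> psh a \<delta> \<in> ext C A'"
  using module_hom_closed[OF ET1_push_linear] by blast

lemma pull_closed:
  "\<lbrakk>\<delta> \<in> ext C A; c \<in> arr C' C; C \<in> obj; C' \<in> obj; A \<in> obj\<rbrakk>
    \<Longrightarrow> pll c \<delta> \<in> ext C' A"
  using module_hom_closed[OF ET1_pull_linear] by blast

lemma push_zero:
  "\<lbrakk>a \<in> arr A A'; C \<in> obj; A \<in> obj; A' \<in> obj\<rbrakk>
    \<Longrightarrow> psh a (zext C A) = zext C A'"
  using module_hom_zero[OF ET1_vectorspace ET1_vectorspace ET1_push_linear] by blast

lemma pull_zero:
  "\<lbrakk>c \<in> arr C' C; C \<in> obj; C' \<in> obj; A \<in> obj\<rbrakk>
    \<Longrightarrow> pll c (zext C A) = zext C' A"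
  using module_hom_zero[OF ET1_vectorspace ET1_vectorspace ET1_pull_linear] by blast

lemma push_add:
  "\<lbrakk>\<delta> \<in> ext C A; \<epsilon> \<in> ext C A; a \<in> arr A A';
    C \<in> obj; A \<in> obj; A' \<in> obj\<rbrakk>
    \<Longrightarrow> psh a (\<delta> \<oplus>\<^bsub>Ext1 \<C> C A\<^esub> \<epsilon>) = psh a \<delta> \<oplus>\<^bsub>Ext1 \<C> C A'\<^esub> psh a \<epsilon>"
  using module_hom_add[OF ET1_push_linear] by blast

lemma pull_add:
  "\<lbrakk>\<delta> \<in> ext C A; \<epsilon> \<in> ext C A; c \<in> arr C' C;
    C \<in> obj; C' \<in> obj; A \<in> obj\<rbrakk>
    \<Longrightarrow> pll c (\<delta> \<oplus>\<^bsub>Ext1 \<C> C A\<^esub> \<epsilon>) = pll c \<delta> \<oplus>\<^bsub>Ext1 \<C> C' A\<^esub> pll c \<epsilon>"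
  using module_hom_add[OF ET1_pull_linear] by blast

lemma push_smult:
  "\<lbrakk>r \<in> carrier K; \<delta> \<in> ext C A; a \<in> arr A A'; C \<in> obj; A \<in> obj; A' \<in> obj\<rbrakk>
    \<Longrightarrow> psh a (r \<odot>\<^bsub>Ext1 \<C> C A\<^esub> \<delta>) = r \<odot>\<^bsub>Ext1 \<C> C A'\<^esub> psh a \<delta>"
  using module_hom_smult[OF ET1_push_linear] by blast

lemma pull_smult:
  "\<lbrakk>r \<in> carrier K; \<delta> \<in> ext C A; c \<in> arr C' C; C \<in> obj; C' \<in> obj; A \<in> obj\<rbrakk>
    \<Longrightarrow> pll c (r \<odot>\<^bsub>Ext1 \<C> C A\<^esub> \<delta>) = r \<odot>\<^bsub>Ext1 \<C> C' A\<^esub> pll c \<delta>"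
  using module_hom_smult[OF ET1_pull_linear] by blast

lemma push_mor_add:
  "\<lbrakk>\<delta> \<in> ext C A; a \<in> arr A A'; a' \<in> arr A A';
    C \<in> obj; A \<in> obj; A' \<in> obj\<rbrakk>
    \<Longrightarrow> psh (a \<oplus>\<^bsub>Hom \<C> A A'\<^esub> a') \<delta> = psh a \<delta> \<oplus>\<^bsub>Ext1 \<C> C A'\<^esub> psh a' \<delta>"
  using module_hom_add[OF ET1_push_bilinear] by blast

lemma push_mor_minus:
  "\<lbrakk>\<delta> \<in> ext C A; a \<in> arr A A'; a' \<in> arr A A';
    C \<in> obj; A \<in> obj; A' \<in> obj\<rbrakk>
    \<Longrightarrow> psh (a \<ominus>\<^bsub>Hom \<C> A A'\<^esub> a') \<delta> = psh a \<delta> \<ominus>\<^bsub>Ext1 \<C> C A'\<^esub> psh a' \<delta>"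
  using module_hom_minus[OF Hom_vectorspace ET1_vectorspace ET1_push_bilinear] by blast

lemma push_mor_zero:
  "\<lbrakk>\<delta> \<in> ext C A; C \<in> obj; A \<in> obj; A' \<in> obj\<rbrakk>
    \<Longrightarrow> psh (zhom A A') \<delta> = zext C A'"
  using module_hom_zero[OF Hom_vectorspace ET1_vectorspace ET1_push_bilinear] by blast

lemma push_mor_smult:
  "\<lbrakk>r \<in> carrier K; \<delta> \<in> ext C A; a \<in> arr A A'; C \<in> obj; A \<in> obj; A' \<in> obj\<rbrakk>
    \<Longrightarrow> psh (r \<odot>\<^bsub>Hom \<C> A A'\<^esub> a) \<delta> = r \<odot>\<^bsub>Ext1 \<C> C A'\<^esub> psh a \<delta>"
  using module_hom_smult[OF ET1_push_bilinear] by blast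

lemma pull_mor_add:
  "\<lbrakk>\<delta> \<in> ext C A; c \<in> arr C' C; c' \<in> arr C' C;
    C \<in> obj; C' \<in> obj; A \<in> obj\<rbrakk>
    \<Longrightarrow> pll (c \<oplus>\<^bsub>Hom \<C> C' C\<^esub> c') \<delta> = pll c \<delta> \<oplus>\<^bsub>Ext1 \<C> C' A\<^esub> pll c' \<delta>"
  using module_hom_add[OF ET1_pull_bilinear] by blast

lemma pull_mor_minus:
  "\<lbrakk>\<delta> \<in> ext C A; c \<in> arr C' C; c' \<in> arr C' C;
    C \<in> obj; C' \<in> obj; A \<in> obj\<rbrakk>
    \<Longrightarrow> pll (c \<ominus>\<^bsub>Hom \<C> C' C\<^esub> c') \<delta> = pll c \<delta> \<ominus>\<^bsub>Ext1 \<C> C' A\<^esub> pll c' \<delta>"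
  using module_hom_minus[OF Hom_vectorspace ET1_vectorspace ET1_pull_bilinear] by blast

lemma pull_mor_smult:
  "\<lbrakk>r \<in> carrier K; \<delta> \<in> ext C A; c \<in> arr C' C; C \<in> obj; C' \<in> obj; A \<in> obj\<rbrakk>
    \<Longrightarrow> pll (r \<odot>\<^bsub>Hom \<C> C' C\<^esub> c) \<delta> = r \<odot>\<^bsub>Ext1 \<C> C' A\<^esub> pll c \<delta>"
  using module_hom_smult[OF ET1_pull_bilinear] by blast

lemma push_comp:
  "\<lbrakk>\<delta> \<in> ext C A; a \<in> arr A A'; a' \<in> arr A' A'';
    C \<in> obj; A \<in> obj; A' \<in> obj; A'' \<in> obj\<rbrakk>
    \<Longrightarrow> psh (a' \<cdot> a) \<delta> = psh a' (psh a \<delta>)"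
  using ET1_push_comp by blast

lemma pull_comp:
  "\<lbrakk>\<delta> \<in> ext C A; c \<in> arr C' C; c' \<in> arr C'' C';
    C \<in> obj; C' \<in> obj; C'' \<in> obj; A \<in> obj\<rbrakk>
    \<Longrightarrow> pll (c \<cdot> c') \<delta> = pll c' (pll c \<delta>)"
  using ET1_pull_comp by blast

lemma push_pull:
  "\<lbrakk>\<delta> \<in> ext C A; a \<in> arr A A'; c \<in> arr C' C;
    C \<in> obj; C' \<in> obj; A \<in> obj; A' \<in> obj\<rbrakk>
    \<Longrightarrow> psh a (pll c \<delta>) = pll c (psh a \<delta>)"
  using ET1_push_pull by blast

section \<open>Realizations and trivial triangles\<close>

lemma seq_equiv_refl: "\<lbrakk>s \<in> sequences \<C> A C; A \<in> obj; C \<in> obj\<rbrakk> \<Longrightarrow> (s, s) \<in> seq_equiv \<C> A C"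
  by (auto simp: seq_equiv_def sequences_def comp_ident_left comp_ident_right
      intro!: bexI[OF _ iso_mor_ident])

lemma realn_class:
  assumes "C \<in> obj" "A \<in> obj" "\<delta> \<in> ext C A"
  obtains s where "s \<in> sequences \<C> A C" "realn \<C> C A \<delta> = seq_equiv \<C> A C `` {s}"
  using ET2_class[OF assms] by (auto elim: quotientE)

lemma etriangleD:
  assumes "etri A x B y C \<delta>"
  shows "A \<in> obj" "B \<in> obj" "C \<in> obj" "x \<in> arr A B" "y \<in> arr B C"
    "\<delta> \<in> ext C A"
proof -
  show *: "A \<in> obj" "C \<in> obj" "\<delta> \<in> ext C A"
    using assms by (auto simp: etriangle_def)
  have r: "(B, x, y) \<in> realn \<C> C A \<delta>"
    using assms by (auto simp: etriangle_def)
  have "(B, x, y) \<in> sequences \<C> A C"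
    by (rule realn_class[OF *(2,1,3)]) (use r in \<open>auto simp: seq_equiv_def\<close>)
  then show "B \<in> obj" "x \<in> arr A B" "y \<in> arr B C"
    by (auto simp: sequences_def)
qed

lemma ex_etriangle:
  assumes "\<delta> \<in> ext C A" "C \<in> obj" "A \<in> obj"
  obtains B x y where "etri A x B y C \<delta>"
proof -
  obtain s where s: "s \<in> sequences \<C> A C" "realn \<C> C A \<delta> = seq_equiv \<C> A C `` {s}"
    using realn_class assms by blast
  then have "s \<in> realn \<C> C A \<delta>"
    using seq_equiv_refl assms by blast
  then show thesis
    using that assms by (cases s) (auto simp: etriangle_def)
qed

text \<open>The class is the image of one representative
  \<open>(B\<^sub>0, x\<^sub>0, y\<^sub>0)\<close>; composing its isomorphism to
  \<open>(B, x, y)\<close> with \<open>b\<close> stays in that image.\<close>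

lemma etriangle_equiv:
  assumes T: "etri A x B y C \<delta>" and b: "b \<in> isos B B'" "b \<cdot> x = x'" "y' \<cdot> b = y"
    and B': "B' \<in> obj" and y': "y' \<in> arr B' C"
  shows "etri A x' B' y' C \<delta>"
proof -
  note t = etriangleD[OF T]
  obtain B\<^sub>0 x\<^sub>0 y\<^sub>0 where s: "(B\<^sub>0, x\<^sub>0, y\<^sub>0) \<in> sequences \<C> A C"
      "realn \<C> C A \<delta> = seq_equiv \<C> A C `` {(B\<^sub>0, x\<^sub>0, y\<^sub>0)}"
    using realn_class[OF t(3,1,6)] by (metis prod_cases3)
  have "((B\<^sub>0, x\<^sub>0, y\<^sub>0), (B, x, y)) \<in> seq_equiv \<C> A C"
    using T s by (auto simp: etriangle_def)
  then obtain b\<^sub>0 where b\<^sub>0: "b\<^sub>0 \<in> isos B\<^sub>0 B" "b\<^sub>0 \<cdot> x\<^sub>0 = x" "y \<cdot> b\<^sub>0 = y\<^sub>0"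
    by (auto simp: seq_equiv_def)
  have 0: "B\<^sub>0 \<in> obj" "x\<^sub>0 \<in> arr A B\<^sub>0" "y\<^sub>0 \<in> arr B\<^sub>0 C"
    using s by (auto simp: sequences_def)
  have bm: "b \<in> arr B B'" "b\<^sub>0 \<in> arr B\<^sub>0 B"
    using b b\<^sub>0 by (auto simp: iso_mor_def)
  have x': "x' \<in> arr A B'"
    using b(2) comp_closed[OF t(4) bm(1) t(1,2) B'] by simp
  have "b \<cdot> b\<^sub>0 \<in> isos B\<^sub>0 B'"
    by (rule iso_mor_comp[OF b\<^sub>0(1) b(1) 0(1) t(2) B'])
  moreover have "(b \<cdot> b\<^sub>0) \<cdot> x\<^sub>0 = x'"
    using comp_assoc'[OF 0(2) bm(2,1) t(1) 0(1) t(2) B'] b b\<^sub>0 by simp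
  moreover have "y' \<cdot> (b \<cdot> b\<^sub>0) = y\<^sub>0"
    using comp_assoc'[OF bm(2,1) y' 0(1) t(2) B' t(3)] b b\<^sub>0 by simp
  ultimately have "((B\<^sub>0, x\<^sub>0, y\<^sub>0), (B', x', y')) \<in> seq_equiv \<C> A C"
    using s(1) x' y' B' by (auto simp: seq_equiv_def sequences_def)
  then show ?thesis using s t by (auto simp: etriangle_def)
qed

text \<open>The biproduct of the zero object and \<open>W\<close> gives a split triangle. Maps
  between an arbitrary triangle and such trivial ones turn (ET2), (ET3) and its dual into the
  lifting and extension properties below.\<close>

lemma etriangle_ident_right:
  assumes "zero_object \<C> Z" "W \<in> obj"
  shows "etri Z (zhom Z W) W (idn W) W (zext W Z)"
proof -
  note Z = zero_objectD[OF assms(1)]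
  interpret W: abelian_group "Hom \<C> W W" using Hom_abelian_group assms by blast
  have zz: "(zhom W Z) \<cdot> (zhom Z W) = idn Z"
    using Z assms by (metis comp_closed ident_mor zero_mor)
  have "biproduct \<C> Z W W (zhom Z W) (idn W) (zhom W Z) (idn W)"
    using Z(1) assms(2) zz unfolding biproduct_def
    by (simp add: zero_mor ident_mor comp_ident_left[of W W] comp_ident_left[of Z W]
        comp_ident_right[of W Z] comp_zero_left[of _ W Z W])
  then show ?thesis
    using ET2_zero Z(1) assms(2) zero_Ext1 by (auto simp: etriangle_def)
qed

lemma etriangle_ident_left:
  assumes "zero_object \<C> Z" "W \<in> obj"
  shows "etri W (idn W) W (zhom W Z) Z (zext Z W)"
proof -
  note Z = zero_objectD[OF assms(1)]
  interpret W: abelian_group "Hom \<C> W W" using Hom_abelian_group assms by blast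
  have zz: "(zhom W Z) \<cdot> (zhom Z W) = idn Z"
    using Z assms by (metis comp_closed ident_mor zero_mor)
  have "biproduct \<C> W Z W (idn W) (zhom Z W) (idn W) (zhom W Z)"
    using Z(1) assms(2) zz unfolding biproduct_def
    by (simp add: zero_mor ident_mor comp_ident_left[of W W] comp_ident_left[of Z W]
        comp_ident_right[of W Z] comp_zero_left[of _ W Z W])
  then show ?thesis
    using ET2_zero Z(1) assms(2) zero_Ext1 by (auto simp: etriangle_def)
qed

section \<open>Exactness at the Hom terms and in degree one\<close>

lemma zero_object_exists:
  obtains Z where "zero_object \<C> Z" "Z \<in> obj"
  using ex_zero_object zero_objectD(1) by blast

context
  fixes A x B y C \<delta>
  assumes T: "etri A x B y C \<delta>"
begin

private lemmas low_tri = etriangleD[OF T]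

text \<open>(ET3) for the maps \<open>idn A\<close> and \<open>x\<close> from the trivial triangle
  on \<open>A\<close> forces \<open>y \<cdot> x\<close> to factor through the zero object.\<close>

lemma etriangle_comp_zero: "y \<cdot> x = zhom A C"
proof -
  obtain Z where z: "zero_object \<C> Z" and Z: "Z \<in> obj" using zero_object_exists .
  have "x \<cdot> idn A = x \<cdot> idn A" ..
  then obtain c where c: "c \<in> arr Z C" "c \<cdot> (zhom A Z) = y \<cdot> x"
    using ET3[OF etriangle_ident_left[OF z low_tri(1)] T ident_mor[OF low_tri(1)] low_tri(4)] by auto
  then show ?thesis
    using comp_zero_right[OF c(1) low_tri(1) Z low_tri(3)] by simp
qed

text \<open>The extension of the trivial triangle on \<open>B\<close> lives over the zero object and
  is zero; the third map supplied by (ET3) exhibits \<open>psh x \<delta>\<close> as a pullback of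
  it.\<close>

lemma push_inflation: "psh x \<delta> = zext C B"
proof -
  obtain Z where z: "zero_object \<C> Z" and Z: "Z \<in> obj" using zero_object_exists .
  obtain c where c: "c \<in> arr C Z" "psh x \<delta> = pll c (zext Z B)"
    using ET3[OF T etriangle_ident_left[OF z low_tri(2)] low_tri(4) ident_mor[OF low_tri(2)]] by auto
  then show ?thesis using pull_zero[OF c(1) Z low_tri(3,2)] by simp
qed

lemma pull_deflation: "pll y \<delta> = zext B A"
proof -
  obtain Z where z: "zero_object \<C> Z" and Z: "Z \<in> obj" using zero_object_exists .
  obtain a where a: "a \<in> arr Z A" "psh a (zext B Z) = pll y \<delta>"
    using ET3_op[OF etriangle_ident_right[OF z low_tri(2)] T ident_mor[OF low_tri(2)] low_tri(5)] by auto
  then show ?thesis using push_zero[OF a(1) low_tri(2) Z low_tri(1)] by simp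
qed

text \<open>The trivial triangle on \<open>W\<close> is mapped to the given one with middle
  component \<open>u\<close> and third component zero; the dual of (ET3) supplies the first
  component, which is the factorization.\<close>

lemma exact_Hom_B_co:
  assumes W: "W \<in> obj" and u: "u \<in> arr W B" "y \<cdot> u = zhom W C"
  obtains v where "v \<in> arr W A" "u = x \<cdot> v"
proof -
  obtain Z where z: "zero_object \<C> Z" and Z: "Z \<in> obj" using zero_object_exists .
  have c: "(zhom Z C) \<in> arr Z C" using zero_mor Z low_tri by blast
  have "(zhom Z C) \<cdot> (zhom W Z) = y \<cdot> u"
    using comp_zero_right[OF c W Z low_tri(3)] u by simp
  then obtain a where "a \<in> arr W A" "u \<cdot> idn W = x \<cdot> a"
    using ET3_op[OF etriangle_ident_left[OF z W] T u(1) c] by blast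
  then show thesis using that comp_ident_right[OF W low_tri(2) u(1)] by simp
qed

text \<open>Here the trivial triangle has \<open>W\<close> as its right term. By (ET2) the morphism
  of extensions with component \<open>c\<close> is realized, and its middle component is the
  lift.\<close>

lemma exact_Hom_C_co:
  assumes W: "W \<in> obj" and c: "c \<in> arr W C" "pll c \<delta> = zext W A"
  obtains u where "u \<in> arr W B" "c = y \<cdot> u"
proof -
  obtain Z where z: "zero_object \<C> Z" and Z: "Z \<in> obj" using zero_object_exists .
  have a: "(zhom Z A) \<in> arr Z A" using zero_mor Z low_tri by blast
  have "psh (zhom Z A) (zext W Z) = pll c \<delta>"
    using push_zero[OF a W Z low_tri(1)] c by simp
  then obtain b where "b \<in> arr W B" "y \<cdot> b = c \<cdot> idn W"
    using ET2_morphism[OF etriangle_ident_right[OF z W] T a c(1)] by blast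
  then show thesis using that comp_ident_right[OF W low_tri(3) c(1)] by simp
qed

lemma exact_Hom_B_contra:
  assumes W: "W \<in> obj" and u: "u \<in> arr B W" "u \<cdot> x = zhom A W"
  obtains v where "v \<in> arr C W" "u = v \<cdot> y"
proof -
  obtain Z where z: "zero_object \<C> Z" and Z: "Z \<in> obj" using zero_object_exists .
  have a: "(zhom A Z) \<in> arr A Z" using zero_mor Z low_tri by blast
  have "u \<cdot> x = (zhom Z W) \<cdot> (zhom A Z)"
    using comp_zero_left[OF a low_tri(1) Z W] u by simp
  then obtain c where "c \<in> arr C W" "c \<cdot> y = idn W \<cdot> u"
    using ET3[OF T etriangle_ident_right[OF z W] a u(1)] by blast
  then show thesis using that comp_ident_left[OF low_tri(2) W u(1)] by simp
qed

lemma exact_Hom_A_contra: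
  assumes W: "W \<in> obj" and a: "a \<in> arr A W" "psh a \<delta> = zext C W"
  obtains u where "u \<in> arr B W" "a = u \<cdot> x"
proof -
  obtain Z where z: "zero_object \<C> Z" and Z: "Z \<in> obj" using zero_object_exists .
  have c: "(zhom C Z) \<in> arr C Z" using zero_mor Z low_tri by blast
  have "psh a \<delta> = pll (zhom C Z) (zext Z W)"
    using pull_zero[OF c Z low_tri(3) W] a by simp
  then obtain b where "b \<in> arr B W" "b \<cdot> x = idn W \<cdot> a"
    using ET2_morphism[OF T etriangle_ident_left[OF z W] a(1) c] by blast
  then show thesis using that comp_ident_left[OF low_tri(1) W a(1)] by simp
qed

end

text \<open>Realize \<open>\<epsilon>\<close> by an inflation \<open>u\<close>. Since
  \<open>x\<close> kills \<open>\<epsilon>\<close>, it extends along \<open>u\<close>, and (ET3)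
  completes \<open>idn A\<close> and this extension by the map \<open>c\<close>.\<close>

lemma exact_Ext_A_co:
  assumes T: "etri A x B y C \<delta>" and W: "W \<in> obj"
    and e: "\<epsilon> \<in> ext W A" "psh x \<epsilon> = zext W B"
  obtains c where "c \<in> arr W C" "\<epsilon> = pll c \<delta>"
proof -
  note t = etriangleD[OF T]
  obtain G u v where T': "etri A u G v W \<epsilon>" using ex_etriangle[OF e(1) W t(1)] .
  note t' = etriangleD[OF T']
  obtain b where b: "b \<in> arr G B" "x = b \<cdot> u"
    using exact_Hom_A_contra[OF T' t(2,4) e(2)] .
  have "b \<cdot> u = x \<cdot> idn A" using b comp_ident_right[OF t(1,2,4)] by simp
  then obtain c where "c \<in> arr W C" "psh (idn A) \<epsilon> = pll c \<delta>"
    using ET3[OF T' T ident_mor[OF t(1)] b(1)] by blast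
  then show thesis using that ET1_push_ident[OF W t(1) e(1)] by simp
qed

lemma exact_Ext_C_contra:
  assumes T: "etri A x B y C \<delta>" and W: "W \<in> obj"
    and e: "\<epsilon> \<in> ext C W" "pll y \<epsilon> = zext B W"
  obtains a where "a \<in> arr A W" "\<epsilon> = psh a \<delta>"
proof -
  note t = etriangleD[OF T]
  obtain G u v where T': "etri W u G v C \<epsilon>" using ex_etriangle[OF e(1) t(3) W] .
  note t' = etriangleD[OF T']
  obtain b where b: "b \<in> arr B G" "y = v \<cdot> b"
    using exact_Hom_C_co[OF T' t(2,5) e(2)] .
  have "idn C \<cdot> y = v \<cdot> b" using b comp_ident_left[OF t(2,3,5)] by simp
  then obtain a where "a \<in> arr A W" "psh a \<delta> = pll (idn C) \<epsilon>"
    using ET3_op[OF T T' b(1) ident_mor[OF t(3)]] by blast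
  then show thesis using that ET1_pull_ident[OF t(3) W e(1)] by simp
qed

text \<open>\<open>ET4_op\<close> yields \<open>e\<^sub>* \<epsilon> = y\<^sup>* \<delta>''\<close> for an inflation \<open>e\<close> realizing \<open>x\<^sup>* \<epsilon> = 0\<close>; it
  remains to apply a retraction of \<open>e\<close>.\<close>

lemma exact_Ext_B_contra:
  assumes T: "etri A x B y C \<delta>" and W: "W \<in> obj"
    and e: "\<epsilon> \<in> ext B W" "pll x \<epsilon> = zext A W"
  obtains \<theta> where "\<theta> \<in> ext C W" "\<epsilon> = pll y \<theta>"
proof -
  note t = etriangleD[OF T]
  obtain G u v where T': "etri W u G v B \<epsilon>" using ex_etriangle[OF e(1) t(2) W] .
  obtain E h' d i \<delta>'' where E: "E \<in> obj" "d \<in> arr E A" "i \<in> arr W E"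
      "etri E h' G (y \<cdot> v) C \<delta>''" "etri W i E d A (pll x \<epsilon>)"
      "pll y \<delta>'' = psh i \<epsilon>"
    using ET4_op[OF T T'] by blast
  have d'': "\<delta>'' \<in> ext C E" using etriangleD[OF E(4)] by blast
  have "psh (idn W) (pll x \<epsilon>) = zext A W"
    using ET1_push_ident[OF t(1) W zero_Ext1[OF t(1) W]] e(2) by simp
  then obtain r where r: "r \<in> arr E W" "idn W = r \<cdot> i"
    using exact_Hom_A_contra[OF E(5) W ident_mor[OF W]] by blast
  have "\<epsilon> = psh (r \<cdot> i) \<epsilon>" using ET1_push_ident[OF t(2) W e(1)] r by simp
  also have "\<dots> = psh r (pll y \<delta>'')"
    using push_comp[OF e(1) E(3) r(1) t(2) W E(1) W] E by simp
  also have "\<dots> = pll y (psh r \<delta>'')"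
    by (rule push_pull[OF d'' r(1) t(5,3,2) E(1) W])
  finally show thesis using that push_closed[OF d'' r(1) t(3) E(1) W] by blast
qed

text \<open>Dual to \<open>exact_Ext_B_contra\<close>: (ET4) gives
  \<open>psh x \<delta>'' = pll i \<epsilon>\<close> for a deflation \<open>i\<close> realizing the
  zero extension, and pulling back along a section of \<open>i\<close> recovers
  \<open>\<epsilon>\<close>.\<close>

lemma exact_Ext_B_co:
  assumes T: "etri A x B y C \<delta>" and W: "W \<in> obj"
    and e: "\<epsilon> \<in> ext W B" "psh y \<epsilon> = zext W C"
  obtains \<theta> where "\<theta> \<in> ext W A" "\<epsilon> = psh x \<theta>"
proof -
  note t = etriangleD[OF T]
  obtain G u v where T': "etri B u G v W \<epsilon>" using ex_etriangle[OF e(1) W t(2)] .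
  obtain E h' d i \<delta>'' where E: "E \<in> obj" "d \<in> arr C E" "i \<in> arr E W"
      "etri A (u \<cdot> x) G h' E \<delta>''" "etri C d E i W (psh y \<epsilon>)"
      "psh x \<delta>'' = pll i \<epsilon>"
    using ET4[OF T T'] by blast
  have d'': "\<delta>'' \<in> ext E A" using etriangleD[OF E(4)] by blast
  have "pll (idn W) (psh y \<epsilon>) = zext W C"
    using ET1_pull_ident[OF W t(3) zero_Ext1[OF W t(3)]] e(2) by simp
  then obtain r where r: "r \<in> arr W E" "idn W = i \<cdot> r"
    using exact_Hom_C_co[OF E(5) W ident_mor[OF W]] by blast
  have "\<epsilon> = pll (i \<cdot> r) \<epsilon>" using ET1_pull_ident[OF W t(2) e(1)] r by simp
  also have "\<dots> = pll r (psh x \<delta>'')"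
    using pull_comp[OF e(1) E(3) r(1) W E(1) W t(2)] E by simp
  also have "\<dots> = psh x (pll r \<delta>'')"
    by (rule push_pull[OF d'' t(4) r(1) E(1) W t(1,2), symmetric])
  finally show thesis using that pull_closed[OF d'' r(1) E(1) W t(1)] by blast
qed

text \<open>The dual of (ET4) maps the cocone of the composite deflation \<open>v \<cdot> h\<close>
  to \<open>M\<close>, compatibly with the extensions over \<open>W\<close>. This cocone stands in
  for a pullback of \<open>h\<close> along \<open>u\<close>.\<close>

lemma inflation_refine:
  assumes T: "etri M u G v W \<epsilon>" and T': "etri P p H h G \<theta>"
  obtains M' m \<epsilon>' k where "M' \<in> obj" "m \<in> arr M' M" "\<epsilon>' \<in> ext W M'"
    "psh m \<epsilon>' = \<epsilon>" "k \<in> arr M' H" "h \<cdot> k = u \<cdot> m"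
proof -
  obtain E h' d i \<delta>'' where E: "E \<in> obj" "d \<in> arr E M" "h \<cdot> h' = u \<cdot> d"
      "etri E h' H (v \<cdot> h) W \<delta>''" "psh d \<delta>'' = \<epsilon>"
    using ET4_op[OF T T'] by blast
  show thesis using that[OF E(1,2) _ E(5) _ E(3)] etriangleD[OF E(4)] by blast
qed

text \<open>An extension of \<open>W\<close> is regarded as finer than its pushforwards. The
  extension by the biproduct with components \<open>\<epsilon>\<close> and
  \<open>\<epsilon>'\<close> is finer than both.\<close>

lemma common_refinement:
  assumes e: "\<epsilon> \<in> ext W M" and e': "\<epsilon>' \<in> ext W M'"
    and ob: "W \<in> obj" "M \<in> obj" "M' \<in> obj"
  obtains N p p' \<eta> where "N \<in> obj" "p \<in> arr N M" "p' \<in> arr N M'"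
    "\<eta> \<in> ext W N" "psh p \<eta> = \<epsilon>" "psh p' \<eta> = \<epsilon>'"
proof -
  obtain N i j p q where b: "biproduct \<C> M M' N i j p q"
    using ex_biproduct ob by blast
  have N: "N \<in> obj" and i: "i \<in> arr M N" and j: "j \<in> arr M' N"
    and p: "p \<in> arr N M" and q: "q \<in> arr N M'"
    and pi: "p \<cdot> i = idn M" and qj: "q \<cdot> j = idn M'"
    and qi: "q \<cdot> i = zhom M M'" and pj: "p \<cdot> j = zhom M' M"
    using b by (auto simp: biproduct_def)
  note ie = push_closed[OF e i ob(1,2) N] and je = push_closed[OF e' j ob(1,3) N]
  define \<eta> where "\<eta> = psh i \<epsilon> \<oplus>\<^bsub>Ext1 \<C> W N\<^esub> psh j \<epsilon>'"
  interpret NE: abelian_group "Ext1 \<C> W N" by (rule Ext1_abelian_group[OF ob(1) N])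
  interpret ME: abelian_group "Ext1 \<C> W M" by (rule Ext1_abelian_group[OF ob(1,2)])
  interpret ME': abelian_group "Ext1 \<C> W M'" by (rule Ext1_abelian_group[OF ob(1,3)])
  have "psh p \<eta> = \<epsilon>"
    using push_add[OF ie je p ob(1) N ob(2)] push_comp[OF e i p ob(1,2) N ob(2), symmetric]
      push_comp[OF e' j p ob(1,3) N ob(2), symmetric] pi pj ET1_push_ident[OF ob(1,2) e]
      push_mor_zero[OF e' ob(1,3,2)] e by (simp add: \<eta>_def)
  moreover have "psh q \<eta> = \<epsilon>'"
    using push_add[OF ie je q ob(1) N ob(3)] push_comp[OF e i q ob(1,2) N ob(3), symmetric]
      push_comp[OF e' j q ob(1,3) N ob(3), symmetric] qi qj ET1_push_ident[OF ob(1,3) e']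
      push_mor_zero[OF e ob(1,2,3)] e' by (simp add: \<eta>_def)
  moreover have "\<eta> \<in> ext W N" using ie je by (simp add: \<eta>_def)
  ultimately show thesis using that[OF N p q] by blast
qed

end

section \<open>Expressions for higher extensions\<close>

text \<open>A structural description of the field of \<open>yeq\<close> (see
  \<open>yeq_refl_iff\<close>), so that single expressions can be treated by induction on their
  shape. The target \<open>A\<close> is fixed while source and degree vary, because tensors are
  taken apart from the contravariant end.\<close>

primrec ywf ::
  "('k, 'r) ring_scheme \<Rightarrow> ('o, 'k, 'm, 'e, 'z) extri_cat_scheme \<Rightarrow> 'o \<Rightarrow>
   ('o, 'k, 'e) yterm \<Rightarrow> nat \<Rightarrow> 'o \<Rightarrow> bool"
  where
    "ywf K \<C> A (Base \<delta>) n C \<longleftrightarrow> n = 1 \<and> C \<in> Ob \<C> \<and> A \<in> Ob \<C> \<and> \<delta> \<in> carrier (Ext1 \<C> C A)"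
  | "ywf K \<C> A Zero n C \<longleftrightarrow> 1 \<le> n \<and> C \<in> Ob \<C> \<and> A \<in> Ob \<C>"
  | "ywf K \<C> A (Add s t) n C \<longleftrightarrow> ywf K \<C> A s n C \<and> ywf K \<C> A t n C"
  | "ywf K \<C> A (Scale r s) n C \<longleftrightarrow> r \<in> carrier K \<and> ywf K \<C> A s n C"
  | "ywf K \<C> A (Tens \<xi> M \<delta>) n C \<longleftrightarrow> (\<exists>m. n = Suc m \<and> C \<in> Ob \<C> \<and> M \<in> Ob \<C> \<and>
      \<delta> \<in> carrier (Ext1 \<C> C M) \<and> ywf K \<C> A \<xi> m M)"

lemma ywf_Ob: "ywf K \<C> A t n C \<Longrightarrow> 1 \<le> n \<and> C \<in> Ob \<C> \<and> A \<in> Ob \<C>"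
  by (induction t arbitrary: n C) auto

lemma ywf_imp_yeq: "ywf K \<C> A t n C \<Longrightarrow> yeq K \<C> n C A t t"
  by (induction t arbitrary: n C) (auto intro: yeq.base[simplified] yeq.zero yeq.add yeq.scale yeq.tens)

declare yeq.trans [trans]

context linear_extriangulated_category
begin

abbreviation "eqv n C A s t \<equiv> yeq K \<C> n C A s t"
abbreviation "wft A t n C \<equiv> ywf K \<C> A t n C"
abbreviation "res c t \<equiv> ypull \<C> c t"

lemma Ext1_add_closed:
  "\<lbrakk>\<delta> \<in> ext C A; \<epsilon> \<in> ext C A; C \<in> obj; A \<in> obj\<rbrakk>
    \<Longrightarrow> \<delta> \<oplus>\<^bsub>Ext1 \<C> C A\<^esub> \<epsilon> \<in> ext C A"
  using abelian_groupE(1)[OF Ext1_abelian_group] by blast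

lemma Ext1_smult_closed:
  "\<lbrakk>r \<in> carrier K; \<delta> \<in> ext C A; C \<in> obj; A \<in> obj\<rbrakk>
    \<Longrightarrow> r \<odot>\<^bsub>Ext1 \<C> C A\<^esub> \<delta> \<in> ext C A"
  using module.smult_closed[OF vectorspace.axioms(1)[OF ET1_vectorspace]] by blast

lemma Hom_smult_closed:
  "\<lbrakk>r \<in> carrier K; f \<in> arr X Y; X \<in> obj; Y \<in> obj\<rbrakk>
    \<Longrightarrow> r \<odot>\<^bsub>Hom \<C> X Y\<^esub> f \<in> arr X Y"
  using module.smult_closed[OF vectorspace.axioms(1)[OF Hom_vectorspace]] by blast

lemma ywf_ypull:
  "\<lbrakk>wft A t n C; c \<in> arr C' C; C' \<in> obj\<rbrakk> \<Longrightarrow> wft A (res c t) n C'"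
  by (induction t arbitrary: n) (auto intro: pull_closed)

lemma yeq_imp_ywf: "eqv n C A s t \<Longrightarrow> wft A s n C \<and> wft A t n C"
proof (induction rule: yeq.induct)
  case (coend C M N f \<delta> n A \<xi>)
  then show ?case by (auto intro: push_closed ywf_ypull)
qed (auto simp: Ext1_add_closed Ext1_smult_closed dest: ywf_Ob)

lemma yeq_refl_iff: "eqv n C A t t \<longleftrightarrow> wft A t n C"
  by (auto dest: yeq_imp_ywf ywf_imp_yeq)

lemma yeq_Ob: "eqv n C A s t \<Longrightarrow> 1 \<le> n \<and> C \<in> obj \<and> A \<in> obj"
  by (auto dest!: yeq_imp_ywf ywf_Ob)

lemma ypull_cong:
  "\<lbrakk>eqv n C A s t; c \<in> arr C' C; C' \<in> obj\<rbrakk>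
    \<Longrightarrow> eqv n C' A (res c s) (res c t)"
proof (induction arbitrary: c rule: yeq.induct)
  case (coend C M N f \<delta> n A \<xi>)
  have "psh f (pll c \<delta>) = pll c (psh f \<delta>)"
    using push_pull coend by blast
  moreover have "pll c \<delta> \<in> ext C' M"
    using pull_closed coend by blast
  ultimately show ?case
    using yeq.coend[of C' \<C> M N f "pll c \<delta>" K n A \<xi>] coend by simp
next
  case (base_add C A \<delta> \<epsilon>)
  then show ?case
    using yeq.base_add[of C' \<C> A "pll c \<delta>" "pll c \<epsilon>" K] pull_add pull_closed by simp
next
  case (base_scale C A r \<delta>)
  then show ?case
    using yeq.base_scale[of C' \<C> A r K "pll c \<delta>"] pull_smult pull_closed by simp
next
  case (tens_add_right C M \<delta> \<epsilon> n A \<xi>)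
  then show ?case
    using yeq.tens_add_right[of C' \<C> M "pll c \<delta>" "pll c \<epsilon>" K] pull_add pull_closed by simp
next
  case (tens_scale_right C M \<delta> r n A \<xi>)
  then show ?case
    using yeq.tens_scale_right[of C' \<C> M "pll c \<delta>" r K] pull_smult pull_closed by simp
next
  case (trans n C A s t u)
  then show ?case by (blast intro: yeq.trans)
qed (auto intro: yeq.base[simplified] yeq.zero yeq.add yeq.scale yeq.tens yeq.add_assoc yeq.add_comm
    yeq.add_zero yeq.scale_zero yeq.scale_one yeq.scale_scale yeq.scale_add_left yeq.scale_add_right
    yeq.tens_add_left yeq.tens_scale_left pull_closed dest: yeq.sym)

lemma ypull_ident: "wft A t n C \<Longrightarrow> res (idn C) t = t"
  by (induction t arbitrary: n) (auto simp: ET1_pull_ident)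

lemma ypull_comp:
  "\<lbrakk>wft A t n C; c \<in> arr C' C; c' \<in> arr C'' C'; C' \<in> obj; C'' \<in> obj\<rbrakk>
    \<Longrightarrow> res (c \<cdot> c') t = res c' (res c t)"
  by (induction t arbitrary: n) (auto simp: pull_comp)

lemma zero_smult_Ext1:
  "\<lbrakk>C \<in> obj; A \<in> obj; \<delta> \<in> ext C A\<rbrakk>
    \<Longrightarrow> \<zero>\<^bsub>K\<^esub> \<odot>\<^bsub>Ext1 \<C> C A\<^esub> \<delta> = zext C A"
  using module.smult_l_null[OF vectorspace.axioms(1)[OF ET1_vectorspace]] by blast

lemma zero_smult_Hom:
  "\<lbrakk>X \<in> obj; Y \<in> obj; f \<in> arr X Y\<rbrakk>
    \<Longrightarrow> \<zero>\<^bsub>K\<^esub> \<odot>\<^bsub>Hom \<C> X Y\<^esub> f = zhom X Y"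
  using module.smult_l_null[OF vectorspace.axioms(1)[OF Hom_vectorspace]] by blast

text \<open>None of the rules of \<open>yeq\<close> mentions the zero of \<open>Ext1\<close>.
  Writing it as 0 times itself makes \<open>base_scale\<close> and \<open>scale_zero\<close>
  applicable; the same device handles the other zeros below.\<close>

lemma yeq_Base_zero:
  assumes ob: "C \<in> obj" "A \<in> obj"
  shows "eqv 1 C A (Base (zext C A)) Zero"
proof -
  note z = zero_Ext1[OF ob]
  have "eqv 1 C A (Base (\<zero>\<^bsub>K\<^esub> \<odot>\<^bsub>Ext1 \<C> C A\<^esub> (zext C A)))
      (Scale \<zero>\<^bsub>K\<^esub> (Base (zext C A)))"
    by (rule yeq.base_scale[OF ob _ z]) simp
  also have "eqv 1 C A \<dots> Zero"
    by (rule yeq.scale_zero[OF yeq.base[OF ob z]])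
  finally show ?thesis by (simp add: zero_smult_Ext1 ob z)
qed

lemma yeq_Tens_zero_right:
  assumes ob: "C \<in> obj" "M \<in> obj" and "wft A \<xi> n M"
  shows "eqv (Suc n) C A (Tens \<xi> M (zext C M)) Zero"
proof -
  note z = zero_Ext1[OF ob] and x = ywf_imp_yeq[OF assms(3)]
  have "eqv (Suc n) C A (Tens \<xi> M (\<zero>\<^bsub>K\<^esub> \<odot>\<^bsub>Ext1 \<C> C M\<^esub> (zext C M)))
      (Scale \<zero>\<^bsub>K\<^esub> (Tens \<xi> M (zext C M)))"
    by (rule yeq.tens_scale_right[OF ob z _ x]) simp
  also have "eqv (Suc n) C A \<dots> Zero"
    by (rule yeq.scale_zero[OF yeq.tens[OF ob z x]])
  finally show ?thesis by (simp add: zero_smult_Ext1 ob z)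
qed

lemma yeq_Tens_zero_left:
  assumes "C \<in> obj" "M \<in> obj" "A \<in> obj" "\<delta> \<in> ext C M" "1 \<le> n"
  shows "eqv (Suc n) C A (Tens Zero M \<delta>) Zero"
proof -
  have z: "eqv n M A Zero Zero" by (rule yeq.zero) (use assms in auto)
  have "eqv (Suc n) C A (Tens Zero M \<delta>) (Tens (Scale \<zero>\<^bsub>K\<^esub> Zero) M \<delta>)"
    by (rule yeq.tens[OF assms(1,2,4) yeq.sym[OF yeq.scale_zero[OF z]]])
  also have "eqv (Suc n) C A \<dots> (Scale \<zero>\<^bsub>K\<^esub> (Tens Zero M \<delta>))"
    by (rule yeq.tens_scale_left[OF assms(1,2,4) _ z]) simp
  also have "eqv (Suc n) C A \<dots> Zero"
    by (rule yeq.scale_zero[OF yeq.tens[OF assms(1,2,4) z]])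
  finally show ?thesis .
qed

lemma yeq_add_middle:
  assumes "eqv n C A a a" "eqv n C A b b" "eqv n C A c c" "eqv n C A d d"
  shows "eqv n C A (Add (Add a b) (Add c d)) (Add (Add a c) (Add b d))"
proof -
  have "eqv n C A (Add (Add a b) (Add c d)) (Add a (Add b (Add c d)))"
    using assms by (intro yeq.add_assoc yeq.add)
  also have "eqv n C A \<dots> (Add a (Add (Add b c) d))"
    using assms by (intro yeq.add yeq.sym[OF yeq.add_assoc])
  also have "eqv n C A \<dots> (Add a (Add (Add c b) d))"
    using assms by (intro yeq.add yeq.add_comm)
  also have "eqv n C A \<dots> (Add a (Add c (Add b d)))"
    using assms by (intro yeq.add yeq.add_assoc)
  also have "eqv n C A \<dots> (Add (Add a c) (Add b d))"
    using assms by (intro yeq.sym[OF yeq.add_assoc] yeq.add)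
  finally show ?thesis .
qed

lemma yeq_scale_Zero: "\<lbrakk>r \<in> carrier K; C \<in> obj; A \<in> obj; 1 \<le> n\<rbrakk> \<Longrightarrow> eqv n C A (Scale r Zero) Zero"
proof -
  assume a: "r \<in> carrier K" "C \<in> obj" "A \<in> obj" "1 \<le> n"
  have z: "eqv n C A Zero Zero" using a by (intro yeq.zero)
  have "eqv n C A (Scale r Zero) (Scale r (Scale \<zero>\<^bsub>K\<^esub> Zero))"
    by (intro yeq.scale a yeq.sym[OF yeq.scale_zero] z)
  also have "eqv n C A \<dots> (Scale (r \<otimes>\<^bsub>K\<^esub> \<zero>\<^bsub>K\<^esub>) Zero)"
    by (intro yeq.sym[OF yeq.scale_scale] a z) simp
  also have "eqv n C A \<dots> Zero"
    using yeq.scale_zero[OF z] a by simp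
  finally show ?thesis .
qed

lemma yeq_scale_commute:
  assumes "q \<in> carrier K" "r \<in> carrier K" "eqv n C A s s"
  shows "eqv n C A (Scale q (Scale r s)) (Scale r (Scale q s))"
  using yeq.scale_scale[OF assms] yeq.scale_scale[OF assms(2,1,3)] m_comm[OF assms(1,2)]
  by (metis yeq.sym yeq.trans)

text \<open>A pullback touches only the outermost extensions, where additivity in the morphism is
  bilinearity; \<open>yeq_add_middle\<close> regroups the summands.\<close>

lemma ypull_add_mor:
  "\<lbrakk>wft A t n C; c \<in> arr C' C; c' \<in> arr C' C; C' \<in> obj\<rbrakk>
    \<Longrightarrow> eqv n C' A (res (c \<oplus>\<^bsub>Hom \<C> C' C\<^esub> c') t) (Add (res c t) (res c' t))"
proof (induction t arbitrary: n)
  case (Base \<delta>)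
  then show ?case
    using yeq.base_add[of C' \<C> A "pll c \<delta>" "pll c' \<delta>" K] pull_mor_add pull_closed by clarsimp
next
  case Zero
  then show ?case by (auto intro!: yeq.sym[OF yeq.add_zero] yeq.zero)
next
  case (Add s t)
  have "eqv n C' A (res (c \<oplus>\<^bsub>Hom \<C> C' C\<^esub> c') (Add s t))
      (Add (Add (res c s) (res c' s)) (Add (res c t) (res c' t)))"
    using Add by (auto intro!: yeq.add)
  also have "eqv n C' A \<dots> (Add (Add (res c s) (res c t)) (Add (res c' s) (res c' t)))"
    using Add by (auto intro!: yeq_add_middle ywf_imp_yeq ywf_ypull)
  finally show ?case by simp
next
  case (Scale r s)
  have "eqv n C' A (res (c \<oplus>\<^bsub>Hom \<C> C' C\<^esub> c') (Scale r s))
      (Scale r (Add (res c s) (res c' s)))"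
    using Scale by (auto intro!: yeq.scale)
  also have "eqv n C' A \<dots> (Add (Scale r (res c s)) (Scale r (res c' s)))"
    using Scale by (auto intro!: yeq.scale_add_right ywf_imp_yeq ywf_ypull)
  finally show ?case by simp
next
  case (Tens \<xi> M \<delta>)
  then obtain m where m: "n = Suc m" "M \<in> obj" "\<delta> \<in> ext C M" "wft A \<xi> m M" "C \<in> obj"
    by auto
  show ?case
    using yeq.tens_add_right[of C' \<C> M "pll c \<delta>" "pll c' \<delta>" K m A \<xi>] m Tens(3-)
      ywf_imp_yeq[OF m(4)] pull_mor_add pull_closed by simp
qed

lemma ypull_smult_mor:
  "\<lbrakk>wft A t n C; r \<in> carrier K; c \<in> arr C' C; C' \<in> obj\<rbrakk>
    \<Longrightarrow> eqv n C' A (res (r \<odot>\<^bsub>Hom \<C> C' C\<^esub> c) t) (Scale r (res c t))"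
proof (induction t arbitrary: n)
  case (Base \<delta>)
  then show ?case
    using yeq.base_scale[of C' \<C> A r K "pll c \<delta>"] pull_mor_smult pull_closed by clarsimp
next
  case Zero
  then show ?case by (auto intro!: yeq.sym[OF yeq_scale_Zero])
next
  case (Add s t)
  have "eqv n C' A (res (r \<odot>\<^bsub>Hom \<C> C' C\<^esub> c) (Add s t))
      (Add (Scale r (res c s)) (Scale r (res c t)))"
    using Add by (auto intro!: yeq.add)
  also have "eqv n C' A \<dots> (Scale r (Add (res c s) (res c t)))"
    using Add by (auto intro!: yeq.sym[OF yeq.scale_add_right] ywf_imp_yeq ywf_ypull)
  finally show ?case by simp
next
  case (Scale q s)
  have "eqv n C' A (res (r \<odot>\<^bsub>Hom \<C> C' C\<^esub> c) (Scale q s))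
      (Scale q (Scale r (res c s)))"
    using Scale by (auto intro!: yeq.scale)
  also have "eqv n C' A \<dots> (Scale r (Scale q (res c s)))"
    using Scale by (auto intro!: yeq_scale_commute ywf_imp_yeq ywf_ypull)
  finally show ?case by simp
next
  case (Tens \<xi> M \<delta>)
  then obtain m where m: "n = Suc m" "M \<in> obj" "\<delta> \<in> ext C M" "wft A \<xi> m M" "C \<in> obj"
    by auto
  show ?case
    using yeq.tens_scale_right[of C' \<C> M "pll c \<delta>" r K m A \<xi>] m Tens(3-)
      ywf_imp_yeq[OF m(4)] pull_mor_smult pull_closed by simp
qed

lemma ypull_zero_mor:
  assumes "wft A t n C" "C' \<in> obj"
  shows "eqv n C' A (res (zhom C' C) t) Zero"
proof -
  have C: "C \<in> obj" using ywf_Ob[OF assms(1)] by blast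
  note z = zero_mor[OF assms(2) C]
  have "eqv n C' A (res (\<zero>\<^bsub>K\<^esub> \<odot>\<^bsub>Hom \<C> C' C\<^esub> (zhom C' C)) t)
      (Scale \<zero>\<^bsub>K\<^esub> (res (zhom C' C) t))"
    by (rule ypull_smult_mor[OF assms(1) _ z assms(2)]) simp
  also have "eqv n C' A \<dots> Zero"
    by (intro yeq.scale_zero ywf_imp_yeq ywf_ypull[OF assms(1) z assms(2)])
  finally show ?thesis by (simp add: zero_smult_Hom assms C z)
qed

text \<open>In degree 1 no tensor can occur, because its left factor would have degree 0. The
  remaining operations are carried out in \<open>Ext1\<close>.\<close>

lemma ex_Base:
  assumes "wft A t 1 C"
  shows "\<exists>\<delta> \<in> ext C A. eqv 1 C A t (Base \<delta>)"
  using assms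
proof (induction t)
  case (Base \<delta>)
  then show ?case using ywf_imp_yeq by fastforce
next
  case Zero
  then show ?case using yeq_Base_zero[of C A] zero_Ext1 yeq.sym by (metis ywf.simps(2))
next
  case (Add s t)
  then obtain \<delta> \<epsilon> where de: "\<delta> \<in> ext C A" "eqv 1 C A s (Base \<delta>)"
      "\<epsilon> \<in> ext C A" "eqv 1 C A t (Base \<epsilon>)" by auto
  have ob: "C \<in> obj" "A \<in> obj" using yeq_Ob[OF de(2)] by auto
  have "eqv 1 C A (Add s t) (Base (\<delta> \<oplus>\<^bsub>Ext1 \<C> C A\<^esub> \<epsilon>))"
    using yeq.add[OF de(2,4)] yeq.base_add[OF ob de(1,3)] by (metis yeq.sym yeq.trans)
  then show ?case using Ext1_add_closed de ob by blast
next
  case (Scale r s)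
  then obtain \<delta> where de: "\<delta> \<in> ext C A" "eqv 1 C A s (Base \<delta>)" "r \<in> carrier K"
    by auto
  have ob: "C \<in> obj" "A \<in> obj" using yeq_Ob[OF de(2)] by auto
  have "eqv 1 C A (Scale r s) (Base (r \<odot>\<^bsub>Ext1 \<C> C A\<^esub> \<delta>))"
    using yeq.scale[OF de(3,2)] yeq.base_scale[OF ob de(3,1)] by (metis yeq.sym yeq.trans)
  then show ?case using Ext1_smult_closed de ob by blast
next
  case (Tens \<xi> M \<delta>)
  then show ?case using ywf_Ob by fastforce
qed

lemma yeq_Tens_refine:
  assumes "N \<in> obj" "M \<in> obj" "p \<in> arr N M" "\<eta> \<in> ext C N" "C \<in> obj"
    "wft A \<xi> n M"
  shows "eqv (Suc n) C A (Tens \<xi> M (psh p \<eta>)) (Tens (res p \<xi>) N \<eta>)"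
  by (intro yeq.sym[OF yeq.coend] assms ywf_imp_yeq)

text \<open>Sums are the only difficulty: over a common refinement two tensors acquire the same
  right factor, and then their left factors are added.\<close>

lemma ex_Tens:
  assumes "1 \<le> n" "wft A t (Suc n) C"
  shows "\<exists>M \<xi> \<delta>. M \<in> obj \<and> wft A \<xi> n M \<and> \<delta> \<in> ext C M \<and>
    eqv (Suc n) C A t (Tens \<xi> M \<delta>)"
  using assms(2)
proof (induction t)
  case (Base \<delta>)
  then show ?case using assms(1) by auto
next
  case Zero
  then have ob: "C \<in> obj" "A \<in> obj" by auto
  note z = zero_Ext1[OF ob]
  have "wft A Zero n A" using ob assms by auto
  then show ?case
    using yeq.sym[OF yeq_Tens_zero_left[OF ob(1,2,2) z assms(1)]] z ob by blast
next
  case (Add s t)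
  then obtain M \<xi> \<delta> M' \<xi>' \<delta>' where
    s: "M \<in> obj" "wft A \<xi> n M" "\<delta> \<in> ext C M"
      "eqv (Suc n) C A s (Tens \<xi> M \<delta>)" and
    t: "M' \<in> obj" "wft A \<xi>' n M'" "\<delta>' \<in> ext C M'"
      "eqv (Suc n) C A t (Tens \<xi>' M' \<delta>')"
    by auto
  have C: "C \<in> obj" using yeq_Ob[OF s(4)] by blast
  obtain N p p' \<eta> where N: "N \<in> obj" "p \<in> arr N M" "p' \<in> arr N M'"
    "\<eta> \<in> ext C N" "psh p \<eta> = \<delta>" "psh p' \<eta> = \<delta>'"
    using common_refinement[OF s(3) t(3) C s(1) t(1)] .
  note w = ywf_ypull[OF s(2) N(2,1)] ywf_ypull[OF t(2) N(3,1)]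
  have "eqv (Suc n) C A s (Tens (res p \<xi>) N \<eta>)"
    using yeq.trans[OF s(4)] yeq_Tens_refine[OF N(1) s(1) N(2,4) C s(2)] N(5) by simp
  moreover have "eqv (Suc n) C A t (Tens (res p' \<xi>') N \<eta>)"
    using yeq.trans[OF t(4)] yeq_Tens_refine[OF N(1) t(1) N(3,4) C t(2)] N(6) by simp
  ultimately have "eqv (Suc n) C A (Add s t)
      (Add (Tens (res p \<xi>) N \<eta>) (Tens (res p' \<xi>') N \<eta>))"
    by (rule yeq.add)
  also have "eqv (Suc n) C A \<dots> (Tens (Add (res p \<xi>) (res p' \<xi>')) N \<eta>)"
    by (intro yeq.sym[OF yeq.tens_add_left] ywf_imp_yeq C N w)
  finally show ?case
    using N w by (intro exI conjI) (auto)
next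
  case (Scale r s)
  then obtain M \<xi> \<delta> where
    s: "M \<in> obj" "wft A \<xi> n M" "\<delta> \<in> ext C M"
      "eqv (Suc n) C A s (Tens \<xi> M \<delta>)" and r: "r \<in> carrier K"
    by auto
  have C: "C \<in> obj" using yeq_Ob[OF s(4)] by blast
  have "eqv (Suc n) C A (Scale r s) (Scale r (Tens \<xi> M \<delta>))"
    by (intro yeq.scale r s)
  also have "eqv (Suc n) C A \<dots> (Tens (Scale r \<xi>) M \<delta>)"
    by (intro yeq.sym[OF yeq.tens_scale_left] ywf_imp_yeq C r s)
  finally show ?case using s r by (intro exI conjI) auto
next
  case (Tens \<xi> M \<delta>)
  then show ?case using ywf_imp_yeq[OF Tens(2)] by auto
qed

text \<open>An extension is killed by the deflation that realizes it. In degree 1 this applies to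
  \<open>\<kappa>\<close> itself, and in higher degree to the right factor of a single tensor
  representing \<open>\<kappa>\<close>.\<close>

lemma effaceable:
  assumes "1 \<le> n" "wft A \<kappa> n G"
  obtains P p H h \<theta> where "etri P p H h G \<theta>" "eqv n H A (res h \<kappa>) Zero"
proof (cases "n = 1")
  case True
  obtain \<theta> where th: "\<theta> \<in> ext G A" "eqv 1 G A \<kappa> (Base \<theta>)"
    using ex_Base assms True by blast
  have ob: "G \<in> obj" "A \<in> obj" using yeq_Ob[OF th(2)] by auto
  obtain p H h where T: "etri A p H h G \<theta>" using ex_etriangle[OF th(1) ob] by metis
  note t = etriangleD[OF T]
  have "eqv 1 H A (res h \<kappa>) (Base (pll h \<theta>))"
    using ypull_cong[OF th(2) t(5,2)] by simp
  also have "eqv 1 H A \<dots> Zero"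
    using yeq_Base_zero[OF t(2,1)] pull_deflation[OF T] by simp
  finally show thesis using that T True by blast
next
  case False
  then obtain m where m: "n = Suc m" "1 \<le> m" using assms(1) by (cases n) auto
  obtain P \<rho> \<theta> where P: "P \<in> obj" "wft A \<rho> m P" "\<theta> \<in> ext G P"
    "eqv (Suc m) G A \<kappa> (Tens \<rho> P \<theta>)"
    using ex_Tens[OF m(2)] assms(2) m by blast
  have G: "G \<in> obj" using yeq_Ob[OF P(4)] by auto
  obtain p H h where T: "etri P p H h G \<theta>" using ex_etriangle[OF P(3) G P(1)] by metis
  note t = etriangleD[OF T]
  have "eqv n H A (res h \<kappa>) (Tens \<rho> P (pll h \<theta>))"
    using ypull_cong[OF P(4) t(5,2)] m by simp
  also have "eqv n H A \<dots> Zero"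
    using yeq_Tens_zero_right[OF t(2,1) P(2)] pull_deflation[OF T] m by simp
  finally show thesis using that T by blast
qed

text \<open>A deflation onto \<open>G\<close> that kills \<open>\<kappa>\<close> is moved across the
  inflation \<open>u\<close> by \<open>inflation_refine\<close>, so that \<open>u \<cdot> m\<close>
  factors through it. Unwanted terms are refined away by this.\<close>

lemma refine_kill:
  assumes n: "1 \<le> n" and k: "wft A \<kappa> n G" and T: "etri M u G v W \<epsilon>"
  obtains M' m \<epsilon>' where "M' \<in> obj" "m \<in> arr M' M" "\<epsilon>' \<in> ext W M'"
    "psh m \<epsilon>' = \<epsilon>" "eqv n M' A (res m (res u \<kappa>)) Zero"
proof -
  note t = etriangleD[OF T]
  obtain P p H h \<theta> where H: "etri P p H h G \<theta>" "eqv n H A (res h \<kappa>) Zero"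
    using effaceable[OF n k] .
  note h = etriangleD[OF H(1)]
  obtain M' m \<epsilon>' l where M: "M' \<in> obj" "m \<in> arr M' M" "\<epsilon>' \<in> ext W M'"
    "psh m \<epsilon>' = \<epsilon>" "l \<in> arr M' H" "h \<cdot> l = u \<cdot> m"
    using inflation_refine[OF T H(1)] .
  have "res m (res u \<kappa>) = res l (res h \<kappa>)"
    using ypull_comp[OF k t(4) M(2) t(1) M(1)] ypull_comp[OF k h(5) M(5) h(2) M(1)] M(6) by simp
  moreover have "eqv n M' A (res l (res h \<kappa>)) Zero"
    using ypull_cong[OF H(2) M(5,1)] by simp
  ultimately show thesis using that M by metis
qed

end

section \<open>The vanishing criterion for tensors\<close>

text \<open>
  \<open>yrep K \<C> n A N \<epsilon> t \<eta>\<close> expresses that the class of \<open>t\<close> is \<open>\<eta> \<otimes> \<epsilon>\<close> because every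
  tensor occurring at top level in \<open>t\<close> is explicitly pulled back from \<open>\<epsilon> \<in> \<E>(C, N)\<close>. As
  \<open>\<epsilon>\<close> gets finer this exhibits the coend as a filtered colimit.
\<close>

primrec yrep ::
  "('k, 'r) ring_scheme \<Rightarrow> ('o, 'k, 'm, 'e, 'z) extri_cat_scheme \<Rightarrow> nat \<Rightarrow> 'o \<Rightarrow> 'o \<Rightarrow> 'e \<Rightarrow>
   ('o, 'k, 'e) yterm \<Rightarrow> ('o, 'k, 'e) yterm \<Rightarrow> bool"
  where
    "yrep K \<C> n A N \<epsilon> (Base \<delta>) \<eta> \<longleftrightarrow> False"
  | "yrep K \<C> n A N \<epsilon> Zero \<eta> \<longleftrightarrow> yeq K \<C> n N A Zero \<eta>"
  | "yrep K \<C> n A N \<epsilon> (Add s t) \<eta> \<longleftrightarrow> (\<exists>\<eta>\<^sub>1 \<eta>\<^sub>2. yrep K \<C> n A N \<epsilon> s \<eta>\<^sub>1 \<and> yrep K \<C> n A N \<epsilon> t \<eta>\<^sub>2 \<and>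
      yeq K \<C> n N A (Add \<eta>\<^sub>1 \<eta>\<^sub>2) \<eta>)"
  | "yrep K \<C> n A N \<epsilon> (Scale r s) \<eta> \<longleftrightarrow> r \<in> carrier K \<and>
      (\<exists>\<eta>\<^sub>1. yrep K \<C> n A N \<epsilon> s \<eta>\<^sub>1 \<and> yeq K \<C> n N A (Scale r \<eta>\<^sub>1) \<eta>)"
  | "yrep K \<C> n A N \<epsilon> (Tens \<xi> M \<delta>) \<eta> \<longleftrightarrow> M \<in> Ob \<C> \<and> ywf K \<C> A \<xi> n M \<and>
      (\<exists>a \<in> mor \<C> N M. push \<C> a \<epsilon> = \<delta> \<and> yeq K \<C> n N A (ypull \<C> a \<xi>) \<eta>)"

text \<open>Equality at some stage of the filtered colimit. Transitivity is not built in; it comes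
  from \<open>yrep_unique\<close>.\<close>

definition yrel ::
  "('k, 'r) ring_scheme \<Rightarrow> ('o, 'k, 'm, 'e, 'z) extri_cat_scheme \<Rightarrow> nat \<Rightarrow> 'o \<Rightarrow> 'o \<Rightarrow>
   ('o, 'k, 'e) yterm \<Rightarrow> ('o, 'k, 'e) yterm \<Rightarrow> bool"
  where "yrel K \<C> n W A s t \<longleftrightarrow> (\<exists>N \<epsilon> \<eta>. N \<in> Ob \<C> \<and> \<epsilon> \<in> carrier (Ext1 \<C> W N) \<and>
    yrep K \<C> n A N \<epsilon> s \<eta> \<and> yrep K \<C> n A N \<epsilon> t \<eta>)"

lemma yrelI:
  "\<lbrakk>N \<in> Ob \<C>; \<epsilon> \<in> carrier (Ext1 \<C> W N); yrep K \<C> n A N \<epsilon> s \<eta>; yrep K \<C> n A N \<epsilon> t \<eta>\<rbrakk>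
    \<Longrightarrow> yrel K \<C> n W A s t"
  by (auto simp: yrel_def)

lemma yrep_cong: "\<lbrakk>yrep K \<C> n A N \<epsilon> t \<eta>; yeq K \<C> n N A \<eta> \<eta>'\<rbrakk> \<Longrightarrow> yrep K \<C> n A N \<epsilon> t \<eta>'"
  by (cases t) (auto intro: yeq.trans)

context linear_extriangulated_category
begin

abbreviation "rep n A N \<epsilon> t \<eta> \<equiv> yrep K \<C> n A N \<epsilon> t \<eta>"
abbreviation "rel n W A s t \<equiv> yrel K \<C> n W A s t"

lemma yrep_wf: "rep n A N \<epsilon> t \<eta> \<Longrightarrow> wft A \<eta> n N"
  by (cases t) (auto dest!: yeq_imp_ywf)

lemma yrep_refine:
  assumes "rep n A N \<epsilon> t \<eta>" and m: "m \<in> arr N' N" "psh m \<epsilon>' = \<epsilon>"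
    "\<epsilon>' \<in> ext W N'" and ob: "N \<in> obj" "N' \<in> obj" "W \<in> obj"
  shows "rep n A N' \<epsilon>' t (res m \<eta>)"
  using assms(1)
proof (induction t arbitrary: \<eta>)
  case Zero
  then show ?case using ypull_cong[of n N A Zero \<eta>] m ob by auto
next
  case (Add s t)
  then obtain \<eta>\<^sub>1 \<eta>\<^sub>2 where h: "rep n A N \<epsilon> s \<eta>\<^sub>1" "rep n A N \<epsilon> t \<eta>\<^sub>2"
    "eqv n N A (Add \<eta>\<^sub>1 \<eta>\<^sub>2) \<eta>" by auto
  show ?case using Add.IH(1)[OF h(1)] Add.IH(2)[OF h(2)] ypull_cong[OF h(3) m(1) ob(2)] by auto
next
  case (Scale r s)
  then obtain \<eta>\<^sub>1 where h: "rep n A N \<epsilon> s \<eta>\<^sub>1" "eqv n N A (Scale r \<eta>\<^sub>1) \<eta>" "r \<in> carrier K"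
    by auto
  show ?case using Scale.IH[OF h(1)] ypull_cong[OF h(2) m(1) ob(2)] h(3) by auto
next
  case (Tens \<xi> M \<delta>)
  then obtain a where a: "M \<in> obj" "wft A \<xi> n M" "a \<in> arr N M" "psh a \<epsilon> = \<delta>"
    "eqv n N A (res a \<xi>) \<eta>" by auto
  have "psh (a \<cdot> m) \<epsilon>' = \<delta>"
    using push_comp[OF m(3,1) a(3) ob(3,2,1) a(1)] m a by simp
  moreover have "eqv n N' A (res (a \<cdot> m) \<xi>) (res m \<eta>)"
    using ypull_comp[OF a(2,3) m(1) ob(1,2)] ypull_cong[OF a(5) m(1) ob(2)] by simp
  ultimately show ?case using a comp_closed[OF m(1) a(3) ob(2,1) a(1)] by auto
qed simp

text \<open>The representative depends on the choice of \<open>a\<close> in the \<open>Tens\<close>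
  case. Two choices differ by a map that extends along the inflation realizing
  \<open>\<epsilon>\<close>, and \<open>refine_kill\<close> makes the contribution of this
  difference vanish.\<close>

lemma yrep_unique:
  assumes n: "1 \<le> n" and W: "W \<in> obj"
  shows "\<lbrakk>rep n A N \<epsilon> t \<eta>; rep n A N \<epsilon> t \<eta>'; N \<in> obj; \<epsilon> \<in> ext W N\<rbrakk>
    \<Longrightarrow> \<exists>N' m \<epsilon>'. N' \<in> obj \<and> m \<in> arr N' N \<and> \<epsilon>' \<in> ext W N' \<and>
      psh m \<epsilon>' = \<epsilon> \<and> eqv n N' A (res m \<eta>) (res m \<eta>')"
proof (induction t arbitrary: N \<epsilon> \<eta> \<eta>')
  case Zero
  then have "eqv n N A \<eta> \<eta>'" by (auto intro: yeq.trans yeq.sym)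
  then show ?case
    using Zero ypull_cong[OF _ ident_mor] ET1_push_ident[OF W] ident_mor by blast
next
  case (Add s t)
  obtain \<eta>\<^sub>1 \<eta>\<^sub>2 where h: "rep n A N \<epsilon> s \<eta>\<^sub>1" "rep n A N \<epsilon> t \<eta>\<^sub>2"
    "eqv n N A (Add \<eta>\<^sub>1 \<eta>\<^sub>2) \<eta>" using Add.prems by auto
  obtain \<eta>\<^sub>1' \<eta>\<^sub>2' where h': "rep n A N \<epsilon> s \<eta>\<^sub>1'" "rep n A N \<epsilon> t \<eta>\<^sub>2'"
    "eqv n N A (Add \<eta>\<^sub>1' \<eta>\<^sub>2') \<eta>'" using Add.prems by auto
  obtain N' m \<epsilon>' where m: "N' \<in> obj" "m \<in> arr N' N" "\<epsilon>' \<in> ext W N'"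
    "psh m \<epsilon>' = \<epsilon>" "eqv n N' A (res m \<eta>\<^sub>1) (res m \<eta>\<^sub>1')"
    using Add.IH(1)[OF h(1) h'(1) Add.prems(3,4)] by blast
  note ref = yrep_refine[OF _ m(2,4,3) Add.prems(3) m(1) W]
  \<comment> \<open>The stage that settles \<open>s\<close> is refined further to settle
    \<open>t\<close>; the agreement for \<open>s\<close> survives refinement.\<close>
  obtain N'' l \<epsilon>'' where l: "N'' \<in> obj" "l \<in> arr N'' N'" "\<epsilon>'' \<in> ext W N''"
    "psh l \<epsilon>'' = \<epsilon>'"
    "eqv n N'' A (res l (res m \<eta>\<^sub>2)) (res l (res m \<eta>\<^sub>2'))"
    using Add.IH(2)[OF ref[OF h(2)] ref[OF h'(2)] m(1,3)] by blast
  have c: "eqv n N'' A (res l (res m (Add \<eta>\<^sub>1 \<eta>\<^sub>2)))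
      (res l (res m (Add \<eta>\<^sub>1' \<eta>\<^sub>2')))"
    using yeq.add[OF ypull_cong[OF m(5) l(2,1)] l(5)] by simp
  have "eqv n N'' A (res l (res m \<eta>)) (res l (res m (Add \<eta>\<^sub>1 \<eta>\<^sub>2)))"
    by (rule ypull_cong[OF ypull_cong[OF yeq.sym[OF h(3)] m(2,1)] l(2,1)])
  also note c
  also have "eqv n N'' A (res l (res m (Add \<eta>\<^sub>1' \<eta>\<^sub>2'))) (res l (res m \<eta>'))"
    by (rule ypull_cong[OF ypull_cong[OF h'(3) m(2,1)] l(2,1)])
  finally have "eqv n N'' A (res (m \<cdot> l) \<eta>) (res (m \<cdot> l) \<eta>')"
    using ypull_comp[OF yrep_wf[OF Add.prems(1)] m(2) l(2) m(1) l(1)]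
      ypull_comp[OF yrep_wf[OF Add.prems(2)] m(2) l(2) m(1) l(1)] by simp
  moreover have "psh (m \<cdot> l) \<epsilon>'' = \<epsilon>"
    using push_comp[OF l(3,2) m(2) W l(1) m(1) Add.prems(3)] l m by simp
  ultimately show ?case
    using comp_closed[OF l(2) m(2) l(1) m(1) Add.prems(3)] l by blast
next
  case (Scale r s)
  obtain \<eta>\<^sub>1 where h: "rep n A N \<epsilon> s \<eta>\<^sub>1" "eqv n N A (Scale r \<eta>\<^sub>1) \<eta>" "r \<in> carrier K"
    using Scale.prems by auto
  obtain \<eta>\<^sub>1' where h': "rep n A N \<epsilon> s \<eta>\<^sub>1'" "eqv n N A (Scale r \<eta>\<^sub>1') \<eta>'"
    using Scale.prems by auto
  obtain N' m \<epsilon>' where m: "N' \<in> obj" "m \<in> arr N' N" "\<epsilon>' \<in> ext W N'"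
    "psh m \<epsilon>' = \<epsilon>" "eqv n N' A (res m \<eta>\<^sub>1) (res m \<eta>\<^sub>1')"
    using Scale.IH[OF h(1) h'(1) Scale.prems(3,4)] by blast
  have "eqv n N' A (res m \<eta>) (res m (Scale r \<eta>\<^sub>1))"
    by (rule ypull_cong[OF yeq.sym[OF h(2)] m(2,1)])
  also have "eqv n N' A \<dots> (res m (Scale r \<eta>\<^sub>1'))"
    using yeq.scale[OF h(3) m(5)] by simp
  also have "eqv n N' A \<dots> (res m \<eta>')"
    by (rule ypull_cong[OF h'(2) m(2,1)])
  finally show ?case using m by blast
next
  case (Tens \<xi> M \<delta>)
  obtain a where a: "M \<in> obj" "wft A \<xi> n M" "a \<in> arr N M" "psh a \<epsilon> = \<delta>"
    "eqv n N A (res a \<xi>) \<eta>" using Tens.prems by auto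
  obtain a' where a': "a' \<in> arr N M" "psh a' \<epsilon> = \<delta>"
    "eqv n N A (res a' \<xi>) \<eta>'" using Tens.prems by auto
  note N = Tens.prems(3) and e = Tens.prems(4)
  obtain G u v where T: "etri N u G v W \<epsilon>" using ex_etriangle[OF e W N] .
  note t = etriangleD[OF T]
  interpret E: abelian_group "Ext1 \<C> W M" by (rule Ext1_abelian_group[OF W a(1)])
  interpret H: abelian_group "Hom \<C> N M" by (rule Hom_abelian_group[OF N a(1)])
  have "psh (a \<ominus>\<^bsub>Hom \<C> N M\<^esub> a') \<epsilon> = zext W M"
    using push_mor_minus[OF e a(3) a'(1) W N a(1)] a a' push_closed[OF e a(3) W N a(1)]
    by (simp add: a_minus_def E.r_neg)
  then obtain h where h: "h \<in> arr G M" "a \<ominus>\<^bsub>Hom \<C> N M\<^esub> a' = h \<cdot> u"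
    using exact_Hom_A_contra[OF T a(1) minus_mor[OF a(3) a'(1) N a(1)]] by blast
  note hu = comp_closed[OF t(4) h(1) N t(2) a(1)]
  \<comment> \<open>Pulling \<open>\<xi>\<close> back along \<open>a\<close> thus gives a term
    through \<open>u\<close>, which is to be killed, plus the pullback along
    \<open>a'\<close>.\<close>
  have dec: "a = (h \<cdot> u) \<oplus>\<^bsub>Hom \<C> N M\<^esub> a'"
    using h(2)[symmetric] a(3) a'(1) by (simp add: a_minus_def H.a_assoc H.l_neg)
  note k = ywf_ypull[OF a(2) h(1) t(2)]
  obtain N' m \<epsilon>' where m: "N' \<in> obj" "m \<in> arr N' N" "\<epsilon>' \<in> ext W N'"
    "psh m \<epsilon>' = \<epsilon>" "eqv n N' A (res m (res u (res h \<xi>))) Zero"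
    using refine_kill[OF n k T] .
  have w: "wft A (res m (res a' \<xi>)) n N'"
    by (rule ywf_ypull[OF ywf_ypull[OF a(2) a'(1) N] m(2,1)])
  have "eqv n N' A (res m \<eta>) (res m (res a \<xi>))"
    by (rule ypull_cong[OF yeq.sym[OF a(5)] m(2,1)])
  also have "eqv n N' A \<dots> (Add (res m (res (h \<cdot> u) \<xi>)) (res m (res a' \<xi>)))"
    using ypull_cong[OF ypull_add_mor[OF a(2) hu a'(1) N] m(2,1)] dec by simp
  also have "eqv n N' A \<dots> (Add Zero (res m (res a' \<xi>)))"
    using yeq.add[OF m(5) ywf_imp_yeq[OF w]] ypull_comp[OF a(2) h(1) t(4,2) N] by simp
  also have "eqv n N' A \<dots> (res m (res a' \<xi>))"
    by (rule yeq.add_zero[OF ywf_imp_yeq[OF w]])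
  also have "eqv n N' A \<dots> (res m \<eta>')"
    by (rule ypull_cong[OF a'(3) m(2,1)])
  finally show ?case using m by blast
qed simp

lemma yrel_combine:
  assumes st: "rel n W A s s'" "rel n W A t t'" and W: "W \<in> obj"
  obtains N \<epsilon> \<eta> \<zeta> where "N \<in> obj" "\<epsilon> \<in> ext W N"
    "rep n A N \<epsilon> s \<eta>" "rep n A N \<epsilon> s' \<eta>" "rep n A N \<epsilon> t \<zeta>" "rep n A N \<epsilon> t' \<zeta>"
proof -
  obtain M \<epsilon> \<eta> where 1: "M \<in> obj" "\<epsilon> \<in> ext W M"
    "rep n A M \<epsilon> s \<eta>" "rep n A M \<epsilon> s' \<eta>" using st(1) by (auto simp: yrel_def)
  obtain M' \<epsilon>' \<eta>' where 2: "M' \<in> obj" "\<epsilon>' \<in> ext W M'"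
    "rep n A M' \<epsilon>' t \<eta>'" "rep n A M' \<epsilon>' t' \<eta>'" using st(2) by (auto simp: yrel_def)
  obtain N p p' \<epsilon>'' where N: "N \<in> obj" "p \<in> arr N M" "p' \<in> arr N M'"
    "\<epsilon>'' \<in> ext W N" "psh p \<epsilon>'' = \<epsilon>" "psh p' \<epsilon>'' = \<epsilon>'"
    using common_refinement[OF 1(2) 2(2) W 1(1) 2(1)] .
  note r1 = yrep_refine[OF _ N(2,5,4) 1(1) N(1) W] and r2 = yrep_refine[OF _ N(3,6,4) 2(1) N(1) W]
  show thesis using that[OF N(1,4) r1[OF 1(3)] r1[OF 1(4)] r2[OF 2(3)] r2[OF 2(4)]] .
qed

text \<open>At a common stage \<open>t\<close> has two representatives; after a refinement that
  identifies them, all three expressions agree.\<close>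

lemma yrel_trans:
  assumes n: "1 \<le> n" and W: "W \<in> obj" and st: "rel n W A s t" and tu: "rel n W A t u"
  shows "rel n W A s u"
proof -
  obtain N \<epsilon> \<eta> \<zeta> where N: "N \<in> obj" "\<epsilon> \<in> ext W N"
    "rep n A N \<epsilon> s \<eta>" "rep n A N \<epsilon> t \<eta>" "rep n A N \<epsilon> t \<zeta>" "rep n A N \<epsilon> u \<zeta>"
    using yrel_combine[OF st tu W] .
  obtain N' m \<epsilon>' where m: "N' \<in> obj" "m \<in> arr N' N" "\<epsilon>' \<in> ext W N'"
    "psh m \<epsilon>' = \<epsilon>" "eqv n N' A (res m \<eta>) (res m \<zeta>)"
    using yrep_unique[OF n W N(4,5,1,2)] by blast
  note r = yrep_refine[OF _ m(2,4,3) N(1) m(1) W]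
  show ?thesis
    by (rule yrelI[OF m(1,3) yrep_cong[OF r[OF N(3)] m(5)] r[OF N(6)]])
qed

lemma yrep_ident:
  assumes "\<delta> \<in> ext W M" "W \<in> obj" "M \<in> obj" "wft A \<xi> n M" "eqv n M A \<xi> \<eta>"
  shows "rep n A M \<delta> (Tens \<xi> M \<delta>) \<eta>"
  using assms ET1_push_ident[OF assms(2,3,1)] ident_mor[OF assms(3)] ypull_ident[OF assms(4)] by auto

lemma yrep_Add:
  "\<lbrakk>rep n A N \<epsilon> s \<eta>; rep n A N \<epsilon> t \<zeta>\<rbrakk> \<Longrightarrow> rep n A N \<epsilon> (Add s t) (Add \<eta> \<zeta>)"
  using yeq.add[OF ywf_imp_yeq[OF yrep_wf] ywf_imp_yeq[OF yrep_wf]] by fastforce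

lemma yrep_Scale:
  "\<lbrakk>rep n A N \<epsilon> s \<eta>; r \<in> carrier K\<rbrakk> \<Longrightarrow> rep n A N \<epsilon> (Scale r s) (Scale r \<eta>)"
  using yeq.scale[OF _ ywf_imp_yeq[OF yrep_wf]] by fastforce

lemma yrelI':
  "\<lbrakk>N \<in> obj; \<epsilon> \<in> ext W N; rep n A N \<epsilon> s \<eta>; rep n A N \<epsilon> t \<zeta>;
    eqv n N A \<eta> \<zeta>\<rbrakk> \<Longrightarrow> rel n W A s t"
  using yrelI yrep_cong by fastforce

text \<open>Every generating rule holds at a stage, so a chain of rules collapses into one
  comparison. The degree is carried as \<open>l = Suc n\<close> with \<open>n\<close> positive,
  which excludes the rules for \<open>Base\<close>.\<close>

lemma yeq_imp_yrel: "\<lbrakk>eqv l W A s t; l = Suc n; 1 \<le> n\<rbrakk> \<Longrightarrow> rel n W A s t"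
proof (induction rule: yeq.induct)
  case (zero C A l)
  have "eqv n A A Zero Zero" using zero by (intro yeq.zero) auto
  then show ?case by (intro yrelI[OF zero(2) zero_Ext1[OF zero(1,2)]]) auto
next
  case (add l C A s s' t t')
  have C: "C \<in> obj" using yeq_Ob[OF add(1)] by blast
  obtain N \<epsilon> \<eta> \<zeta> where N: "N \<in> obj" "\<epsilon> \<in> ext C N"
    "rep n A N \<epsilon> s \<eta>" "rep n A N \<epsilon> s' \<eta>" "rep n A N \<epsilon> t \<zeta>" "rep n A N \<epsilon> t' \<zeta>"
    using yrel_combine[OF add.IH(1)[OF add.prems] add.IH(2)[OF add.prems] C] .
  show ?case by (rule yrelI[OF N(1,2) yrep_Add[OF N(3,5)] yrep_Add[OF N(4,6)]])
next
  case (scale r l C A s s')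
  then obtain N \<epsilon> \<eta> where N: "N \<in> obj" "\<epsilon> \<in> ext C N"
    "rep n A N \<epsilon> s \<eta>" "rep n A N \<epsilon> s' \<eta>" by (auto simp: yrel_def)
  show ?case by (rule yrelI[OF N(1,2) yrep_Scale[OF N(3) scale(1)] yrep_Scale[OF N(4) scale(1)]])
next
  case (tens C M \<delta> l A \<xi> \<xi>')
  then have e: "eqv n M A \<xi> \<xi>'" by simp
  note w = yeq_imp_ywf[OF e, THEN conjunct1] yeq_imp_ywf[OF e, THEN conjunct2]
  note r = yrep_ident[OF tens(3,1,2) _ ywf_imp_yeq]
  show ?case by (rule yrelI'[OF tens(2,3) r[OF w(1,1)] r[OF w(2,2)] e])
next
  case (sym l C A s t)
  then show ?case by (auto simp: yrel_def)
next
  case (trans l C A s t u)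
  then show ?case using yrel_trans yeq_Ob[OF trans(1)] by blast
next
  case (add_assoc l C A s t u)
  have C: "C \<in> obj" using yeq_Ob[OF add_assoc(1)] by blast
  obtain N \<epsilon> \<eta> \<zeta> where N: "N \<in> obj" "\<epsilon> \<in> ext C N"
    "rep n A N \<epsilon> s \<eta>" "rep n A N \<epsilon> t \<zeta>"
    using yrel_combine[OF add_assoc.IH(1)[OF add_assoc.prems] add_assoc.IH(2)[OF add_assoc.prems] C]
    by metis
  obtain M \<epsilon>' \<theta> where M: "M \<in> obj" "\<epsilon>' \<in> ext C M" "rep n A M \<epsilon>' u \<theta>"
    using add_assoc.IH(3)[OF add_assoc.prems] by (auto simp: yrel_def)
  obtain L p p' \<epsilon>'' where L: "L \<in> obj" "p \<in> arr L N" "p' \<in> arr L M"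
    "\<epsilon>'' \<in> ext C L" "psh p \<epsilon>'' = \<epsilon>" "psh p' \<epsilon>'' = \<epsilon>'"
    using common_refinement[OF N(2) M(2) C N(1) M(1)] .
  note r = yrep_refine[OF N(3) L(2,5,4) N(1) L(1) C] yrep_refine[OF N(4) L(2,5,4) N(1) L(1) C]
    yrep_refine[OF M(3) L(3,6,4) M(1) L(1) C]
  show ?case
    by (rule yrelI'[OF L(1,4) yrep_Add[OF yrep_Add[OF r(1,2)] r(3)] yrep_Add[OF r(1) yrep_Add[OF r(2,3)]]
          yeq.add_assoc[OF r[THEN yrep_wf, THEN ywf_imp_yeq]]])
next
  case (add_comm l C A s t)
  have C: "C \<in> obj" using yeq_Ob[OF add_comm(1)] by blast
  obtain N \<epsilon> \<eta> \<zeta> where N: "N \<in> obj" "\<epsilon> \<in> ext C N"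
    "rep n A N \<epsilon> s \<eta>" "rep n A N \<epsilon> t \<zeta>"
    using yrel_combine[OF add_comm.IH(1)[OF add_comm.prems] add_comm.IH(2)[OF add_comm.prems] C]
    by metis
  show ?case
    by (rule yrelI'[OF N(1,2) yrep_Add[OF N(3,4)] yrep_Add[OF N(4,3)]
          yeq.add_comm[OF N(3,4)[THEN yrep_wf, THEN ywf_imp_yeq]]])
next
  case (scale_add_right r l C A s t)
  have C: "C \<in> obj" using yeq_Ob[OF scale_add_right(2)] by blast
  obtain N \<epsilon> \<eta> \<zeta> where N: "N \<in> obj" "\<epsilon> \<in> ext C N"
    "rep n A N \<epsilon> s \<eta>" "rep n A N \<epsilon> t \<zeta>"
    using yrel_combine[OF scale_add_right.IH(1)[OF scale_add_right.prems]
        scale_add_right.IH(2)[OF scale_add_right.prems] C] by metis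
  note S = yrep_Scale[OF _ scale_add_right(1)]
  show ?case
    by (rule yrelI'[OF N(1,2) S[OF yrep_Add[OF N(3,4)]] yrep_Add[OF S[OF N(3)] S[OF N(4)]]
          yeq.scale_add_right[OF scale_add_right(1) N(3,4)[THEN yrep_wf, THEN ywf_imp_yeq]]])
next
  case (tens_add_left C M \<delta> l A \<xi> \<eta>)
  then have w: "wft A \<xi> n M" "wft A \<eta> n M" "wft A (Add \<xi> \<eta>) n M" using yeq_imp_ywf by auto
  note r = yrep_ident[OF tens_add_left(3,1,2) _ ywf_imp_yeq]
  show ?case
    by (rule yrelI[OF tens_add_left(2,3) r[OF w(3,3)] yrep_Add[OF r[OF w(1,1)] r[OF w(2,2)]]])
next
  case (tens_add_right C M \<delta> \<epsilon> l A \<xi>)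
  then have w: "wft A \<xi> n M" using yeq_imp_ywf by auto
  \<comment> \<open>Both right factors come from one \<open>\<theta>\<close> along \<open>p\<close>
    and \<open>p'\<close>, so their sum is its pushforward along the sum of \<open>p\<close> and
    \<open>p'\<close>.\<close>
  obtain N p p' \<theta> where N: "N \<in> obj" "p \<in> arr N M" "p' \<in> arr N M"
    "\<theta> \<in> ext C N" "psh p \<theta> = \<delta>" "psh p' \<theta> = \<epsilon>"
    using common_refinement[OF tens_add_right(3,4,1,2,2)] .
  note M = tens_add_right(2) and y = ywf_ypull[OF w N(2,1), THEN ywf_imp_yeq] ywf_ypull[OF w N(3,1), THEN ywf_imp_yeq]
  have "rep n A N \<theta> (Tens \<xi> M (\<delta> \<oplus>\<^bsub>Ext1 \<C> C M\<^esub> \<epsilon>)) (Add (res p \<xi>) (res p' \<xi>))"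
    using ypull_add_mor[OF w N(2,3,1)] push_mor_add[OF N(4,2,3) tens_add_right(1) N(1) M]
      N w M add_mor[OF N(2,3,1) M] by auto
  moreover have "rep n A N \<theta> (Add (Tens \<xi> M \<delta>) (Tens \<xi> M \<epsilon>)) (Add (res p \<xi>) (res p' \<xi>))"
    using N w M y yeq.add[OF y] by auto
  ultimately show ?case by (rule yrelI[OF N(1,4)])
next
  case (tens_scale_left C M \<delta> r l A \<xi>)
  then have w: "wft A \<xi> n M" "wft A (Scale r \<xi>) n M" using yeq_imp_ywf by auto
  note R = yrep_ident[OF tens_scale_left(3,1,2) _ ywf_imp_yeq]
  show ?case
    by (rule yrelI[OF tens_scale_left(2,3) R[OF w(2,2)] yrep_Scale[OF R[OF w(1,1)] tens_scale_left(4)]])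
next
  case (tens_scale_right C M \<delta> r l A \<xi>)
  then have w: "wft A \<xi> n M" using yeq_imp_ywf by auto
  note M = tens_scale_right(2) and r = tens_scale_right(4) and i = ident_mor[OF tens_scale_right(2)]
  \<comment> \<open>The scalar is absorbed into the connecting map, which becomes \<open>r\<close>
    times the identity of \<open>M\<close>.\<close>
  have "psh (r \<odot>\<^bsub>Hom \<C> M M\<^esub> idn M) \<delta> = r \<odot>\<^bsub>Ext1 \<C> C M\<^esub> \<delta>"
    using push_mor_smult[OF r tens_scale_right(3) i tens_scale_right(1) M M]
      ET1_push_ident[OF tens_scale_right(1) M tens_scale_right(3)] by simp
  moreover have "eqv n M A (res (r \<odot>\<^bsub>Hom \<C> M M\<^esub> idn M) \<xi>) (Scale r \<xi>)"
    using ypull_smult_mor[OF w r i M] ypull_ident[OF w] by simp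
  ultimately have "rep n A M \<delta> (Tens \<xi> M (r \<odot>\<^bsub>Ext1 \<C> C M\<^esub> \<delta>)) (Scale r \<xi>)"
    using M w Hom_smult_closed[OF r i M M] by auto
  then show ?case
    by (rule yrelI[OF tens_scale_right(2,3) _
          yrep_Scale[OF yrep_ident[OF tens_scale_right(3,1,2) w ywf_imp_yeq[OF w]] r]])
next
  case (coend C M N f \<delta> l A \<xi>)
  then have w: "wft A \<xi> n N" using yeq_imp_ywf by auto
  note w' = ywf_ypull[OF w coend(4,2)]
  \<comment> \<open>At the stage \<open>\<delta>\<close> the map \<open>f\<close> itself witnesses
    the right side of the coend relation.\<close>
  have "rep n A M \<delta> (Tens \<xi> N (psh f \<delta>)) (res f \<xi>)"
    using coend(1-5) w ywf_imp_yeq[OF w'] by auto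
  then show ?case by (rule yrelI[OF coend(2,5) yrep_ident[OF coend(5,1,2) w' ywf_imp_yeq[OF w']]])
next
  case (add_zero l C A s)
  then obtain N \<epsilon> \<eta> where N: "N \<in> obj" "\<epsilon> \<in> ext C N" "rep n A N \<epsilon> s \<eta>"
    by (auto simp: yrel_def)
  note w = ywf_imp_yeq[OF yrep_wf[OF N(3)]]
  have z: "rep n A N \<epsilon> Zero Zero" using yeq_Ob[OF w] by (auto intro: yeq.zero)
  show ?case
    by (rule yrelI'[OF N(1,2) yrep_Add[OF z N(3)] N(3) yeq.add_zero[OF w]])
next
  case (scale_zero l C A s)
  then obtain N \<epsilon> \<eta> where N: "N \<in> obj" "\<epsilon> \<in> ext C N" "rep n A N \<epsilon> s \<eta>"
    by (auto simp: yrel_def)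
  note w = ywf_imp_yeq[OF yrep_wf[OF N(3)]]
  have z: "rep n A N \<epsilon> Zero Zero" using yeq_Ob[OF w] by (auto intro: yeq.zero)
  show ?case
    by (rule yrelI'[OF N(1,2) yrep_Scale[OF N(3) zero_closed] z yeq.scale_zero[OF w]])
next
  case (scale_one l C A s)
  then obtain N \<epsilon> \<eta> where N: "N \<in> obj" "\<epsilon> \<in> ext C N" "rep n A N \<epsilon> s \<eta>"
    by (auto simp: yrel_def)
  show ?case
    by (rule yrelI'[OF N(1,2) yrep_Scale[OF N(3) one_closed] N(3) yeq.scale_one[OF ywf_imp_yeq[OF yrep_wf[OF N(3)]]]])
next
  case (scale_scale q r l C A s)
  then obtain N \<epsilon> \<eta> where N: "N \<in> obj" "\<epsilon> \<in> ext C N" "rep n A N \<epsilon> s \<eta>"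
    by (auto simp: yrel_def)
  note qr = scale_scale(1,2)
  show ?case
    by (rule yrelI'[OF N(1,2) yrep_Scale[OF N(3) m_closed[OF qr]] yrep_Scale[OF yrep_Scale[OF N(3) qr(2)] qr(1)]
          yeq.scale_scale[OF qr ywf_imp_yeq[OF yrep_wf[OF N(3)]]]])
next
  case (scale_add_left q r l C A s)
  then obtain N \<epsilon> \<eta> where N: "N \<in> obj" "\<epsilon> \<in> ext C N" "rep n A N \<epsilon> s \<eta>"
    by (auto simp: yrel_def)
  note qr = scale_add_left(1,2) and S = yrep_Scale[OF N(3)]
  show ?case
    by (rule yrelI'[OF N(1,2) S[OF a_closed[OF qr]] yrep_Add[OF S[OF qr(1)] S[OF qr(2)]]
          yeq.scale_add_left[OF qr ywf_imp_yeq[OF yrep_wf[OF N(3)]]]])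
qed simp_all

text \<open>Agreement with \<open>Zero\<close> at a stage says that the representative of the tensor
  there, a pullback of \<open>\<xi>\<close>, vanishes.\<close>

lemma Tens_eq_Zero:
  assumes "1 \<le> n" "eqv (Suc n) W A (Tens \<xi> M \<delta>) Zero"
  obtains N a \<epsilon> where "N \<in> obj" "a \<in> arr N M" "\<epsilon> \<in> ext W N" "psh a \<epsilon> = \<delta>"
    "eqv n N A (res a \<xi>) Zero"
proof -
  obtain N \<epsilon> \<eta> where "N \<in> obj" "\<epsilon> \<in> ext W N" "rep n A N \<epsilon> (Tens \<xi> M \<delta>) \<eta>"
    "rep n A N \<epsilon> Zero \<eta>"
    using yeq_imp_yrel[OF assms(2) refl assms(1)] by (auto simp: yrel_def)
  moreover from this obtain a where "a \<in> arr N M" "psh a \<epsilon> = \<delta>"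
    "eqv n N A (res a \<xi>) \<eta>" "eqv n N A \<eta> Zero" by (auto intro: yeq.sym)
  ultimately show thesis using that yeq.trans[of K \<C> n N A _ \<eta> Zero] by blast
qed

end

section \<open>Long exact sequences\<close>

text \<open>Evaluates expressions of degree 1, among which \<open>Tens\<close> does not occur. Its
  invariance under \<open>yeq\<close> shows that \<open>Base\<close> identifies no distinct
  extensions.\<close>

primrec yval :: "('o, 'k, 'm, 'e, 'z) extri_cat_scheme \<Rightarrow> 'o \<Rightarrow> 'o \<Rightarrow> ('o, 'k, 'e) yterm \<Rightarrow> 'e"
  where
    "yval \<C> C A (Base \<delta>) = \<delta>"
  | "yval \<C> C A Zero = \<zero>\<^bsub>Ext1 \<C> C A\<^esub>"
  | "yval \<C> C A (Add s t) = yval \<C> C A s \<oplus>\<^bsub>Ext1 \<C> C A\<^esub> yval \<C> C A t"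
  | "yval \<C> C A (Scale r s) = r \<odot>\<^bsub>Ext1 \<C> C A\<^esub> yval \<C> C A s"
  | "yval \<C> C A (Tens \<xi> M \<delta>) = undefined"

text \<open>The covariant variable of an iterated tensor belongs to its innermost left factor, a
  \<open>Base\<close> leaf; so covariant operations act by substitution at these leaves.\<close>

primrec ymap :: "('e \<Rightarrow> ('o, 'k, 'e) yterm) \<Rightarrow> ('o, 'k, 'e) yterm \<Rightarrow> ('o, 'k, 'e) yterm"
  where
    "ymap f (Base \<delta>) = f \<delta>"
  | "ymap f Zero = Zero"
  | "ymap f (Add s t) = Add (ymap f s) (ymap f t)"
  | "ymap f (Scale r s) = Scale r (ymap f s)"
  | "ymap f (Tens \<xi> M \<delta>) = Tens (ymap f \<xi>) M \<delta>"

context linear_extriangulated_category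
begin

lemma yval_closed: "wft A t n C \<Longrightarrow> n = 1 \<Longrightarrow> yval \<C> C A t \<in> ext C A"
  by (induction t) (auto simp: zero_Ext1 Ext1_add_closed Ext1_smult_closed dest: ywf_Ob)

lemma yval_cong: "eqv n C A s t \<Longrightarrow> n = 1 \<Longrightarrow> yval \<C> C A s = yval \<C> C A t"
proof (induction rule: yeq.induct)
  case (add_assoc n C A s t u)
  interpret E: abelian_group "Ext1 \<C> C A"
    using Ext1_abelian_group yeq_Ob[OF add_assoc(1)] by blast
  show ?case using add_assoc by (auto simp: E.a_assoc dest!: yeq_imp_ywf yval_closed)
next
  case (add_comm n C A s t)
  interpret E: abelian_group "Ext1 \<C> C A"
    using Ext1_abelian_group yeq_Ob[OF add_comm(1)] by blast
  show ?case using add_comm by (auto simp: E.a_comm dest!: yeq_imp_ywf yval_closed)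
next
  case (add_zero n C A s)
  interpret E: abelian_group "Ext1 \<C> C A"
    using Ext1_abelian_group yeq_Ob[OF add_zero(1)] by blast
  show ?case using add_zero by (auto dest!: yeq_imp_ywf yval_closed)
next
  case (scale_zero n C A s)
  then show ?case using zero_smult_Ext1 yeq_Ob[OF scale_zero(1)] yval_closed yeq_imp_ywf
    by (metis yval.simps(2,4))
next
  case (scale_one n C A s)
  interpret E: vectorspace K "Ext1 \<C> C A"
    using ET1_vectorspace yeq_Ob[OF scale_one(1)] by blast
  show ?case using scale_one by (auto dest!: yeq_imp_ywf yval_closed)
next
  case (scale_scale q r n C A s)
  interpret E: vectorspace K "Ext1 \<C> C A"
    using ET1_vectorspace yeq_Ob[OF scale_scale(3)] by blast
  show ?case using scale_scale by (auto simp: E.smult_assoc1 dest!: yeq_imp_ywf yval_closed)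
next
  case (scale_add_left q r n C A s)
  interpret E: vectorspace K "Ext1 \<C> C A"
    using ET1_vectorspace yeq_Ob[OF scale_add_left(3)] by blast
  show ?case using scale_add_left by (auto simp: E.smult_l_distr dest!: yeq_imp_ywf yval_closed)
next
  case (scale_add_right r n C A s t)
  interpret E: vectorspace K "Ext1 \<C> C A"
    using ET1_vectorspace yeq_Ob[OF scale_add_right(2)] by blast
  show ?case using scale_add_right by (auto simp: E.smult_r_distr dest!: yeq_imp_ywf yval_closed)
qed (auto dest!: yeq_Ob)

lemma yeq_Base_iff:
  assumes "\<delta> \<in> ext C A" "C \<in> obj" "A \<in> obj"
  shows "eqv 1 C A (Base \<delta>) (Base \<epsilon>) \<longleftrightarrow> \<delta> = \<epsilon>"
  using yval_cong[of 1 C A "Base \<delta>" "Base \<epsilon>"] yeq.base[OF assms(2,3,1), of K] by auto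

lemma yeq_Base_Zero_iff:
  assumes "\<delta> \<in> ext C A" "C \<in> obj" "A \<in> obj"
  shows "eqv 1 C A (Base \<delta>) Zero \<longleftrightarrow> \<delta> = zext C A"
  using yval_cong[of 1 C A "Base \<delta>" Zero] yeq_Base_zero[OF assms(2,3)] by auto

text \<open>Exactness at the middle term of the contravariant sequence, required for all triangles
  at once: the passage to degree \<open>n + 1\<close> applies it to triangles other than the given
  one.\<close>

definition half_exact :: "nat \<Rightarrow> 'o \<Rightarrow> bool"
  where "half_exact n V \<longleftrightarrow> (\<forall>A x B y C \<delta> \<beta>. etri A x B y C \<delta> \<longrightarrow> wft V \<beta> n B \<longrightarrow>
    eqv n A V (res x \<beta>) Zero \<longrightarrow> (\<exists>\<gamma>. wft V \<gamma> n C \<and> eqv n B V \<beta> (res y \<gamma>)))"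

text \<open>
  Replaces the bicartesian square of \<open>a\<close> and the inflation of \<open>\<epsilon>\<close> in the usual argument: if
  \<open>N \<rightarrow> G \<rightarrow> B\<close>, with maps \<open>i\<close> and \<open>g\<close>, realizes \<open>y\<^sup>* \<epsilon>\<close>, then \<open>a = s i\<close> and
  \<open>i\<^sub>* \<epsilon> = r\<^sub>* \<delta>\<close> for some \<open>s\<close> and \<open>r\<close>, and both \<open>1 - s r\<close> and \<open>g r\<close> factor through \<open>u\<close>.
\<close>

lemma vanish_extends:
  assumes n: "1 \<le> n" and he: "half_exact n V" and T: "etri M u B y W \<delta>"
    and xi: "wft V \<xi> n M" and van: "eqv (Suc n) W V (Tens \<xi> M \<delta>) Zero"
  obtains \<beta> where "wft V \<beta> n B" "eqv n M V \<xi> (res u \<beta>)"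
proof -
  note t = etriangleD[OF T]
  obtain N a \<epsilon> where N: "N \<in> obj" "a \<in> arr N M" "\<epsilon> \<in> ext W N" "psh a \<epsilon> = \<delta>"
    "eqv n N V (res a \<xi>) Zero"
    using Tens_eq_Zero[OF n van] .
  note ye = pull_closed[OF N(3) t(5,3,2) N(1)]
  obtain G i g where TG: "etri N i G g B (pll y \<epsilon>)" using ex_etriangle[OF ye t(2) N(1)] .
  note tg = etriangleD[OF TG]
  have "psh a (pll y \<epsilon>) = zext B M"
    using push_pull[OF N(3,2) t(5,3,2) N(1) t(1)] N(4) pull_deflation[OF T] by simp
  then obtain s where s: "s \<in> arr G M" "a = s \<cdot> i"
    using exact_Hom_A_contra[OF TG t(1) N(2)] by blast
  note sx = ywf_ypull[OF xi s(1) tg(2)]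
  have "eqv n N V (res i (res s \<xi>)) Zero"
    using N(5) ypull_comp[OF xi s(1) tg(4,2,1)] s(2) by simp
  \<comment> \<open>Since \<open>res s \<xi>\<close> vanishes on \<open>N\<close>, half exactness
    for the triangle realizing \<open>pll y \<epsilon>\<close> lets it descend to
    \<open>B\<close>.\<close>
  then obtain \<beta>' where b': "wft V \<beta>' n B" "eqv n G V (res s \<xi>) (res g \<beta>')"
    using he[unfolded half_exact_def] TG sx by blast
  note ie = push_closed[OF N(3) tg(4) t(3) N(1) tg(2)]
  have "pll y (psh i \<epsilon>) = zext B G"
    using push_pull[OF N(3) tg(4) t(5,3,2) N(1) tg(2)] push_inflation[OF TG] by simp
  then obtain r where r: "r \<in> arr M G" "psh i \<epsilon> = psh r \<delta>"
    using exact_Ext_C_contra[OF T tg(2) ie] by blast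
  note sr = comp_closed[OF r(1) s(1) t(1) tg(2) t(1)]
  note id = ident_mor[OF t(1)]
  have "psh (s \<cdot> r) \<delta> = \<delta>"
    using push_comp[OF t(6) r(1) s(1) t(3,1) tg(2) t(1)] push_comp[OF N(3) tg(4) s(1) t(3) N(1) tg(2) t(1)]
      r(2) s(2) N(4) by simp
  then have "psh (idn M \<ominus>\<^bsub>Hom \<C> M M\<^esub> (s \<cdot> r)) \<delta> = \<delta> \<ominus>\<^bsub>Ext1 \<C> W M\<^esub> \<delta>"
    using push_mor_minus[OF t(6) id sr t(3,1,1)] ET1_push_ident[OF t(3,1,6)] by simp
  also have "\<dots> = zext W M"
    using abelian_group.r_neg[OF Ext1_abelian_group[OF t(3,1)] t(6)] by (simp add: a_minus_def)
  finally obtain q where q: "q \<in> arr B M" "idn M \<ominus>\<^bsub>Hom \<C> M M\<^esub> (s \<cdot> r) = q \<cdot> u"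
    using exact_Hom_A_contra[OF T t(1) minus_mor[OF id sr t(1,1)]] by blast
  note qu = comp_closed[OF t(4) q(1) t(1,2,1)]
  interpret H: abelian_group "Hom \<C> M M" by (rule Hom_abelian_group[OF t(1,1)])
  have id_eq: "idn M = (q \<cdot> u) \<oplus>\<^bsub>Hom \<C> M M\<^esub> (s \<cdot> r)"
    using q(2)[symmetric] id sr by (simp add: a_minus_def H.a_assoc H.l_neg)
  note gr = comp_closed[OF r(1) tg(5) t(1) tg(2) t(2)]
  have "psh (g \<cdot> r) \<delta> = psh (g \<cdot> i) \<epsilon>"
    using push_comp[OF t(6) r(1) tg(5) t(3,1) tg(2) t(2)] push_comp[OF N(3) tg(4,5) t(3) N(1) tg(2) t(2)]
      r(2) by simp
  then have "psh (g \<cdot> r) \<delta> = zext W B"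
    using etriangle_comp_zero[OF TG] push_mor_zero[OF N(3) t(3) N(1) t(2)] by simp
  then obtain l where l: "l \<in> arr B B" "g \<cdot> r = l \<cdot> u"
    using exact_Hom_A_contra[OF T t(2) gr] by blast
  \<comment> \<open>Replacing \<open>res s \<xi>\<close> by \<open>res g \<beta>'\<close> turns the
    pullback along \<open>s \<cdot> r\<close> into one along \<open>g \<cdot> r\<close>, which
    factors through \<open>u\<close>.\<close>
  have 1: "eqv n M V (res (s \<cdot> r) \<xi>) (res u (res l \<beta>'))"
    using ypull_cong[OF b'(2) r(1) t(1)] ypull_comp[OF xi s(1) r(1) tg(2) t(1)]
      ypull_comp[OF b'(1) tg(5) r(1) tg(2) t(1)] ypull_comp[OF b'(1) l(1) t(4,2,1)] l(2) by simp
  have "eqv n M V (res (idn M) \<xi>) (Add (res (q \<cdot> u) \<xi>) (res (s \<cdot> r) \<xi>))"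
    using ypull_add_mor[OF xi qu sr t(1)] id_eq by simp
  also have "eqv n M V \<dots> (Add (res u (res q \<xi>)) (res u (res l \<beta>')))"
    using yeq.add[OF ywf_imp_yeq[OF ywf_ypull[OF xi qu t(1)]] 1] ypull_comp[OF xi q(1) t(4,2,1)] by simp
  finally have "eqv n M V \<xi> (res u (Add (res q \<xi>) (res l \<beta>')))"
    using ypull_ident[OF xi] by simp
  moreover have "wft V (Add (res q \<xi>) (res l \<beta>')) n B"
    using ywf_ypull[OF xi q(1) t(2)] ywf_ypull[OF b'(1) l(1) t(2)] by simp
  ultimately show thesis using that by blast
qed

lemma half_exact_1: "half_exact 1 V"
  unfolding half_exact_def
proof (intro allI impI)
  fix A x B y C \<delta> \<beta>
  assume T: "etri A x B y C \<delta>" and b: "wft V \<beta> 1 B"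
    and z: "eqv 1 A V (res x \<beta>) Zero"
  note t = etriangleD[OF T]
  have V: "V \<in> obj" using ywf_Ob[OF b] by blast
  obtain \<epsilon> where e: "\<epsilon> \<in> ext B V" "eqv 1 B V \<beta> (Base \<epsilon>)" using ex_Base[OF b] by blast
  have "eqv 1 A V (Base (pll x \<epsilon>)) Zero"
    using yeq.trans[OF yeq.sym[OF ypull_cong[OF e(2) t(4,1)]] z] by simp
  then have "pll x \<epsilon> = zext A V"
    using yeq_Base_Zero_iff[OF pull_closed[OF e(1) t(4,2,1) V] t(1) V] by blast
  then obtain \<theta> where "\<theta> \<in> ext C V" "\<epsilon> = pll y \<theta>"
    using exact_Ext_B_contra[OF T V e(1)] by blast
  then show "\<exists>\<gamma>. wft V \<gamma> 1 C \<and> eqv 1 B V \<beta> (res y \<gamma>)"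
    using e t V by (intro exI[of _ "Base \<theta>"]) auto
qed

text \<open>Write \<open>\<beta>\<close> as the tensor of \<open>\<xi>\<close> and
  \<open>\<epsilon>\<close>. Vanishing along \<open>x\<close> extends \<open>\<xi>\<close> over the
  inflation \<open>m\<close> realizing \<open>pll x \<epsilon>\<close>. The coend relation then
  moves \<open>m\<close> to the right factor, and \<open>psh m \<epsilon>\<close> comes from
  \<open>C\<close> by exactness in degree 1.\<close>

lemma half_exact_Suc:
  assumes n: "1 \<le> n" and he: "half_exact n V"
  shows "half_exact (Suc n) V"
  unfolding half_exact_def
proof (intro allI impI)
  fix A x B y C \<delta> \<beta>
  assume T: "etri A x B y C \<delta>" and b: "wft V \<beta> (Suc n) B"
    and z: "eqv (Suc n) A V (res x \<beta>) Zero"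
  note t = etriangleD[OF T]
  obtain M \<xi> \<epsilon> where M: "M \<in> obj" "wft V \<xi> n M" "\<epsilon> \<in> ext B M"
    "eqv (Suc n) B V \<beta> (Tens \<xi> M \<epsilon>)" using ex_Tens[OF n b] by blast
  note xe = pull_closed[OF M(3) t(4,2,1) M(1)]
  obtain D m d where TD: "etri M m D d A (pll x \<epsilon>)" using ex_etriangle[OF xe t(1) M(1)] .
  note td = etriangleD[OF TD]
  have "eqv (Suc n) A V (Tens \<xi> M (pll x \<epsilon>)) Zero"
    using yeq.trans[OF yeq.sym[OF ypull_cong[OF M(4) t(4,1)]] z] by simp
  then obtain \<eta> where e: "wft V \<eta> n D" "eqv n M V \<xi> (res m \<eta>)"
    using vanish_extends[OF n he TD M(2)] by blast
  note me = push_closed[OF M(3) td(4) t(2) M(1) td(2)]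
  have "pll x (psh m \<epsilon>) = zext A D"
    using push_pull[OF M(3) td(4) t(4,2,1) M(1) td(2)] push_inflation[OF TD] by simp
  then obtain \<theta> where th: "\<theta> \<in> ext C D" "psh m \<epsilon> = pll y \<theta>"
    using exact_Ext_B_contra[OF T td(2) me] by blast
  note M(4)
  also have "eqv (Suc n) B V (Tens \<xi> M \<epsilon>) (Tens (res m \<eta>) M \<epsilon>)"
    by (rule yeq.tens[OF t(2) M(1,3) e(2)])
  also have "eqv (Suc n) B V \<dots> (Tens \<eta> D (psh m \<epsilon>))"
    by (rule yeq.coend[OF t(2) M(1) td(2,4) M(3) ywf_imp_yeq[OF e(1)]])
  finally have "eqv (Suc n) B V \<beta> (res y (Tens \<eta> D \<theta>))" using th(2) by simp
  moreover have "wft V (Tens \<eta> D \<theta>) (Suc n) C" using e th t td by simp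
  ultimately show "\<exists>\<gamma>. wft V \<gamma> (Suc n) C \<and> eqv (Suc n) B V \<beta> (res y \<gamma>)" by blast
qed

lemma half_exact: "1 \<le> n \<Longrightarrow> half_exact n V"
proof (induction n rule: dec_induct)
  case base
  show ?case by (rule half_exact_1)
next
  case (step n)
  then show ?case by (intro half_exact_Suc) auto
qed

lemma exact_higher_B_contra:
  assumes "etri A x B y C \<delta>" "wft V \<beta> n B" "eqv n A V (res x \<beta>) Zero"
  shows "\<exists>\<gamma>. wft V \<gamma> n C \<and> eqv n B V \<beta> (res y \<gamma>)"
  using half_exact[of n V] assms ywf_Ob[OF assms(2)] unfolding half_exact_def by blast

lemma exact_higher_A_contra:
  assumes "etri A x B y C \<delta>" "wft V \<alpha> n A" "eqv (Suc n) C V (Tens \<alpha> A \<delta>) Zero"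
  shows "\<exists>\<beta>. wft V \<beta> n B \<and> eqv n A V \<alpha> (res x \<beta>)"
proof -
  have n: "1 \<le> n" using ywf_Ob[OF assms(2)] by blast
  show ?thesis using vanish_extends[OF n half_exact[OF n] assms] by blast
qed

text \<open>As in \<open>half_exact_Suc\<close>, except that \<open>psh m \<epsilon>\<close> is now
  killed by \<open>y\<close> and hence equals \<open>psh a \<delta>\<close> for some
  \<open>a\<close>, which the coend relation moves back to the left factor.\<close>

lemma exact_higher_C_contra:
  assumes T: "etri A x B y C \<delta>" and g: "wft V \<gamma> (Suc n) C" and n: "1 \<le> n"
    and z: "eqv (Suc n) B V (res y \<gamma>) Zero"
  shows "\<exists>\<alpha>. wft V \<alpha> n A \<and> eqv (Suc n) C V \<gamma> (Tens \<alpha> A \<delta>)"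
proof -
  note t = etriangleD[OF T]
  obtain M \<xi> \<epsilon> where M: "M \<in> obj" "wft V \<xi> n M" "\<epsilon> \<in> ext C M"
    "eqv (Suc n) C V \<gamma> (Tens \<xi> M \<epsilon>)" using ex_Tens[OF n g] by blast
  note ye = pull_closed[OF M(3) t(5,3,2) M(1)]
  obtain D m d where TD: "etri M m D d B (pll y \<epsilon>)" using ex_etriangle[OF ye t(2) M(1)] .
  note td = etriangleD[OF TD]
  have "eqv (Suc n) B V (Tens \<xi> M (pll y \<epsilon>)) Zero"
    using yeq.trans[OF yeq.sym[OF ypull_cong[OF M(4) t(5,2)]] z] by simp
  then obtain \<eta> where e: "wft V \<eta> n D" "eqv n M V \<xi> (res m \<eta>)"
    using vanish_extends[OF n half_exact[OF n] TD M(2)] by blast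
  note me = push_closed[OF M(3) td(4) t(3) M(1) td(2)]
  have "pll y (psh m \<epsilon>) = zext B D"
    using push_pull[OF M(3) td(4) t(5,3,2) M(1) td(2)] push_inflation[OF TD] by simp
  then obtain a where a: "a \<in> arr A D" "psh m \<epsilon> = psh a \<delta>"
    using exact_Ext_C_contra[OF T td(2) me] by blast
  note M(4)
  also have "eqv (Suc n) C V (Tens \<xi> M \<epsilon>) (Tens (res m \<eta>) M \<epsilon>)"
    by (rule yeq.tens[OF t(3) M(1,3) e(2)])
  also have "eqv (Suc n) C V \<dots> (Tens \<eta> D (psh m \<epsilon>))"
    by (rule yeq.coend[OF t(3) M(1) td(2,4) M(3) ywf_imp_yeq[OF e(1)]])
  also have "eqv (Suc n) C V (Tens \<eta> D (psh m \<epsilon>)) (Tens (res a \<eta>) A \<delta>)"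
    using yeq_Tens_refine[OF t(1) td(2) a(1) t(6,3) e(1)] a(2) by simp
  finally show ?thesis using ywf_ypull[OF e(1) a(1) t(1)] by blast
qed

lemma Tens_inflation_zero:
  assumes T: "etri A x B y C \<delta>" and b: "wft V \<beta> n B"
  shows "eqv (Suc n) C V (Tens (res x \<beta>) A \<delta>) Zero"
proof -
  note t = etriangleD[OF T]
  have "eqv (Suc n) C V (Tens (res x \<beta>) A \<delta>) (Tens \<beta> B (psh x \<delta>))"
    by (rule yeq.coend[OF t(3,1,2,4,6) ywf_imp_yeq[OF b]])
  also have "eqv (Suc n) C V (Tens \<beta> B (psh x \<delta>)) Zero"
    using yeq_Tens_zero_right[OF t(3,2) b] push_inflation[OF T] by simp
  finally show ?thesis .
qed

lemma ypull_deflation_Tens: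
  assumes T: "etri A x B y C \<delta>" and a: "wft V \<alpha> n A"
  shows "eqv (Suc n) B V (res y (Tens \<alpha> A \<delta>)) Zero"
  using yeq_Tens_zero_right[OF etriangleD(2,1)[OF T] a] pull_deflation[OF T] by simp

lemma ypull_ypull_zero:
  assumes T: "etri A x B y C \<delta>" and g: "wft V \<gamma> n C"
  shows "eqv n A V (res x (res y \<gamma>)) Zero"
  using ypull_zero_mor[OF g etriangleD(1)[OF T]] ypull_comp[OF g etriangleD(5,4,2,1)[OF T]]
    etriangle_comp_zero[OF T] by simp

text \<open>Left multiplication by an element of \<open>\<E>\<^sup>k(A, A')\<close>, given by its values on \<open>\<E>(C, A)\<close>.\<close>

definition left_mult :: "nat \<Rightarrow> 'o \<Rightarrow> 'o \<Rightarrow> ('e \<Rightarrow> ('o, 'k, 'e) yterm) \<Rightarrow> bool"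
  where "left_mult k A A' f \<longleftrightarrow> A \<in> obj \<and> A' \<in> obj \<and> (\<forall>C \<in> obj. \<forall>\<delta> \<in> ext C A.
    wft A' (f \<delta>) (Suc k) C \<and>
    (\<forall>\<epsilon> \<in> ext C A. eqv (Suc k) C A' (f (\<delta> \<oplus>\<^bsub>Ext1 \<C> C A\<^esub> \<epsilon>)) (Add (f \<delta>) (f \<epsilon>))) \<and>
    (\<forall>r \<in> carrier K. eqv (Suc k) C A' (f (r \<odot>\<^bsub>Ext1 \<C> C A\<^esub> \<delta>)) (Scale r (f \<delta>))) \<and>
    (\<forall>B \<in> obj. \<forall>c \<in> arr B C. f (pll c \<delta>) = res c (f \<delta>)))"

lemma left_multD:
  assumes "left_mult k A A' f"
  shows "A \<in> obj" "A' \<in> obj"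
    and "\<lbrakk>C \<in> obj; \<delta> \<in> ext C A\<rbrakk> \<Longrightarrow> wft A' (f \<delta>) (Suc k) C"
    and "\<lbrakk>C \<in> obj; \<delta> \<in> ext C A; \<epsilon> \<in> ext C A\<rbrakk>
      \<Longrightarrow> eqv (Suc k) C A' (f (\<delta> \<oplus>\<^bsub>Ext1 \<C> C A\<^esub> \<epsilon>)) (Add (f \<delta>) (f \<epsilon>))"
    and "\<lbrakk>C \<in> obj; \<delta> \<in> ext C A; r \<in> carrier K\<rbrakk>
      \<Longrightarrow> eqv (Suc k) C A' (f (r \<odot>\<^bsub>Ext1 \<C> C A\<^esub> \<delta>)) (Scale r (f \<delta>))"
    and "\<lbrakk>C \<in> obj; B \<in> obj; \<delta> \<in> ext C A; c \<in> arr B C\<rbrakk>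
      \<Longrightarrow> f (pll c \<delta>) = res c (f \<delta>)"
  using assms unfolding left_mult_def by auto

lemma left_mult_push:
  assumes "a \<in> arr A A'" "A \<in> obj" "A' \<in> obj"
  shows "left_mult 0 A A' (\<lambda>\<delta>. Base (psh a \<delta>))"
  using assms yeq.base_add[of _ \<C> A' _ _ K] yeq.base_scale[of _ \<C> A' _ K]
  by (auto simp: left_mult_def push_closed push_add push_smult push_pull)

lemma left_mult_conn:
  assumes "\<delta> \<in> ext C A" "C \<in> obj" "A \<in> obj"
  shows "left_mult 1 C A (\<lambda>\<epsilon>. Tens (Base \<delta>) C \<epsilon>)"
  using assms yeq.tens_add_right[of _ \<C> C _ _ K 1 A "Base \<delta>"] yeq.tens_scale_right[of _ \<C> C _ _ K 1 A "Base \<delta>"]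
    yeq.base[of C \<C> A \<delta> K]
  by (auto simp: left_mult_def)

lemma ymap_wf:
  assumes "left_mult k A A' f"
  shows "wft A t n C \<Longrightarrow> wft A' (ymap f t) (n + k) C"
  using left_multD[OF assms] by (induction t arbitrary: n C) auto

lemma ymap_ypull:
  assumes "left_mult k A A' f" "c \<in> arr B C" "B \<in> obj"
  shows "wft A t n C \<Longrightarrow> ymap f (res c t) = res c (ymap f t)"
  using assms(2,3) left_multD[OF assms(1)] by (induction t arbitrary: n) auto

lemma ymap_cong:
  assumes lm: "left_mult k A A' f"
  shows "eqv n C A0 s t \<Longrightarrow> A0 = A \<Longrightarrow> eqv (n + k) C A' (ymap f s) (ymap f t)"
proof (induction rule: yeq.induct)
  case (coend C M N g \<delta> n A0 \<xi>)
  then have w: "wft A \<xi> n N" using yeq_imp_ywf by auto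
  show ?case
    using yeq.coend[OF coend(1-5) ywf_imp_yeq[OF ymap_wf[OF lm w]]] ymap_ypull[OF lm coend(4,2) w] by simp
next
  case (trans n C A0 s t u)
  then show ?case by (blast intro: yeq.trans)
qed (auto intro: yeq.zero yeq.add yeq.scale yeq.tens yeq.add_assoc yeq.add_comm yeq.add_zero yeq.scale_zero
    yeq.scale_one yeq.scale_scale yeq.scale_add_left yeq.scale_add_right yeq.tens_add_left
    yeq.tens_add_right yeq.tens_scale_left yeq.tens_scale_right ywf_imp_yeq left_multD[OF lm] dest: yeq.sym)

text \<open>Both maps act on the innermost extensions, so it is enough that their composite vanishes
  on \<open>Ext1\<close>.\<close>

lemma ymap_ymap_Zero:
  assumes f: "left_mult k A A' f" and g: "left_mult l A' A'' g"
    and z: "\<And>C \<delta>. \<lbrakk>C \<in> obj; \<delta> \<in> ext C A\<rbrakk> \<Longrightarrow> eqv (Suc k + l) C A'' (ymap g (f \<delta>)) Zero"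
  shows "wft A t n C \<Longrightarrow> eqv (n + k + l) C A'' (ymap g (ymap f t)) Zero"
proof (induction t arbitrary: n C)
  case (Base \<delta>)
  then show ?case using z by auto
next
  case Zero
  then show ?case using left_multD(2)[OF g] by (auto intro: yeq.zero)
next
  case (Add s t)
  have 0: "eqv (n + k + l) C A'' Zero Zero"
    using Add.prems left_multD(2)[OF g] by (auto intro!: yeq.zero dest: ywf_Ob)
  show ?case
    using yeq.trans[OF yeq.add yeq.add_zero[OF 0]] Add by auto
next
  case (Scale r s)
  have r: "r \<in> carrier K" and s: "wft A s n C" using Scale.prems by auto
  have "eqv (n + k + l) C A'' (Scale r (ymap g (ymap f s))) (Scale r Zero)"
    by (rule yeq.scale[OF r Scale.IH[OF s]])
  also have "eqv (n + k + l) C A'' \<dots> Zero"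
    using yeq_scale_Zero[OF r] ywf_Ob[OF s] left_multD(2)[OF g] by simp
  finally show ?case by simp
next
  case (Tens \<xi> M \<delta>)
  then obtain m where m: "n = Suc m" "M \<in> obj" "\<delta> \<in> ext C M" "wft A \<xi> m M" "C \<in> obj"
    by auto
  have "eqv (Suc (m + k + l)) C A'' (Tens (ymap g (ymap f \<xi>)) M \<delta>) (Tens Zero M \<delta>)"
    by (rule yeq.tens[OF m(5,2,3) Tens.IH[OF m(4)]])
  also have "eqv (Suc (m + k + l)) C A'' \<dots> Zero"
    using yeq_Tens_zero_left[OF m(5,2) left_multD(2)[OF g] m(3)] ywf_Ob[OF m(4)] by simp
  finally show ?case using m by simp
qed

text \<open>The numbers \<open>k\<close> and \<open>l\<close> are the degrees of the two
  multiplications, so that one notion covers the pushforwards (degree 0) and the connecting map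
  (degree 1).\<close>

definition exact_at ::
  "nat \<Rightarrow> nat \<Rightarrow> nat \<Rightarrow> 'o \<Rightarrow> 'o \<Rightarrow> 'o \<Rightarrow> ('e \<Rightarrow> ('o, 'k, 'e) yterm) \<Rightarrow> ('e \<Rightarrow> ('o, 'k, 'e) yterm) \<Rightarrow> bool"
  where "exact_at n k l A A' A'' f g \<longleftrightarrow> (\<forall>W t. wft A' t (n + k) W \<longrightarrow>
    eqv (n + k + l) W A'' (ymap g t) Zero \<longrightarrow>
    (\<exists>s. wft A s n W \<and> eqv (n + k) W A' t (ymap f s)))"

text \<open>Write \<open>t\<close> as the tensor of \<open>\<xi>\<close> and
  \<open>\<epsilon>\<close>. The vanishing criterion pulls \<open>\<xi>\<close> back to an element
  annihilated by \<open>g\<close>, which has a preimage under \<open>f\<close> in degree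
  \<open>n\<close>; tensoring the latter with \<open>\<epsilon>'\<close> gives a preimage of
  \<open>t\<close>.\<close>

lemma exact_at_Suc:
  assumes f: "left_mult k A A' f" and g: "left_mult l A' A'' g" and n: "1 \<le> n"
    and ex: "exact_at n k l A A' A'' f g"
  shows "exact_at (Suc n) k l A A' A'' f g"
  unfolding exact_at_def
proof (intro allI impI)
  fix W t
  assume t: "wft A' t (Suc n + k) W" and z: "eqv (Suc n + k + l) W A'' (ymap g t) Zero"
  have W: "W \<in> obj" using ywf_Ob[OF t] by blast
  obtain M \<xi> \<epsilon> where M: "M \<in> obj" "wft A' \<xi> (n + k) M" "\<epsilon> \<in> ext W M"
    "eqv (Suc (n + k)) W A' t (Tens \<xi> M \<epsilon>)"
    using ex_Tens[of "n + k" A' t W] n t by auto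
  have "eqv (Suc (n + k + l)) W A'' (Tens (ymap g \<xi>) M \<epsilon>) (ymap g t)"
    using ymap_cong[OF g yeq.sym[OF M(4)] refl] by simp
  also have "eqv (Suc (n + k + l)) W A'' (ymap g t) Zero" using z by simp
  finally have z': "eqv (Suc (n + k + l)) W A'' (Tens (ymap g \<xi>) M \<epsilon>) Zero" .
  have "1 \<le> n + k + l" using n by simp
  then obtain N a \<epsilon>' where N: "N \<in> obj" "a \<in> arr N M" "\<epsilon>' \<in> ext W N" "psh a \<epsilon>' = \<epsilon>"
    "eqv (n + k + l) N A'' (res a (ymap g \<xi>)) Zero"
    using Tens_eq_Zero[OF _ z'] by metis
  note aw = ywf_ypull[OF M(2) N(2,1)]
  have "eqv (n + k + l) N A'' (ymap g (res a \<xi>)) Zero"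
    using ymap_ypull[OF g N(2,1) M(2)] N(5) by simp
  then obtain s where s: "wft A s n N" "eqv (n + k) N A' (res a \<xi>) (ymap f s)"
    using ex aw unfolding exact_at_def by blast
  note M(4)
  also have "eqv (Suc (n + k)) W A' (Tens \<xi> M \<epsilon>) (Tens (res a \<xi>) N \<epsilon>')"
    using yeq_Tens_refine[OF N(1) M(1) N(2,3) W M(2)] N(4) by simp
  also have "eqv (Suc (n + k)) W A' \<dots> (Tens (ymap f s) N \<epsilon>')"
    by (rule yeq.tens[OF W N(1,3) s(2)])
  finally have "eqv (Suc n + k) W A' t (ymap f (Tens s N \<epsilon>'))" by simp
  moreover have "wft A (Tens s N \<epsilon>') (Suc n) W" using W N s by simp
  ultimately show "\<exists>s. wft A s (Suc n) W \<and> eqv (Suc n + k) W A' t (ymap f s)" by blast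
qed

lemma exact_at_induct:
  assumes "left_mult k A A' f" "left_mult l A' A'' g" "exact_at 1 k l A A' A'' f g" "1 \<le> n"
  shows "exact_at n k l A A' A'' f g"
  using assms(4) by (induction n rule: dec_induct) (use assms exact_at_Suc in auto)

lemma ymap_Base: "eqv 1 W A t (Base \<delta>) \<Longrightarrow> left_mult k A A' f \<Longrightarrow> eqv (Suc k) W A' (ymap f t) (f \<delta>)"
  using ymap_cong[of k A A' f 1 W A t "Base \<delta>"] by simp

section \<open>The covariant sequence of a triangle in positive degrees\<close>

context
  fixes A x B y C \<delta>
  assumes T: "etri A x B y C \<delta>"
begin

private lemmas high_tri = etriangleD[OF T]

private abbreviation "push_x \<equiv> \<lambda>\<epsilon>. Base (psh x \<epsilon>)"
private abbreviation "push_y \<equiv> \<lambda>\<epsilon>. Base (psh y \<epsilon>)"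
private abbreviation "conn \<equiv> \<lambda>\<epsilon>. Tens (Base \<delta>) C \<epsilon>"

private lemmas lm_x = left_mult_push[OF high_tri(4,1,2)]
private lemmas lm_y = left_mult_push[OF high_tri(5,2,3)]
private lemmas lm_conn = left_mult_conn[OF high_tri(6,3,1)]

lemma exact_higher_B_co_1: "exact_at 1 0 0 A B C push_x push_y"
  unfolding exact_at_def
proof (intro allI impI)
  fix W s
  assume s: "wft B s (1 + 0) W" and z: "eqv (1 + 0 + 0) W C (ymap push_y s) Zero"
  have W: "W \<in> obj" using ywf_Ob[OF s] by blast
  obtain \<epsilon> where e: "\<epsilon> \<in> ext W B" "eqv 1 W B s (Base \<epsilon>)" using ex_Base[of B s W] s by auto
  have "eqv 1 W C (push_y \<epsilon>) Zero"
    using yeq.trans[OF yeq.sym[OF ymap_Base[OF e(2) lm_y]]] z by simp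
  then have "psh y \<epsilon> = zext W C"
    using yeq_Base_Zero_iff[OF push_closed[OF e(1) high_tri(5) W high_tri(2,3)] W high_tri(3)] by blast
  then obtain \<theta> where "\<theta> \<in> ext W A" "\<epsilon> = psh x \<theta>"
    using exact_Ext_B_co[OF T W e(1)] by blast
  then show "\<exists>u. wft A u 1 W \<and> eqv (1 + 0) W B s (ymap push_x u)"
    using e W high_tri by (intro exI[of _ "Base \<theta>"]) auto
qed

text \<open>If the tensor of \<open>\<delta>\<close> and \<open>\<epsilon>\<close> vanishes, then
  \<open>\<epsilon>\<close> is a pushforward along some \<open>a\<close> with
  \<open>pll a \<delta>\<close> zero, and such an \<open>a\<close> lifts along
  \<open>y\<close>.\<close>

lemma exact_higher_C_co_1: "exact_at 1 0 1 B C A push_y conn"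
  unfolding exact_at_def
proof (intro allI impI)
  fix W s
  assume s: "wft C s (1 + 0) W" and z: "eqv (1 + 0 + 1) W A (ymap conn s) Zero"
  have W: "W \<in> obj" using ywf_Ob[OF s] by blast
  obtain \<epsilon> where e: "\<epsilon> \<in> ext W C" "eqv 1 W C s (Base \<epsilon>)" using ex_Base[of C s W] s by auto
  have "eqv (Suc 1) W A (conn \<epsilon>) Zero"
    using yeq.trans[OF yeq.sym[OF ymap_Base[OF e(2) lm_conn]]] z by simp
  then obtain N a \<epsilon>' where N: "N \<in> obj" "a \<in> arr N C" "\<epsilon>' \<in> ext W N" "psh a \<epsilon>' = \<epsilon>"
    "eqv 1 N A (res a (Base \<delta>)) Zero"
    using Tens_eq_Zero[of 1 W A "Base \<delta>" C \<epsilon>] by auto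
  have "pll a \<delta> = zext N A"
    using yeq_Base_Zero_iff[OF pull_closed[OF high_tri(6) N(2) high_tri(3) N(1) high_tri(1)] N(1) high_tri(1)] N(5) by simp
  then obtain u where u: "u \<in> arr N B" "a = y \<cdot> u"
    using exact_Hom_C_co[OF T N(1,2)] by blast
  have "psh y (psh u \<epsilon>') = \<epsilon>"
    using push_comp[OF N(3) u(1) high_tri(5) W N(1) high_tri(2,3)] u N by simp
  then show "\<exists>u. wft B u 1 W \<and> eqv (1 + 0) W C s (ymap push_y u)"
    using e W high_tri push_closed[OF N(3) u(1) W N(1) high_tri(2)]
    by (intro exI[of _ "Base (psh u \<epsilon>')"]) auto
qed

text \<open>The criterion yields \<open>b\<close> with \<open>psh x (pll b \<alpha>)\<close> zero.
  Hence \<open>pll b \<alpha>\<close> is a pullback of \<open>\<delta>\<close> along some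
  \<open>c\<close>, and the coend relation moves \<open>c\<close> to the right factor.\<close>

lemma exact_higher_A_co_1: "exact_at 1 1 0 C A B conn push_x"
  unfolding exact_at_def
proof (intro allI impI)
  fix W s
  assume s: "wft A s (1 + 1) W" and z: "eqv (1 + 1 + 0) W B (ymap push_x s) Zero"
  have W: "W \<in> obj" using ywf_Ob[OF s] by blast
  obtain M \<xi> \<epsilon> where M: "M \<in> obj" "wft A \<xi> 1 M" "\<epsilon> \<in> ext W M"
    "eqv (Suc 1) W A s (Tens \<xi> M \<epsilon>)"
    using ex_Tens[of 1 A s W] s by auto
  obtain \<alpha> where a: "\<alpha> \<in> ext M A" "eqv 1 M A \<xi> (Base \<alpha>)" using ex_Base[OF M(2)] by blast
  have s': "eqv (Suc 1) W A s (Tens (Base \<alpha>) M \<epsilon>)"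
    by (rule yeq.trans[OF M(4) yeq.tens[OF W M(1,3) a(2)]])
  have "eqv (Suc 1) W B (Tens (Base (psh x \<alpha>)) M \<epsilon>) Zero"
    using yeq.trans[OF yeq.sym[OF ymap_cong[OF lm_x s' refl]]] z by simp
  then obtain N b \<epsilon>' where N: "N \<in> obj" "b \<in> arr N M" "\<epsilon>' \<in> ext W N" "psh b \<epsilon>' = \<epsilon>"
    "eqv 1 N B (res b (Base (psh x \<alpha>))) Zero"
    using Tens_eq_Zero[of 1 W B "Base (psh x \<alpha>)" M \<epsilon>] by auto
  note ba = pull_closed[OF a(1) N(2) M(1) N(1) high_tri(1)]
  have p: "psh x (pll b \<alpha>) = pll b (psh x \<alpha>)"
    by (rule push_pull[OF a(1) high_tri(4) N(2) M(1) N(1) high_tri(1,2)])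
  then have "psh x (pll b \<alpha>) = zext N B"
    using yeq_Base_Zero_iff[OF push_closed[OF ba high_tri(4) N(1) high_tri(1,2)] N(1) high_tri(2)] N(5) by simp
  then obtain c where c: "c \<in> arr N C" "pll b \<alpha> = pll c \<delta>"
    using exact_Ext_A_co[OF T N(1) ba] by blast
  note ce = push_closed[OF N(3) c(1) W N(1) high_tri(3)]
  have w: "wft A (Base \<delta>) 1 C" "wft A (Base \<alpha>) 1 M" using high_tri a M by auto
  note s'
  also have "eqv (Suc 1) W A (Tens (Base \<alpha>) M \<epsilon>) (Tens (res c (Base \<delta>)) N \<epsilon>')"
    using yeq_Tens_refine[OF N(1) M(1) N(2,3) W w(2)] N(4) c(2) by simp
  also have "eqv (Suc 1) W A \<dots> (conn (psh c \<epsilon>'))"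
    by (rule yeq.coend[OF W N(1) high_tri(3) c(1) N(3) ywf_imp_yeq[OF w(1)]])
  finally show "\<exists>u. wft C u 1 W \<and> eqv (1 + 1) W A s (ymap conn u)"
    using ce W high_tri by (intro exI[of _ "Base (psh c \<epsilon>')"]) auto
qed

lemma exact_higher_B_co:
  "\<lbrakk>1 \<le> n; wft B s n W; eqv n W C (ymap push_y s) Zero\<rbrakk>
    \<Longrightarrow> \<exists>u. wft A u n W \<and> eqv n W B s (ymap push_x u)"
  using exact_at_induct[OF lm_x lm_y exact_higher_B_co_1] unfolding exact_at_def by simp

lemma exact_higher_C_co:
  "\<lbrakk>1 \<le> n; wft C s n W; eqv (Suc n) W A (ymap conn s) Zero\<rbrakk>
    \<Longrightarrow> \<exists>u. wft B u n W \<and> eqv n W C s (ymap push_y u)"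
  using exact_at_induct[OF lm_y lm_conn exact_higher_C_co_1] unfolding exact_at_def by simp

lemma exact_higher_A_co:
  "\<lbrakk>1 \<le> n; wft A s (Suc n) W; eqv (Suc n) W B (ymap push_x s) Zero\<rbrakk>
    \<Longrightarrow> \<exists>u. wft C u n W \<and> eqv (Suc n) W A s (ymap conn u)"
  using exact_at_induct[OF lm_conn lm_x exact_higher_A_co_1] unfolding exact_at_def by simp

lemma push_push_zero:
  assumes "wft A s n W"
  shows "eqv n W C (ymap push_y (ymap push_x s)) Zero"
proof -
  have "eqv 1 V C (Base (psh y (psh x \<epsilon>))) Zero"
    if "V \<in> obj" "\<epsilon> \<in> ext V A" for V \<epsilon>
    using yeq_Base_zero[OF that(1) high_tri(3)] push_comp[OF that(2) high_tri(4,5) that(1) high_tri(1-3)]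
      etriangle_comp_zero[OF T] push_mor_zero[OF that(2,1) high_tri(1,3)] by simp
  then show ?thesis using ymap_ymap_Zero[OF lm_x lm_y _ assms] by simp
qed

lemma conn_push_zero:
  assumes "wft B s n W"
  shows "eqv (Suc n) W A (ymap conn (ymap push_y s)) Zero"
proof -
  have w: "wft A (Base \<delta>) 1 C" using high_tri by simp
  have "eqv (Suc 1) V A (Tens (Base \<delta>) C (psh y \<epsilon>)) Zero"
    if V: "V \<in> obj" and e: "\<epsilon> \<in> ext V B" for V \<epsilon>
  proof -
    have "eqv (Suc 1) V A (Tens (Base \<delta>) C (psh y \<epsilon>)) (Tens (res y (Base \<delta>)) B \<epsilon>)"
      by (rule yeq_Tens_refine[OF high_tri(2,3,5) e V w])
    also have "eqv (Suc 1) V A \<dots> (Tens Zero B \<epsilon>)"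
      using yeq.tens[OF V high_tri(2) e yeq_Base_zero[OF high_tri(2,1)]] pull_deflation[OF T] by simp
    also have "eqv (Suc 1) V A \<dots> Zero"
      by (rule yeq_Tens_zero_left[OF V high_tri(2,1) e]) simp
    finally show ?thesis .
  qed
  then show ?thesis using ymap_ymap_Zero[OF lm_y lm_conn _ assms] by simp
qed

lemma push_conn_zero:
  assumes "wft C s n W"
  shows "eqv (Suc n) W B (ymap push_x (ymap conn s)) Zero"
proof -
  have "eqv (Suc 1) V B (Tens (Base (psh x \<delta>)) C \<epsilon>) Zero"
    if V: "V \<in> obj" and e: "\<epsilon> \<in> ext V C" for V \<epsilon>
  proof -
    have "eqv (Suc 1) V B (Tens (Base (psh x \<delta>)) C \<epsilon>) (Tens Zero C \<epsilon>)"
      using yeq.tens[OF V high_tri(3) e yeq_Base_zero[OF high_tri(3,2)]] push_inflation[OF T] by simp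
    also have "eqv (Suc 1) V B \<dots> Zero"
      by (rule yeq_Tens_zero_left[OF V high_tri(3,2) e]) simp
    finally show ?thesis .
  qed
  then show ?thesis using ymap_ymap_Zero[OF lm_conn lm_x _ assms] by simp
qed

end

end

section \<open>Cardinalities\<close>

lemma card_const_fibres:
  assumes "finite S" "\<And>a. a \<in> S \<Longrightarrow> card {b \<in> S. f b = f a} = n"
  shows "card S = n * card (f ` S)"
proof -
  have "card S = (\<Sum>w \<in> f ` S. card {b \<in> S. f b = w})"
    using sum.image_gen[OF assms(1), of "\<lambda>_. 1 :: nat" f] by simp
  also have "\<dots> = (\<Sum>w \<in> f ` S. n)"
    using assms(2) by (intro sum.cong) auto
  finally show ?thesis by simp
qed

text \<open>The fibre of \<open>f\<close> through \<open>v\<close> is the translate of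
  \<open>N\<close> by \<open>v\<close>.\<close>

lemma (in abelian_group) card_translation_fibres:
  assumes "finite S" and S: "S \<subseteq> carrier G" "\<And>u v. \<lbrakk>u \<in> S; v \<in> S\<rbrakk> \<Longrightarrow> u \<oplus> v \<in> S"
    and N: "N \<subseteq> S"
    and iff: "\<And>u v. \<lbrakk>u \<in> S; v \<in> S\<rbrakk> \<Longrightarrow> f u = f v \<longleftrightarrow> u \<ominus> v \<in> N"
  shows "card S = card N * card (f ` S)"
proof -
  have fib: "card {u \<in> S. f u = f v} = card N" if v: "v \<in> S" for v
  proof -
    have "bij_betw (\<lambda>n. n \<oplus> v) N {u \<in> S. f u = f v}"
    proof (rule bij_betw_byWitness[where f' = "\<lambda>u. u \<ominus> v"])
      show "\<forall>n\<in>N. (n \<oplus> v) \<ominus> v = n"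
        using N S v by (auto simp: a_minus_def a_assoc r_neg subset_iff)
      show "\<forall>u\<in>{u \<in> S. f u = f v}. (u \<ominus> v) \<oplus> v = u"
        using S v by (auto simp: a_minus_def a_assoc l_neg subset_iff)
      show "(\<lambda>n. n \<oplus> v) ` N \<subseteq> {u \<in> S. f u = f v}"
      proof clarsimp
        fix n assume n: "n \<in> N"
        then have "(n \<oplus> v) \<ominus> v = n"
          using N S v by (auto simp: a_minus_def a_assoc r_neg subset_iff)
        then show "n \<oplus> v \<in> S \<and> f (n \<oplus> v) = f v"
          using iff[of "n \<oplus> v" v] S(2)[of n v] n v N by auto
      qed
      show "(\<lambda>u. u \<ominus> v) ` {u \<in> S. f u = f v} \<subseteq> N"
        using iff v by auto
    qed
    then show ?thesis using bij_betw_same_card by metis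
  qed
  show ?thesis by (rule card_const_fibres[OF assms(1) fib])
qed

text \<open>The order formula for a homomorphism restricted to the kernel of another. Later
  \<open>h\<close> is composition with a map of a triangle and \<open>f\<close> the action on its
  extension.\<close>

lemma card_kernel_restricted_image:
  assumes V: "abelian_group V" and W: "abelian_group W" and E: "abelian_group E" and fin: "finite (carrier V)"
    and h: "\<And>u. u \<in> carrier V \<Longrightarrow> h u \<in> carrier W" and f: "\<And>u. u \<in> carrier V \<Longrightarrow> f u \<in> carrier E"
    and h_add: "\<And>u v. \<lbrakk>u \<in> carrier V; v \<in> carrier V\<rbrakk> \<Longrightarrow> h (u \<oplus>\<^bsub>V\<^esub> v) = h u \<oplus>\<^bsub>W\<^esub> h v"
    and f_add: "\<And>u v. \<lbrakk>u \<in> carrier V; v \<in> carrier V\<rbrakk> \<Longrightarrow> f (u \<oplus>\<^bsub>V\<^esub> v) = f u \<oplus>\<^bsub>E\<^esub> f v"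
  shows "card {u \<in> carrier V. h u = \<zero>\<^bsub>W\<^esub>} = card {u \<in> carrier V. h u = \<zero>\<^bsub>W\<^esub> \<and> f u = \<zero>\<^bsub>E\<^esub>} *
    card (f ` {u \<in> carrier V. h u = \<zero>\<^bsub>W\<^esub>})"
proof -
  interpret V: abelian_group V by fact
  interpret W: abelian_group W by fact
  interpret E: abelian_group E by fact
  have sub: "(u \<ominus>\<^bsub>V\<^esub> v) \<oplus>\<^bsub>V\<^esub> v = u" if "u \<in> carrier V" "v \<in> carrier V" for u v
    using that by (simp add: a_minus_def V.a_assoc V.l_neg)
  have "h (u \<ominus>\<^bsub>V\<^esub> v) = \<zero>\<^bsub>W\<^esub>"
    if "u \<in> carrier V" "v \<in> carrier V" "h u = \<zero>\<^bsub>W\<^esub>" "h v = \<zero>\<^bsub>W\<^esub>" for u v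
    using h_add[of "u \<ominus>\<^bsub>V\<^esub> v" v] sub[of u v] h[of "u \<ominus>\<^bsub>V\<^esub> v"] that by simp
  moreover have "f u = f v \<longleftrightarrow> f (u \<ominus>\<^bsub>V\<^esub> v) = \<zero>\<^bsub>E\<^esub>" if "u \<in> carrier V" "v \<in> carrier V" for u v
    using f_add[of "u \<ominus>\<^bsub>V\<^esub> v" v] sub[OF that] f[of v] f[of "u \<ominus>\<^bsub>V\<^esub> v"] that
    by (metis V.minus_closed E.add.r_cancel_one E.l_zero E.zero_closed)
  ultimately show ?thesis
    using fin h_add by (intro V.card_translation_fibres) auto
qed

lemma card_kernel_image:
  assumes "abelian_group V" "abelian_group W" "finite (carrier V)"
    and "\<And>u. u \<in> carrier V \<Longrightarrow> f u \<in> carrier W"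
    and "\<And>u v. \<lbrakk>u \<in> carrier V; v \<in> carrier V\<rbrakk> \<Longrightarrow> f (u \<oplus>\<^bsub>V\<^esub> v) = f u \<oplus>\<^bsub>W\<^esub> f v"
  shows "card (carrier V) = card {u \<in> carrier V. f u = \<zero>\<^bsub>W\<^esub>} * card (f ` carrier V)"
proof -
  interpret W: abelian_group W by fact
  show ?thesis
    using card_kernel_restricted_image[of V W W "\<lambda>_. \<zero>\<^bsub>W\<^esub>" f] assms by simp
qed

lemma (in vectorspace) finite_carrier:
  assumes "finite (carrier K)" "fin_dim"
  shows "finite (carrier V)"
proof -
  obtain S where S: "finite S" "S \<subseteq> carrier V" "span S = carrier V"
    using assms(2) by (auto simp: fin_dim_def)
  have "carrier V \<subseteq> (\<lambda>a. lincomb a S) ` (S \<rightarrow>\<^sub>E carrier K)"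
  proof
    fix v assume "v \<in> carrier V"
    then obtain a where a: "a \<in> S \<rightarrow> carrier K" "v = lincomb a S"
      using finite_span[OF S(1,2)] S(3) by auto
    \<comment> \<open>Coefficients matter only on \<open>S\<close>, and there are finitely many
      functions restricted to \<open>S\<close>.\<close>
    have "lincomb (restrict a S) S = lincomb a S"
      using a(1) S(2) by (intro lincomb_cong) auto
    then show "v \<in> (\<lambda>a. lincomb a S) ` (S \<rightarrow>\<^sub>E carrier K)"
      using a by (intro image_eqI[of _ _ "restrict a S"]) (auto simp: PiE_def)
  qed
  then show ?thesis
    using finite_PiE[of S "\<lambda>_. carrier K"] S(1) assms(1) by (auto intro: finite_subset)
qed

lemma (in vectorspace) carrier_dim_zero:
  assumes "fin_dim" "dim = 0"
  shows "carrier V = {\<zero>\<^bsub>V\<^esub>}"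
proof -
  obtain S where S: "finite S" "S \<subseteq> carrier V" "basis S"
    using finite_basis_exists[OF assms(1)] by (auto simp: basis_def)
  then have "S = {}" using dim_basis[of S] assms(2) by auto
  then show ?thesis using S(3) by (auto simp: basis_def span_empty)
qed

section \<open>Higher extension spaces as quotients of expressions\<close>

definition ycls ::
  "('k, 'r) ring_scheme \<Rightarrow> ('o, 'k, 'm, 'e, 'z) extri_cat_scheme \<Rightarrow> nat \<Rightarrow> 'o \<Rightarrow> 'o \<Rightarrow>
   ('o, 'k, 'e) yterm \<Rightarrow> ('o, 'k, 'e) yterm set"
  where "ycls K \<C> n C A t = {u. yeq K \<C> n C A t u}"

lemma higher_ext_zero: "\<zero>\<^bsub>higher_ext K \<C> n C A\<^esub> = ycls K \<C> n C A Zero"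
  by (simp add: higher_ext_def ycls_def)

context linear_extriangulated_category
begin

abbreviation "hext n C A \<equiv> higher_ext K \<C> n C A"
abbreviation "cls n C A t \<equiv> ycls K \<C> n C A t"
abbreviation "ecard n C A \<equiv> ext_card K \<C> n C A"

lemma ycls_eq_iff: "wft A t n C \<Longrightarrow> cls n C A s = cls n C A t \<longleftrightarrow> eqv n C A s t"
  unfolding ycls_def using ywf_imp_yeq[of K \<C> A t n C]
  by (auto simp: set_eq_iff intro: yeq.trans yeq.sym)

lemma ycls_cong: "eqv n C A s t \<Longrightarrow> cls n C A s = cls n C A t"
  using ycls_eq_iff yeq_imp_ywf by metis

lemma higher_ext_carrier: "carrier (hext n C A) = cls n C A ` {t. wft A t n C}"
  by (auto simp: higher_ext_def quotient_def ycls_def yeq_refl_iff)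

lemma ycls_closed: "wft A t n C \<Longrightarrow> cls n C A t \<in> carrier (hext n C A)"
  by (auto simp: higher_ext_carrier)

lemma higher_ext_add:
  assumes "wft A s n C" "wft A t n C"
  shows "cls n C A s \<oplus>\<^bsub>hext n C A\<^esub> cls n C A t = cls n C A (Add s t)"
proof -
  have "eqv n C A s s" "eqv n C A t t" using assms by (auto intro: ywf_imp_yeq)
  then show ?thesis
    unfolding higher_ext_def ycls_def by (auto intro: yeq.trans[OF yeq.add])
qed

lemma higher_ext_smult:
  assumes "r \<in> carrier K" "wft A s n C"
  shows "r \<odot>\<^bsub>hext n C A\<^esub> cls n C A s = cls n C A (Scale r s)"
proof -
  have "eqv n C A s s" using assms by (auto intro: ywf_imp_yeq)
  then show ?thesis
    unfolding higher_ext_def ycls_def using assms(1) by (auto intro: yeq.trans[OF yeq.scale])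
qed

lemma higher_ext_vectorspace:
  assumes n: "1 \<le> n" and ob: "C \<in> obj" "A \<in> obj"
  shows "vectorspace K (hext n C A)"
proof -
  let ?H = "hext n C A" and ?c = "cls n C A"
  have z: "wft A Zero n C" using n ob by simp
  note rep = higher_ext_carrier[of n C A] and y = ywf_imp_yeq[of K \<C> A _ n C]
  have inv: "\<exists>v \<in> carrier ?H. v \<oplus>\<^bsub>?H\<^esub> u = \<zero>\<^bsub>?H\<^esub>" if u: "u \<in> carrier ?H" for u
  proof -
    obtain s where s: "u = ?c s" "wft A s n C" using u rep by auto
    \<comment> \<open>The rules of \<open>yeq\<close> provide no negatives; -1 times
      \<open>s\<close> is the additive inverse.\<close>
    have m: "\<ominus>\<^bsub>K\<^esub> \<one>\<^bsub>K\<^esub> \<in> carrier K" by simp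
    have w: "wft A (Scale (\<ominus>\<^bsub>K\<^esub> \<one>\<^bsub>K\<^esub>) s) n C" using s m by simp
    have "eqv n C A (Add (Scale (\<ominus>\<^bsub>K\<^esub> \<one>\<^bsub>K\<^esub>) s) s) (Add (Scale (\<ominus>\<^bsub>K\<^esub> \<one>\<^bsub>K\<^esub>) s) (Scale \<one>\<^bsub>K\<^esub> s))"
      by (rule yeq.add[OF y[OF w] yeq.sym[OF yeq.scale_one[OF y[OF s(2)]]]])
    also have "eqv n C A \<dots> (Scale (\<ominus>\<^bsub>K\<^esub> \<one>\<^bsub>K\<^esub> \<oplus>\<^bsub>K\<^esub> \<one>\<^bsub>K\<^esub>) s)"
      by (rule yeq.sym[OF yeq.scale_add_left[OF m one_closed y[OF s(2)]]])
    also have "eqv n C A (Scale (\<ominus>\<^bsub>K\<^esub> \<one>\<^bsub>K\<^esub> \<oplus>\<^bsub>K\<^esub> \<one>\<^bsub>K\<^esub>) s) Zero"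
      using yeq.scale_zero[OF y[OF s(2)]] by (simp add: l_neg)
    finally show ?thesis
      using ycls_closed[OF w] higher_ext_add[OF w s(2)] ycls_cong s(1)
      by (metis higher_ext_zero)
  qed
  have ag: "abelian_group ?H"
  proof (rule abelian_groupI)
    show "\<zero>\<^bsub>?H\<^esub> \<in> carrier ?H" using ycls_closed[OF z] by (simp add: higher_ext_zero)
    show "\<And>x y. \<lbrakk>x \<in> carrier ?H; y \<in> carrier ?H\<rbrakk> \<Longrightarrow> x \<oplus>\<^bsub>?H\<^esub> y \<in> carrier ?H"
      using ycls_closed by (auto simp: rep higher_ext_add)
    show "\<And>x y z. \<lbrakk>x \<in> carrier ?H; y \<in> carrier ?H; z \<in> carrier ?H\<rbrakk>
        \<Longrightarrow> (x \<oplus>\<^bsub>?H\<^esub> y) \<oplus>\<^bsub>?H\<^esub> z = x \<oplus>\<^bsub>?H\<^esub> (y \<oplus>\<^bsub>?H\<^esub> z)"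
      using ycls_cong[OF yeq.add_assoc[OF y y y]] by (auto simp: rep higher_ext_add)
    show "\<And>x y. \<lbrakk>x \<in> carrier ?H; y \<in> carrier ?H\<rbrakk> \<Longrightarrow> x \<oplus>\<^bsub>?H\<^esub> y = y \<oplus>\<^bsub>?H\<^esub> x"
      using ycls_cong[OF yeq.add_comm[OF y y]] by (auto simp: rep higher_ext_add)
    show "\<And>x. x \<in> carrier ?H \<Longrightarrow> \<zero>\<^bsub>?H\<^esub> \<oplus>\<^bsub>?H\<^esub> x = x"
      using ycls_cong[OF yeq.add_zero[OF y]] z by (auto simp: rep higher_ext_zero higher_ext_add)
  qed (rule inv)
  have "Module.module K ?H"
  proof (rule moduleI[OF is_cring ag])
    show "\<And>a x. \<lbrakk>a \<in> carrier K; x \<in> carrier ?H\<rbrakk> \<Longrightarrow> a \<odot>\<^bsub>?H\<^esub> x \<in> carrier ?H"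
      using ycls_closed by (auto simp: rep higher_ext_smult)
    show "\<And>a b x. \<lbrakk>a \<in> carrier K; b \<in> carrier K; x \<in> carrier ?H\<rbrakk>
        \<Longrightarrow> (a \<oplus>\<^bsub>K\<^esub> b) \<odot>\<^bsub>?H\<^esub> x = a \<odot>\<^bsub>?H\<^esub> x \<oplus>\<^bsub>?H\<^esub> b \<odot>\<^bsub>?H\<^esub> x"
      using ycls_cong[OF yeq.scale_add_left[OF _ _ y]] by (auto simp: rep higher_ext_add higher_ext_smult)
    show "\<And>a x y. \<lbrakk>a \<in> carrier K; x \<in> carrier ?H; y \<in> carrier ?H\<rbrakk>
        \<Longrightarrow> a \<odot>\<^bsub>?H\<^esub> (x \<oplus>\<^bsub>?H\<^esub> y) = a \<odot>\<^bsub>?H\<^esub> x \<oplus>\<^bsub>?H\<^esub> a \<odot>\<^bsub>?H\<^esub> y"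
      using ycls_cong[OF yeq.scale_add_right[OF _ y y]] by (auto simp: rep higher_ext_add higher_ext_smult)
    show "\<And>a b x. \<lbrakk>a \<in> carrier K; b \<in> carrier K; x \<in> carrier ?H\<rbrakk>
        \<Longrightarrow> (a \<otimes>\<^bsub>K\<^esub> b) \<odot>\<^bsub>?H\<^esub> x = a \<odot>\<^bsub>?H\<^esub> (b \<odot>\<^bsub>?H\<^esub> x)"
      using ycls_cong[OF yeq.scale_scale[OF _ _ y]] by (auto simp: rep higher_ext_smult)
    show "\<And>x. x \<in> carrier ?H \<Longrightarrow> \<one>\<^bsub>K\<^esub> \<odot>\<^bsub>?H\<^esub> x = x"
      using ycls_cong[OF yeq.scale_one[OF y]] by (auto simp: rep higher_ext_smult)
  qed
  then show ?thesis by (simp add: vectorspace_def field_axioms)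
qed

lemma higher_ext_abelian_group:
  "\<lbrakk>1 \<le> n; C \<in> obj; A \<in> obj\<rbrakk> \<Longrightarrow> abelian_group (hext n C A)"
  using higher_ext_vectorspace by (simp add: vectorspace_def module_def)

text \<open>\<open>ext_card\<close> counts degree 1 in \<open>Ext1\<close> itself. Through this
  bijection all positive degrees can be treated uniformly as quotients of expressions.\<close>

lemma bij_betw_Base:
  assumes "C \<in> obj" "A \<in> obj"
  shows "bij_betw (\<lambda>\<delta>. cls 1 C A (Base \<delta>)) (ext C A) (carrier (hext 1 C A))"
proof (rule bij_betw_imageI)
  show "inj_on (\<lambda>\<delta>. cls 1 C A (Base \<delta>)) (ext C A)"
    using yeq_Base_iff[OF _ assms] ycls_eq_iff[of A _ 1 C] assms by (auto simp: inj_on_def)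
  show "(\<lambda>\<delta>. cls 1 C A (Base \<delta>)) ` ext C A = carrier (hext 1 C A)"
  proof
    show "carrier (hext 1 C A) \<subseteq> (\<lambda>\<delta>. cls 1 C A (Base \<delta>)) ` ext C A"
      unfolding higher_ext_carrier using ex_Base ycls_cong by blast
  qed (use assms ycls_closed in auto)
qed

lemma ext_card_eq:
  assumes "C \<in> obj" "A \<in> obj" "1 \<le> n"
  shows "ecard n C A = card (carrier (hext n C A))"
proof (cases "n = 1")
  case True
  then show ?thesis using bij_betw_same_card[OF bij_betw_Base[OF assms(1,2)]] by simp
next
  case False
  then obtain m where "n = Suc (Suc m)" using that[of "n - 2"] assms(3) by simp
  then show ?thesis by simp
qed

text \<open>The order of the kernel of the map that \<open>\<phi>\<close> induces on
  classes.\<close>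

definition zcard ::
  "nat \<Rightarrow> 'o \<Rightarrow> 'o \<Rightarrow> nat \<Rightarrow> 'o \<Rightarrow> 'o \<Rightarrow> (('o, 'k, 'e) yterm \<Rightarrow> ('o, 'k, 'e) yterm) \<Rightarrow> nat"
  where "zcard n C A n' C' A' \<phi> =
    card (cls n C A ` {t. wft A t n C \<and> eqv n' C' A' (\<phi> t) Zero})"

definition yhom :: "nat \<Rightarrow> 'o \<Rightarrow> 'o \<Rightarrow> nat \<Rightarrow> 'o \<Rightarrow> 'o \<Rightarrow> (('o, 'k, 'e) yterm \<Rightarrow> ('o, 'k, 'e) yterm) \<Rightarrow> bool"
  where "yhom n C A n' C' A' \<phi> \<longleftrightarrow>
    (\<forall>s t. eqv n C A s t \<longrightarrow> eqv n' C' A' (\<phi> s) (\<phi> t)) \<and>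
    (\<forall>s t. wft A s n C \<longrightarrow> wft A t n C \<longrightarrow> eqv n' C' A' (\<phi> (Add s t)) (Add (\<phi> s) (\<phi> t)))"

lemma yhom_ypull: "\<lbrakk>c \<in> arr C' C; C' \<in> obj\<rbrakk> \<Longrightarrow> yhom n C A n C' A (res c)"
  by (auto simp: yhom_def intro: ypull_cong yeq.add ywf_imp_yeq ywf_ypull)

lemma yhom_ymap: "left_mult k A A' f \<Longrightarrow> yhom n W A (n + k) W A' (ymap f)"
  by (auto simp: yhom_def intro: ymap_cong yeq.add ywf_imp_yeq ymap_wf)

lemma yhom_Tens:
  "\<lbrakk>C \<in> obj; A \<in> obj; \<delta> \<in> ext C A\<rbrakk> \<Longrightarrow> yhom n A W (Suc n) C W (\<lambda>\<xi>. Tens \<xi> A \<delta>)"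
  by (auto simp: yhom_def intro: yeq.tens yeq.tens_add_left ywf_imp_yeq)

text \<open>The order of the source is the order of the kernel times that of the image, and
  exactness identifies the image of \<open>\<phi>\<close> with the kernel of
  \<open>\<psi>\<close>.\<close>

lemma card_higher_ext_exact:
  assumes n: "1 \<le> n" "1 \<le> n'" and ob: "C \<in> obj" "A \<in> obj" "C' \<in> obj" "A' \<in> obj"
    and fin: "finite (carrier (hext n C A))"
    and \<phi>: "yhom n C A n' C' A' \<phi>"
    and comp: "\<And>s. wft A s n C \<Longrightarrow> eqv n'' C'' A'' (\<psi> (\<phi> s)) Zero"
    and exact: "\<And>t. \<lbrakk>wft A' t n' C'; eqv n'' C'' A'' (\<psi> t) Zero\<rbrakk>
      \<Longrightarrow> \<exists>s. wft A s n C \<and> eqv n' C' A' t (\<phi> s)"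
  shows "card (carrier (hext n C A)) = zcard n C A n' C' A' \<phi> * zcard n' C' A' n'' C'' A'' \<psi>"
proof -
  let ?H = "hext n C A" and ?H' = "hext n' C' A'"
  let ?c = "cls n C A" and ?c' = "cls n' C' A'"
  have cong: "\<And>s t. eqv n C A s t \<Longrightarrow> eqv n' C' A' (\<phi> s) (\<phi> t)"
    and add: "\<And>s t. \<lbrakk>wft A s n C; wft A t n C\<rbrakk>
      \<Longrightarrow> eqv n' C' A' (\<phi> (Add s t)) (Add (\<phi> s) (\<phi> t))"
    using \<phi> by (auto simp: yhom_def)
  \<comment> \<open>\<open>\<phi>\<close> acts on expressions; on a class it is evaluated at an
    arbitrary element, which \<open>cong\<close> makes harmless.\<close>
  define f where "f S = ?c' (\<phi> (SOME s. s \<in> S))" for S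
  have f: "f (?c s) = ?c' (\<phi> s)" if s: "wft A s n C" for s
  proof -
    have "s \<in> ?c s" using s by (auto simp: ycls_def intro: ywf_imp_yeq)
    then have "(SOME t. t \<in> ?c s) \<in> ?c s" by (rule someI)
    then have "eqv n C A s (SOME t. t \<in> ?c s)" by (simp add: ycls_def)
    then show ?thesis using cong ycls_cong unfolding f_def by metis
  qed
  have wf: "wft A' (\<phi> s) n' C'" if s: "wft A s n C" for s
    using cong[OF ywf_imp_yeq[OF s]] yeq_imp_ywf by blast
  have z: "wft A' Zero n' C'" using n ob by simp
  have "{u \<in> carrier ?H. f u = \<zero>\<^bsub>?H'\<^esub>} = ?c ` {t. wft A t n C \<and> eqv n' C' A' (\<phi> t) Zero}"
    using f ycls_eq_iff[OF z] by (auto simp: higher_ext_carrier higher_ext_zero)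
  moreover have "f ` carrier ?H = ?c' ` {t. wft A' t n' C' \<and> eqv n'' C'' A'' (\<psi> t) Zero}"
  proof
    show "f ` carrier ?H \<subseteq> ?c' ` {t. wft A' t n' C' \<and> eqv n'' C'' A'' (\<psi> t) Zero}"
      using f wf comp by (auto simp: higher_ext_carrier)
    show "?c' ` {t. wft A' t n' C' \<and> eqv n'' C'' A'' (\<psi> t) Zero} \<subseteq> f ` carrier ?H"
    proof clarify
      fix t assume "wft A' t n' C'" "eqv n'' C'' A'' (\<psi> t) Zero"
      then obtain s where "wft A s n C" "eqv n' C' A' t (\<phi> s)" using exact by blast
      then show "?c' t \<in> f ` carrier ?H"
        using f ycls_cong ycls_closed by (intro image_eqI[of _ _ "?c s"]) auto
    qed
  qed
  moreover have "card (carrier ?H) = card {u \<in> carrier ?H. f u = \<zero>\<^bsub>?H'\<^esub>} * card (f ` carrier ?H)"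
  proof (rule card_kernel_image[OF higher_ext_abelian_group higher_ext_abelian_group fin])
    show "\<And>u. u \<in> carrier ?H \<Longrightarrow> f u \<in> carrier ?H'"
      using f wf ycls_closed by (auto simp: higher_ext_carrier)
    show "\<And>u v. \<lbrakk>u \<in> carrier ?H; v \<in> carrier ?H\<rbrakk> \<Longrightarrow> f (u \<oplus>\<^bsub>?H\<^esub> v) = f u \<oplus>\<^bsub>?H'\<^esub> f v"
      using f wf ycls_cong[OF add] by (auto simp: higher_ext_carrier higher_ext_add)
  qed (use n ob in auto)
  ultimately show ?thesis by (simp add: zcard_def)
qed

text \<open>The connecting map from degree 0 to degree 1. Its source consists of morphisms, so
  \<open>card_higher_ext_exact\<close> does not cover it.\<close>

lemma card_Hom_to_higher_ext:
  assumes ob: "X \<in> obj" "Y \<in> obj" "C \<in> obj" "A \<in> obj" and fin: "finite (arr X Y)"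
    and f: "f \<in> LinearCombinations.module_hom K (Hom \<C> X Y) (Ext1 \<C> C A)"
    and comp: "\<And>c. c \<in> arr X Y \<Longrightarrow> eqv 1 C' A' (\<psi> (Base (f c))) Zero"
    and cong': "\<And>s t. eqv 1 C A s t \<Longrightarrow> eqv 1 C' A' (\<psi> s) (\<psi> t)"
    and exact: "\<And>\<epsilon>. \<lbrakk>\<epsilon> \<in> ext C A; eqv 1 C' A' (\<psi> (Base \<epsilon>)) Zero\<rbrakk>
      \<Longrightarrow> \<exists>c \<in> arr X Y. \<epsilon> = f c"
  shows "card (arr X Y) = card {c \<in> arr X Y. f c = zext C A} * zcard 1 C A 1 C' A' \<psi>"
proof -
  let ?c = "cls 1 C A"
  have fc: "f c \<in> ext C A" if "c \<in> arr X Y" for c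
    using module_hom_closed[OF f] that by blast
  have "?c ` {t. wft A t 1 C \<and> eqv 1 C' A' (\<psi> t) Zero} = (\<lambda>\<delta>. ?c (Base \<delta>)) ` f ` arr X Y"
    (is "?L = ?R")
  proof
    show "?R \<subseteq> ?L" using fc comp ob by auto
    show "?L \<subseteq> ?R"
    proof clarify
      fix t assume t: "wft A t 1 C" "eqv 1 C' A' (\<psi> t) Zero"
      obtain \<epsilon> where e: "\<epsilon> \<in> ext C A" "eqv 1 C A t (Base \<epsilon>)" using ex_Base[OF t(1)] by blast
      have "eqv 1 C' A' (\<psi> (Base \<epsilon>)) Zero" using cong'[OF yeq.sym[OF e(2)]] t(2) by (rule yeq.trans)
      then show "?c t \<in> ?R" using exact[OF e(1)] ycls_cong[OF e(2)] by blast
    qed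
  qed
  moreover have "card ((\<lambda>\<delta>. ?c (Base \<delta>)) ` f ` arr X Y) = card (f ` arr X Y)"
    using bij_betw_Base[OF ob(3,4)] fc
    by (intro card_image) (auto simp: bij_betw_def intro: inj_on_subset)
  moreover have "card (arr X Y) = card {c \<in> arr X Y. f c = zext C A} * card (f ` arr X Y)"
    by (rule card_kernel_image[OF Hom_abelian_group[OF ob(1,2)] Ext1_abelian_group[OF ob(3,4)] fin fc
          module_hom_add[OF f]])
  ultimately show ?thesis by (simp add: zcard_def)
qed

lemma card_Hom_exact:
  assumes ob: "X \<in> obj" "Y \<in> obj" "X' \<in> obj" "Y' \<in> obj" and fin: "finite (arr X Y)"
    and f: "f \<in> LinearCombinations.module_hom K (Hom \<C> X Y) (Hom \<C> X' Y')"
    and im: "f ` arr X Y = S"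
  shows "card (arr X Y) = card {c \<in> arr X Y. f c = zhom X' Y'} * card S"
proof -
  have "f c \<in> arr X' Y'" if "c \<in> arr X Y" for c
    using module_hom_closed[OF f] that by blast
  then show ?thesis
    using card_kernel_image[OF Hom_abelian_group[OF ob(1,2)] Hom_abelian_group[OF ob(3,4)] fin _
          module_hom_add[OF f]] im by auto
qed

text \<open>The numbers \<open>a n\<close>, \<open>b n\<close>, \<open>c n\<close> are the orders of
  the kernels of the maps leaving the terms of degree \<open>n\<close> at \<open>A\<close>,
  \<open>B\<close>, \<open>C\<close>. By exactness the image of each map is the next kernel, so the
  order of each term is the product of two consecutive numbers.\<close>

lemma les_card_co:
  assumes T: "etri A x B y C \<delta>" and W: "W \<in> obj"
    and fin0: "\<And>V. V \<in> obj \<Longrightarrow> finite (arr W V)"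
    and fin: "\<And>V n. \<lbrakk>V \<in> obj; 1 \<le> n\<rbrakk> \<Longrightarrow> finite (carrier (hext n W V))"
  obtains a b c :: "nat \<Rightarrow> nat" where
    "a 0 = card {u \<in> arr W A. x \<cdot> u = zhom W B}"
    "\<And>n. ecard n W A = a n * b n" "\<And>n. ecard n W B = b n * c n"
    "\<And>n. ecard n W C = c n * a (Suc n)"
proof -
  note t = etriangleD[OF T]
  let ?x = "\<lambda>\<epsilon>. Base (psh x \<epsilon>)" and ?y = "\<lambda>\<epsilon>. Base (psh y \<epsilon>)"
    and ?d = "\<lambda>\<epsilon>. Tens (Base \<delta>) C \<epsilon>"
  note lm_x = left_mult_push[OF t(4,1,2)] and lm_y = left_mult_push[OF t(5,2,3)]
    and lm_d = left_mult_conn[OF t(6,3,1)]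
  note cx = ymap_cong[OF lm_x _ refl, simplified]
  define a where "a = case_nat (card {u \<in> arr W A. x \<cdot> u = zhom W B})
    (\<lambda>n. zcard (Suc n) W A (Suc n) W B (ymap ?x))"
  define b where "b = case_nat (card {u \<in> arr W B. y \<cdot> u = zhom W C})
    (\<lambda>n. zcard (Suc n) W B (Suc n) W C (ymap ?y))"
  define c where "c = case_nat (card {u \<in> arr W C. pll u \<delta> = zext W A})
    (\<lambda>n. zcard (Suc n) W C (Suc (Suc n)) W A (ymap ?d))"
  have A: "ecard n W A = a n * b n" for n
  proof (cases n)
    case 0
    have "(\<cdot>) x ` arr W A = {u \<in> arr W B. y \<cdot> u = zhom W C}"
    proof
      show "(\<cdot>) x ` arr W A \<subseteq> {u \<in> arr W B. y \<cdot> u = zhom W C}"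
        using comp_assoc'[OF _ t(4,5) W t(1-3)] etriangle_comp_zero[OF T] comp_zero_left[OF _ W t(1,3)]
          comp_closed[OF _ t(4) W t(1,2)] by auto
      show "{u \<in> arr W B. y \<cdot> u = zhom W C} \<subseteq> (\<cdot>) x ` arr W A"
        using exact_Hom_B_co[OF T W] by blast
    qed
    then show ?thesis
      using card_Hom_exact[OF W t(1) W t(2) fin0[OF t(1)] comp_linear_right[OF W t(1,2,4)]] 0
      by (simp add: a_def b_def)
  next
    case (Suc m)
    then have n: "1 \<le> n" by simp
    show ?thesis
      using card_higher_ext_exact[where \<psi> = "ymap ?y", OF n _ W t(1) W t(2) fin[OF t(1) n] yhom_ymap[OF lm_x, of n, simplified] push_push_zero[OF T]
          exact_higher_B_co[OF T n]] n ext_card_eq[OF W t(1) n] Suc by (simp add: a_def b_def)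
  qed
  have B: "ecard n W B = b n * c n" for n
  proof (cases n)
    case 0
    have "(\<cdot>) y ` arr W B = {u \<in> arr W C. pll u \<delta> = zext W A}"
    proof
      show "(\<cdot>) y ` arr W B \<subseteq> {u \<in> arr W C. pll u \<delta> = zext W A}"
        using pull_comp[OF t(6,5) _ t(3,2) W t(1)] pull_deflation[OF T] pull_zero[OF _ t(2) W t(1)]
          comp_closed[OF _ t(5) W t(2,3)] by auto
      show "{u \<in> arr W C. pll u \<delta> = zext W A} \<subseteq> (\<cdot>) y ` arr W B"
        using exact_Hom_C_co[OF T W] by blast
    qed
    then show ?thesis
      using card_Hom_exact[OF W t(2) W t(3) fin0[OF t(2)] comp_linear_right[OF W t(2,3,5)]] 0
      by (simp add: b_def c_def)
  next
    case (Suc m)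
    then have n: "1 \<le> n" by simp
    show ?thesis
      using card_higher_ext_exact[where \<psi> = "ymap ?d", OF n _ W t(2) W t(3) fin[OF t(2) n] yhom_ymap[OF lm_y, of n, simplified] conn_push_zero[OF T]
          exact_higher_C_co[OF T n]] n ext_card_eq[OF W t(2) n] Suc by (simp add: b_def c_def)
  qed
  have C: "ecard n W C = c n * a (Suc n)" for n
  proof (cases n)
    case 0
    have z: "eqv 1 W B (ymap ?x (Base (pll u \<delta>))) Zero" if u: "u \<in> arr W C" for u
      using yeq_Base_zero[OF W t(2)] push_pull[OF t(6,4) u t(3) W t(1,2)] push_inflation[OF T]
        pull_zero[OF u t(3) W t(2)] by simp
    have e: "\<exists>u \<in> arr W C. \<epsilon> = pll u \<delta>"
      if e: "\<epsilon> \<in> ext W A" "eqv 1 W B (ymap ?x (Base \<epsilon>)) Zero" for \<epsilon>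
      using yeq_Base_Zero_iff[OF push_closed[OF e(1) t(4) W t(1,2)] W t(2)] e
        exact_Ext_A_co[OF T W e(1)] by auto
    show ?thesis
      using card_Hom_to_higher_ext[where \<psi> = "ymap ?x", OF W t(3) W t(1) fin0[OF t(3)] ET1_pull_bilinear[OF t(3) W t(1,6)] z _ e] 0
        cx[of 1 W] by (simp add: a_def c_def)
  next
    case (Suc m)
    then have n: "1 \<le> n" by simp
    show ?thesis
      using card_higher_ext_exact[where \<psi> = "ymap ?x", OF n _ W t(3) W t(1) fin[OF t(3) n] yhom_ymap[OF lm_d, of n, simplified] push_conn_zero[OF T]
          exact_higher_A_co[OF T n]] n ext_card_eq[OF W t(3) n] Suc by (simp add: a_def c_def)
  qed
  show thesis
    by (rule that[OF _ A B C]) (simp add: a_def)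
qed

text \<open>Here the sequence runs from \<open>C\<close> over \<open>B\<close> to \<open>A\<close>,
  so \<open>a\<close> belongs to \<open>C\<close> and \<open>c\<close> to \<open>A\<close>.\<close>

lemma les_card_contra:
  assumes T: "etri A x B y C \<delta>" and W: "W \<in> obj"
    and fin0: "\<And>V. V \<in> obj \<Longrightarrow> finite (arr V W)"
    and fin: "\<And>V n. \<lbrakk>V \<in> obj; 1 \<le> n\<rbrakk> \<Longrightarrow> finite (carrier (hext n V W))"
  obtains a b c :: "nat \<Rightarrow> nat" where
    "a 0 = card {u \<in> arr C W. u \<cdot> y = zhom B W}"
    "\<And>n. ecard n C W = a n * b n" "\<And>n. ecard n B W = b n * c n"
    "\<And>n. ecard n A W = c n * a (Suc n)"
proof -
  note t = etriangleD[OF T]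
  let ?d = "\<lambda>\<xi>. Tens \<xi> A \<delta>"
  note cy = ypull_cong[OF _ t(5,2)]
  define a where "a = case_nat (card {u \<in> arr C W. u \<cdot> y = zhom B W})
    (\<lambda>n. zcard (Suc n) C W (Suc n) B W (res y))"
  define b where "b = case_nat (card {u \<in> arr B W. u \<cdot> x = zhom A W})
    (\<lambda>n. zcard (Suc n) B W (Suc n) A W (res x))"
  define c where "c = case_nat (card {u \<in> arr A W. psh u \<delta> = zext C W})
    (\<lambda>n. zcard (Suc n) A W (Suc (Suc n)) C W ?d)"
  have C: "ecard n C W = a n * b n" for n
  proof (cases n)
    case 0
    have "(\<lambda>u. u \<cdot> y) ` arr C W = {u \<in> arr B W. u \<cdot> x = zhom A W}"
    proof
      show "(\<lambda>u. u \<cdot> y) ` arr C W \<subseteq> {u \<in> arr B W. u \<cdot> x = zhom A W}"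
        using comp_assoc'[OF t(4,5) _ t(1-3) W] etriangle_comp_zero[OF T] comp_zero_right[OF _ t(1,3) W]
          comp_closed[OF t(5) _ t(2,3) W] by auto
      show "{u \<in> arr B W. u \<cdot> x = zhom A W} \<subseteq> (\<lambda>u. u \<cdot> y) ` arr C W"
        using exact_Hom_B_contra[OF T W] by blast
    qed
    then show ?thesis
      using card_Hom_exact[OF t(3) W t(2) W fin0[OF t(3)] comp_linear_left[OF t(2,3) W t(5)]] 0
      by (simp add: a_def b_def)
  next
    case (Suc m)
    then have n: "1 \<le> n" by simp
    show ?thesis
      using card_higher_ext_exact[where \<psi> = "res x", OF n n t(3) W t(2) W fin[OF t(3) n] yhom_ypull[OF t(5,2)]
          ypull_ypull_zero[OF T] exact_higher_B_contra[OF T]] ext_card_eq[OF t(3) W n] Suc by (simp add: a_def b_def)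
  qed
  have B: "ecard n B W = b n * c n" for n
  proof (cases n)
    case 0
    have "(\<lambda>u. u \<cdot> x) ` arr B W = {u \<in> arr A W. psh u \<delta> = zext C W}"
    proof
      show "(\<lambda>u. u \<cdot> x) ` arr B W \<subseteq> {u \<in> arr A W. psh u \<delta> = zext C W}"
        using push_comp[OF t(6,4) _ t(3,1,2) W] push_inflation[OF T] push_zero[OF _ t(3,2) W]
          comp_closed[OF t(4) _ t(1,2) W] by auto
      show "{u \<in> arr A W. psh u \<delta> = zext C W} \<subseteq> (\<lambda>u. u \<cdot> x) ` arr B W"
        using exact_Hom_A_contra[OF T W] by blast
    qed
    then show ?thesis
      using card_Hom_exact[OF t(2) W t(1) W fin0[OF t(2)] comp_linear_left[OF t(1,2) W t(4)]] 0
      by (simp add: b_def c_def)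
  next
    case (Suc m)
    then have n: "1 \<le> n" by simp
    show ?thesis
      using card_higher_ext_exact[where \<psi> = "?d", OF n n t(2) W t(1) W fin[OF t(2) n] yhom_ypull[OF t(4,1)]
          Tens_inflation_zero[OF T] exact_higher_A_contra[OF T]] ext_card_eq[OF t(2) W n] Suc
      by (simp add: b_def c_def)
  qed
  have A: "ecard n A W = c n * a (Suc n)" for n
  proof (cases n)
    case 0
    have z: "eqv 1 B W (res y (Base (psh u \<delta>))) Zero" if u: "u \<in> arr A W" for u
      using yeq_Base_zero[OF t(2) W] push_pull[OF t(6) u t(5,3,2,1) W] pull_deflation[OF T]
        push_zero[OF u t(2,1) W] by simp
    have e: "\<exists>u \<in> arr A W. \<epsilon> = psh u \<delta>"
      if e: "\<epsilon> \<in> ext C W" "eqv 1 B W (res y (Base \<epsilon>)) Zero" for \<epsilon>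
      using yeq_Base_Zero_iff[OF pull_closed[OF e(1) t(5,3,2) W] t(2) W] e
        exact_Ext_C_contra[OF T W e(1)] by auto
    show ?thesis
      using card_Hom_to_higher_ext[where \<psi> = "res y", OF t(1) W t(3) W fin0[OF t(1)] ET1_push_bilinear[OF t(3,1) W t(6)] z _ e] 0
        cy[of 1] by (simp add: a_def c_def)
  next
    case (Suc m)
    then have n: "1 \<le> n" by simp
    show ?thesis
      using card_higher_ext_exact[where \<psi> = "res y", OF n _ t(1) W t(3) W fin[OF t(1) n] yhom_Tens[OF t(3,1,6)]
          ypull_deflation_Tens[OF T] exact_higher_C_contra[OF T _ n]] ext_card_eq[OF t(1) W n] Suc
      by (simp add: a_def c_def)
  qed
  show thesis
    by (rule that[OF _ C B A]) (simp add: a_def)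
qed

end

section \<open>Euler forms\<close>

text \<open>Each inner value occurs twice with opposite exponents, which leaves the two
  ends.\<close>

lemma prod_alternating_telescope:
  fixes x :: "nat \<Rightarrow> real"
  assumes "\<And>n. x n > 0"
  shows "(\<Prod>n<N. (x n * x (Suc n)) powi ((-1) ^ n)) = x 0 * x N powi (- ((-1) ^ N))"
proof (induction N)
  case 0
  then show ?case using assms[of 0] by (simp add: power_int_minus)
next
  case (Suc N)
  have "x N powi (- ((-1) ^ N)) * x N powi ((-1) ^ N) = 1"
    using assms[of N] by (simp add: power_int_minus)
  then show ?case
    using Suc by (simp add: power_int_mult_distrib mult.assoc)
qed

text \<open>In each degree the product of the outer terms divided by the middle one is
  \<open>a n * a (Suc n)\<close>. These telescope, and \<open>p N = 1\<close> forces
  \<open>a N = 1\<close> at the upper end.\<close>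

lemma alternating_prod_exact:
  fixes a b c p q r :: "nat \<Rightarrow> nat"
  assumes p: "\<And>n. p n = a n * b n" and q: "\<And>n. q n = b n * c n" and r: "\<And>n. r n = c n * a (Suc n)"
    and pos: "\<And>n. p n > 0" "\<And>n. q n > 0" and N: "p N = 1"
  shows "real (a 0) = (\<Prod>n<N. real (p n) powi ((-1) ^ n)) * (\<Prod>n<N. real (r n) powi ((-1) ^ n)) /
    (\<Prod>n<N. real (q n) powi ((-1) ^ n))"
proof -
  have abc: "a n > 0" "b n > 0" "c n > 0" for n
    using pos[of n] p[of n] q[of n] by auto
  have aN: "a N = 1" using N p[of N] by simp
  have "real (p n) powi ((-1) ^ n) * real (r n) powi ((-1) ^ n) / real (q n) powi ((-1) ^ n)
      = (real (a n) * real (a (Suc n))) powi ((-1) ^ n)" for n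
    using abc[of n] by (simp add: p q r power_int_mult_distrib)
  then have "(\<Prod>n<N. real (p n) powi ((-1) ^ n)) * (\<Prod>n<N. real (r n) powi ((-1) ^ n)) /
      (\<Prod>n<N. real (q n) powi ((-1) ^ n)) = (\<Prod>n<N. (real (a n) * real (a (Suc n))) powi ((-1) ^ n))"
    by (simp add: prod.distrib[symmetric] prod_dividef[symmetric])
  also have "\<dots> = real (a 0)"
    using prod_alternating_telescope[of "\<lambda>n. real (a n)" N] abc aN by simp
  finally show ?thesis by simp
qed

locale ext_finite_category = linear_extriangulated_category K \<C>
  for K :: "('k, 'r) ring_scheme"
  and \<C> :: "('o, 'k, 'm, 'e, 'z) extri_cat_scheme" (structure) +
  assumes finite_field: "finite (carrier K)"
    and fin_dim: "\<lbrakk>U \<in> Ob \<C>; V \<in> Ob \<C>\<rbrakk> \<Longrightarrow> ext_fin_dim K \<C> i U V"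
    and summable_dim: "\<lbrakk>U \<in> Ob \<C>; V \<in> Ob \<C>\<rbrakk> \<Longrightarrow> summable (\<lambda>i. real (ext_dim K \<C> i U V))"
begin

text \<open>The alternating product of orders with degree 0 included, that is, the reciprocal of
  \<open>euler_square\<close>.\<close>

definition euler_form :: "'o \<Rightarrow> 'o \<Rightarrow> real"
  where "euler_form U V = euler_curly K \<C> U V * real (card (arr U V))"

lemma finite_mor: "\<lbrakk>U \<in> obj; V \<in> obj\<rbrakk> \<Longrightarrow> finite (arr U V)"
  using vectorspace.finite_carrier[OF Hom_vectorspace finite_field] fin_dim[of U V 0] by simp

lemma finite_Ext1: "\<lbrakk>U \<in> obj; V \<in> obj\<rbrakk> \<Longrightarrow> finite (ext U V)"
  using vectorspace.finite_carrier[OF ET1_vectorspace finite_field] fin_dim[of U V "Suc 0"] by simp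

lemma finite_higher_ext:
  assumes "U \<in> obj" "V \<in> obj" "1 \<le> n"
  shows "finite (carrier (hext n U V))"
proof (cases "n = 1")
  case True
  then show ?thesis using bij_betw_finite[OF bij_betw_Base[OF assms(1,2)]] finite_Ext1 assms by simp
next
  case False
  then obtain m where m: "n = Suc (Suc m)" using that[of "n - 2"] assms(3) by simp
  show ?thesis
    using vectorspace.finite_carrier[OF higher_ext_vectorspace[OF assms(3,1,2)] finite_field]
      fin_dim[OF assms(1,2), of n] m by simp
qed

lemma ext_card_pos:
  assumes ob: "U \<in> obj" "V \<in> obj"
  shows "ecard n U V > 0"
proof (cases "n = 0")
  case True
  then show ?thesis using finite_mor[OF ob] zero_mor[OF ob] by (auto simp: card_gt_0_iff)
next
  case False
  then have n: "1 \<le> n" by simp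
  have "\<zero>\<^bsub>hext n U V\<^esub> \<in> carrier (hext n U V)"
    using abelian_groupE(2)[OF higher_ext_abelian_group[OF n ob]] .
  then show ?thesis using finite_higher_ext[OF ob n] ext_card_eq[OF ob n] by (auto simp: card_gt_0_iff)
qed

text \<open>A summable sequence of dimensions tends to 0 and, being integral, is eventually
  0.\<close>

lemma ext_card_eventually_1:
  assumes ob: "U \<in> obj" "V \<in> obj"
  shows "eventually (\<lambda>n. ecard n U V = 1) sequentially"
proof -
  have "(\<lambda>n. real (ext_dim K \<C> n U V)) \<longlonglongrightarrow> 0"
    by (rule summable_LIMSEQ_zero[OF summable_dim[OF ob]])
  then have "eventually (\<lambda>n. real (ext_dim K \<C> n U V) < 1) sequentially"
    by (rule order_tendstoD) simp
  \<comment> \<open>From degree 2 on, \<open>ext_dim\<close> and \<open>ext_card\<close> both refer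
    to \<open>higher_ext\<close>.\<close>
  then show ?thesis
    using eventually_ge_at_top[of 2]
  proof eventually_elim
    case (elim n)
    then obtain m where m: "n = Suc (Suc m)" using that[of "n - 2"] by simp
    interpret H: vectorspace K "hext n U V"
      by (rule higher_ext_vectorspace[OF _ ob]) (use m in simp)
    have "carrier (hext n U V) = {\<zero>\<^bsub>hext n U V\<^esub>}"
      using H.carrier_dim_zero fin_dim[OF ob, of n] elim(1) m by simp
    then show ?case using m by simp
  qed
qed

text \<open>The bound makes the infinite product finite. Index \<open>n\<close> of
  \<open>euler_curly\<close> stands for degree \<open>Suc n\<close>; the factor of degree 0 is the
  order of the morphism set.\<close>

lemma euler_form_eq_prod:
  assumes "\<And>n. N \<le> n \<Longrightarrow> ecard n U V = 1" "1 \<le> N"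
  shows "euler_form U V = (\<Prod>n<N. real (ecard n U V) powi ((-1) ^ n))"
proof -
  obtain m where m: "N = Suc m" using assms(2) by (cases N) auto
  have "euler_curly K \<C> U V = (\<Prod>n<m. real (ecard (Suc n) U V) powi ((-1) ^ Suc n))"
    unfolding euler_curly_def using assms(1) m by (intro prodinf_finite) auto
  then show ?thesis
    unfolding euler_form_def m prod.lessThan_Suc_shift by simp
qed

lemma euler_form_pos:
  assumes ob: "U \<in> obj" "V \<in> obj"
  shows "euler_form U V > 0"
proof -
  obtain N where N: "\<And>n. N \<le> n \<Longrightarrow> ecard n U V = 1"
    using ext_card_eventually_1[OF ob] by (auto simp: eventually_sequentially)
  have "euler_form U V = (\<Prod>n<Suc N. real (ecard n U V) powi ((-1) ^ n))"
    using N by (intro euler_form_eq_prod) auto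
  also have "\<dots> > 0" using ext_card_pos[OF ob] by (intro prod_pos) (simp add: zero_less_power_int)
  finally show ?thesis .
qed

lemma ex_common_bound:
  assumes "\<And>V. V \<in> {A, B, C} \<Longrightarrow> eventually (\<lambda>n. P V n) sequentially"
  obtains N where "1 \<le> N" "\<And>n V. \<lbrakk>N \<le> n; V \<in> {A, B, C}\<rbrakk> \<Longrightarrow> P V n"
proof -
  have "eventually (\<lambda>n. P A n \<and> P B n \<and> P C n) sequentially"
    using assms[of A] assms[of B] assms[of C] by (simp add: eventually_conj_iff)
  then obtain N where "\<And>n. N \<le> n \<Longrightarrow> P A n \<and> P B n \<and> P C n"
    by (auto simp: eventually_sequentially)
  then show thesis by (intro that[of "Suc N"]) (auto dest: Suc_leD)
qed

text \<open>The long exact sequence ends in trivial groups, so the kernel of its first map is what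
  remains of the alternating product of all orders.\<close>

lemma card_kernel_inflation:
  assumes T: "etri A x B y C \<delta>" and W: "W \<in> obj"
  shows "real (card {u \<in> arr W A. x \<cdot> u = zhom W B}) =
    euler_form W A * euler_form W C / euler_form W B"
proof -
  note t = etriangleD[OF T]
  obtain a b c :: "nat \<Rightarrow> nat" where abc:
    "a 0 = card {u \<in> arr W A. x \<cdot> u = zhom W B}"
    "\<And>n. ecard n W A = a n * b n" "\<And>n. ecard n W B = b n * c n"
    "\<And>n. ecard n W C = c n * a (Suc n)"
    using les_card_co[OF T W finite_mor[OF W] finite_higher_ext[OF W]] by blast
  obtain N where N: "1 \<le> N" "\<And>n V. \<lbrakk>N \<le> n; V \<in> {A, B, C}\<rbrakk> \<Longrightarrow> ecard n W V = 1"
    using ex_common_bound[of A B C "\<lambda>V n. ecard n W V = 1"] ext_card_eventually_1[OF W] t by blast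
  show ?thesis
    using alternating_prod_exact[where N = N and p = "\<lambda>n. ecard n W A"
        and q = "\<lambda>n. ecard n W B" and r = "\<lambda>n. ecard n W C",
        OF abc(2,3,4) ext_card_pos[OF W t(1)] ext_card_pos[OF W t(2)]] N abc(1)
    by (simp add: euler_form_eq_prod[of N])
qed

lemma card_kernel_deflation:
  assumes T: "etri A x B y C \<delta>" and W: "W \<in> obj"
  shows "real (card {u \<in> arr C W. u \<cdot> y = zhom B W}) =
    euler_form C W * euler_form A W / euler_form B W"
proof -
  note t = etriangleD[OF T]
  obtain a b c :: "nat \<Rightarrow> nat" where abc:
    "a 0 = card {u \<in> arr C W. u \<cdot> y = zhom B W}"
    "\<And>n. ecard n C W = a n * b n" "\<And>n. ecard n B W = b n * c n"
    "\<And>n. ecard n A W = c n * a (Suc n)"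
    using les_card_contra[OF T W finite_mor[OF _ W] finite_higher_ext[OF _ W]] by blast
  obtain N where N: "1 \<le> N" "\<And>n V. \<lbrakk>N \<le> n; V \<in> {A, B, C}\<rbrakk> \<Longrightarrow> ecard n V W = 1"
    using ex_common_bound[of A B C "\<lambda>V n. ecard n V W = 1"] ext_card_eventually_1[OF _ W] t by blast
  show ?thesis
    using alternating_prod_exact[where N = N and p = "\<lambda>n. ecard n C W"
        and q = "\<lambda>n. ecard n B W" and r = "\<lambda>n. ecard n A W",
        OF abc(2,3,4) ext_card_pos[OF t(3) W] ext_card_pos[OF t(2) W]] N abc(1)
    by (simp add: euler_form_eq_prod[of N])
qed

end

section \<open>Automorphisms acting on triangles\<close>

context linear_additive_category
begin

lemma minus_ident_comp_zero:
  assumes w: "w \<in> arr X X" and q: "q \<in> arr X V" "q \<cdot> w = q" and ob: "X \<in> obj" "V \<in> obj"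
  shows "q \<cdot> (w \<ominus>\<^bsub>Hom \<C> X X\<^esub> idn X) = zhom X V"
  using comp_minus_right[OF q(1) w ident_mor[OF ob(1)] ob(1,1,2)] comp_ident_right[OF ob q(1)] q(2)
    abelian_group.r_neg[OF Hom_abelian_group[OF ob] q(1)] by (simp add: a_minus_def)

lemma comp_minus_ident_zero:
  assumes w: "w \<in> arr X X" and q: "q \<in> arr V X" "w \<cdot> q = q" and ob: "V \<in> obj" "X \<in> obj"
  shows "(w \<ominus>\<^bsub>Hom \<C> X X\<^esub> idn X) \<cdot> q = zhom V X"
  using comp_minus_left[OF q(1) w ident_mor[OF ob(2)] ob(1,2,2)] comp_ident_left[OF ob q(1)] q(2)
    abelian_group.r_neg[OF Hom_abelian_group[OF ob] q(1)] by (simp add: a_minus_def)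

text \<open>Let z be \<open>w\<close> minus the identity, so z = p q. Then z z is p (q z) or (z p)
  q, and one of the inner factors vanishes. The two alternatives serve different positions in a
  triangle.\<close>

lemma unipotent_iso:
  assumes w: "w \<in> arr X X" and p: "p \<in> arr V X" and q: "q \<in> arr X V"
    and fac: "w \<ominus>\<^bsub>Hom \<C> X X\<^esub> idn X = p \<cdot> q" and abs: "q \<cdot> w = q \<or> w \<cdot> p = p"
    and ob: "X \<in> obj" "V \<in> obj"
  shows "w \<in> isos X X"
proof -
  let ?z = "w \<ominus>\<^bsub>Hom \<C> X X\<^esub> idn X"
  interpret H: abelian_group "Hom \<C> X X" by (rule Hom_abelian_group[OF ob(1,1)])
  note z = minus_mor[OF w ident_mor[OF ob(1)] ob(1,1)]
  have "idn X \<oplus>\<^bsub>Hom \<C> X X\<^esub> ?z = w"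
    using w ident_mor[OF ob(1)]
    by (metis H.a_comm H.minus_closed a_minus_def H.a_assoc H.a_inv_closed H.l_neg H.r_zero)
  moreover have "?z \<cdot> ?z = zhom X X"
    using abs
  proof
    assume "q \<cdot> w = q"
    then have "p \<cdot> (q \<cdot> ?z) = zhom X X"
      using minus_ident_comp_zero[OF w q _ ob] comp_zero_right[OF p ob ob(1)] by simp
    then show ?thesis using comp_assoc'[OF z q p ob(1,1,2,1)] fac by simp
  next
    assume "w \<cdot> p = p"
    then have "(?z \<cdot> p) \<cdot> q = zhom X X"
      using comp_minus_ident_zero[OF w p _ ob(2,1)] comp_zero_left[OF q ob ob(1)] by simp
    then show ?thesis using comp_assoc'[OF q p z ob(1,2,1,1)] fac by simp
  qed
  ultimately show ?thesis using ident_add_square_zero_iso[OF z _ ob(1)] by simp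
qed

lemma Aut_mor: "a \<in> auts X \<Longrightarrow> a \<in> arr X X"
  by (simp add: Aut_def iso_mor_def)

lemma Aut_comp: "\<lbrakk>a \<in> auts X; b \<in> auts X; X \<in> obj\<rbrakk> \<Longrightarrow> b \<cdot> a \<in> auts X"
  using iso_mor_comp[of a X X b X] by (simp add: Aut_def)

definition aut_inv :: "'o \<Rightarrow> 'm \<Rightarrow> 'm"
  where "aut_inv X a = (SOME b. b \<in> auts X \<and> b \<cdot> a = idn X \<and> a \<cdot> b = idn X)"

lemma aut_inv:
  assumes "a \<in> auts X"
  shows "aut_inv X a \<in> auts X" "aut_inv X a \<cdot> a = idn X" "a \<cdot> aut_inv X a = idn X"
proof -
  have "\<exists>b. b \<in> auts X \<and> b \<cdot> a = idn X \<and> a \<cdot> b = idn X"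
    using assms by (auto simp: Aut_def iso_mor_def)
  from someI_ex[OF this] show "aut_inv X a \<in> auts X" "aut_inv X a \<cdot> a = idn X" "a \<cdot> aut_inv X a = idn X"
    by (simp_all add: aut_inv_def)
qed

lemma Aut_cancel_left:
  assumes a: "a \<in> auts X" and p: "p \<in> arr V X" "q \<in> arr V X" and ob: "V \<in> obj" "X \<in> obj"
  shows "a \<cdot> p = a \<cdot> q \<longleftrightarrow> p = q"
proof -
  have "aut_inv X a \<cdot> (a \<cdot> r) = r" if "r \<in> arr V X" for r
    using comp_assoc'[OF that Aut_mor[OF a] Aut_mor[OF aut_inv(1)[OF a]] ob(1,2,2,2)] aut_inv(2)[OF a]
      comp_ident_left[OF ob that] by simp
  then show ?thesis using p by metis
qed

lemma Aut_cancel_right: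
  assumes a: "a \<in> auts X" and p: "p \<in> arr X V" "q \<in> arr X V" and ob: "X \<in> obj" "V \<in> obj"
  shows "p \<cdot> a = q \<cdot> a \<longleftrightarrow> p = q"
proof -
  have "(r \<cdot> a) \<cdot> aut_inv X a = r" if "r \<in> arr X V" for r
    using comp_assoc'[OF Aut_mor[OF aut_inv(1)[OF a]] Aut_mor[OF a] that ob(1,1,1,2)] aut_inv(3)[OF a]
      comp_ident_right[OF ob that] by simp
  then show ?thesis using p by metis
qed

lemma aut_inv_comp:
  assumes a: "a \<in> auts X" and b: "b \<in> auts X" and X: "X \<in> obj"
  shows "aut_inv X (b \<cdot> a) = aut_inv X a \<cdot> aut_inv X b"
proof -
  note ba = Aut_comp[OF a b X] and i = aut_inv[OF a] aut_inv[OF b]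
  note m = Aut_mor[OF a] Aut_mor[OF b] Aut_mor[OF i(1)] Aut_mor[OF i(4)]
  note bi = comp_closed[OF m(4,3) X X X]
  have "(b \<cdot> a) \<cdot> (aut_inv X a \<cdot> aut_inv X b) = b \<cdot> (a \<cdot> (aut_inv X a \<cdot> aut_inv X b))"
    by (rule comp_assoc'[OF bi m(1,2) X X X X])
  also have "\<dots> = idn X"
    using comp_assoc'[OF m(4,3,1) X X X X] comp_ident_left[OF X X m(4)] i by simp
  finally show ?thesis
    using Aut_cancel_left[OF ba Aut_mor[OF aut_inv(1)[OF ba]] bi X X] aut_inv(3)[OF ba] by simp
qed

text \<open>Counting by orbit and stabilizer, where \<open>\<phi>\<close> is the orbit map and
  \<open>R\<close> describes the stabilizer: the fibre through \<open>a\<close> is the coset of the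
  stabilizer by \<open>a\<close>.\<close>

lemma card_Aut_orbits:
  assumes X: "X \<in> obj" and fin: "finite (arr X X)"
    and stab: "\<And>a w. \<lbrakk>a \<in> auts X; w \<in> auts X\<rbrakk> \<Longrightarrow> \<phi> (a \<cdot> w) = \<phi> a \<longleftrightarrow> R w"
  shows "card (auts X) = card {w \<in> auts X. R w} * card (\<phi> ` auts X)"
proof (rule card_const_fibres[OF finite_Aut[OF fin]])
  fix a assume a: "a \<in> auts X"
  note i = aut_inv[OF a]
  have c: "a \<cdot> (aut_inv X a \<cdot> b) = b" "aut_inv X a \<cdot> (a \<cdot> b) = b" if b: "b \<in> auts X" for b
    using comp_assoc'[OF Aut_mor[OF b] Aut_mor[OF i(1)] Aut_mor[OF a] X X X X]
      comp_assoc'[OF Aut_mor[OF b] Aut_mor[OF a] Aut_mor[OF i(1)] X X X X]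
      comp_ident_left[OF X X Aut_mor[OF b]] i by simp_all
  have "bij_betw (\<lambda>b. aut_inv X a \<cdot> b) {b \<in> auts X. \<phi> b = \<phi> a} {w \<in> auts X. R w}"
    by (rule bij_betw_byWitness[where f' = "\<lambda>w. a \<cdot> w"])
      (use c stab[OF a] Aut_comp[OF _ a X] Aut_comp[OF _ i(1) X] in \<open>auto, metis\<close>)
  then show "card {b \<in> auts X. \<phi> b = \<phi> a} = card {w \<in> auts X. R w}" by (rule bij_betw_same_card)
qed

text \<open>Subtracting the identity turns a stabilizer into a set of endomorphisms cut out by
  linear equations; \<open>aut\<close> ensures that no solution is lost by being
  non-invertible.\<close>

lemma card_Aut_translate:
  assumes X: "X \<in> obj" and iff: "\<And>u. u \<in> arr X X \<Longrightarrow> Q u \<longleftrightarrow> R (u \<oplus>\<^bsub>Hom \<C> X X\<^esub> idn X)"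
    and aut: "\<And>w. \<lbrakk>w \<in> arr X X; R w\<rbrakk> \<Longrightarrow> w \<in> auts X"
  shows "card {w \<in> auts X. R w} = card {u \<in> arr X X. Q u}"
proof -
  interpret H: abelian_group "Hom \<C> X X" by (rule Hom_abelian_group[OF X X])
  note i = ident_mor[OF X]
  have pm: "(u \<oplus>\<^bsub>Hom \<C> X X\<^esub> idn X) \<ominus>\<^bsub>Hom \<C> X X\<^esub> idn X = u"
    and mp: "(u \<ominus>\<^bsub>Hom \<C> X X\<^esub> idn X) \<oplus>\<^bsub>Hom \<C> X X\<^esub> idn X = u" if "u \<in> arr X X" for u
    using that i by (simp_all add: a_minus_def H.a_assoc H.r_neg H.l_neg)
  have "bij_betw (\<lambda>w. w \<ominus>\<^bsub>Hom \<C> X X\<^esub> idn X) {w \<in> auts X. R w} {u \<in> arr X X. Q u}"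
    by (rule bij_betw_byWitness[where f' = "\<lambda>u. u \<oplus>\<^bsub>Hom \<C> X X\<^esub> idn X"])
      (use pm mp iff aut i Aut_mor in auto)
  then show ?thesis by (rule bij_betw_same_card)
qed

end

section \<open>Isomorphisms between triangles\<close>

context linear_extriangulated_category
begin

context
  fixes A x B y C \<delta>
  assumes T: "etri A x B y C \<delta>"
begin

private lemmas iso_tri = etriangleD[OF T]

text \<open>The difference of \<open>w\<close> and the identity kills \<open>\<delta>\<close>, hence
  extends along \<open>x\<close>, while \<open>x\<close> composed with it is zero; so
  \<open>unipotent_iso\<close> applies.\<close>

lemma endo_left_iso:
  assumes w: "w \<in> arr A A" "x \<cdot> w = x" "psh w \<delta> = \<delta>"
  shows "w \<in> isos A A"
proof -
  note i = ident_mor[OF iso_tri(1)]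
  have "psh (w \<ominus>\<^bsub>Hom \<C> A A\<^esub> idn A) \<delta> = zext C A"
    using push_mor_minus[OF iso_tri(6) w(1) i iso_tri(3,1,1)] ET1_push_ident[OF iso_tri(3,1,6)] w(3)
      abelian_group.r_neg[OF Ext1_abelian_group[OF iso_tri(3,1)] iso_tri(6)] by (simp add: a_minus_def)
  then obtain v where v: "v \<in> arr B A" "w \<ominus>\<^bsub>Hom \<C> A A\<^esub> idn A = v \<cdot> x"
    using exact_Hom_A_contra[OF T iso_tri(1) minus_mor[OF w(1) i iso_tri(1,1)]] by blast
  show ?thesis by (rule unipotent_iso[OF w(1) v(1) iso_tri(4) v(2) _ iso_tri(1,2)]) (use w in simp)
qed

lemma endo_right_iso:
  assumes w: "w \<in> arr C C" "w \<cdot> y = y" "pll w \<delta> = \<delta>"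
  shows "w \<in> isos C C"
proof -
  note i = ident_mor[OF iso_tri(3)]
  have "pll (w \<ominus>\<^bsub>Hom \<C> C C\<^esub> idn C) \<delta> = zext C A"
    using pull_mor_minus[OF iso_tri(6) w(1) i iso_tri(3,3,1)] ET1_pull_ident[OF iso_tri(3,1,6)] w(3)
      abelian_group.r_neg[OF Ext1_abelian_group[OF iso_tri(3,1)] iso_tri(6)] by (simp add: a_minus_def)
  then obtain v where v: "v \<in> arr C B" "w \<ominus>\<^bsub>Hom \<C> C C\<^esub> idn C = y \<cdot> v"
    using exact_Hom_C_co[OF T iso_tri(3) minus_mor[OF w(1) i iso_tri(3,3)]] by blast
  show ?thesis by (rule unipotent_iso[OF w(1) iso_tri(5) v(1) v(2) _ iso_tri(3,2)]) (use w in simp)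
qed

lemma endo_mid_iso:
  assumes w: "w \<in> arr B B" "w \<cdot> x = x" "y \<cdot> w = y"
  shows "w \<in> isos B B"
proof -
  obtain v where v: "v \<in> arr C B" "w \<ominus>\<^bsub>Hom \<C> B B\<^esub> idn B = v \<cdot> y"
    using exact_Hom_B_contra[OF T iso_tri(2) minus_mor[OF w(1) ident_mor[OF iso_tri(2)] iso_tri(2,2)]
        comp_minus_ident_zero[OF w(1) iso_tri(4) w(2) iso_tri(1,2)]] .
  show ?thesis by (rule unipotent_iso[OF w(1) v(1) iso_tri(5) v(2) _ iso_tri(2,3)]) (use w in simp)
qed

end

text \<open>The dual of (ET3) over the identities of \<open>B\<close> and \<open>C\<close> gives
  maps both ways. Their composites fix the inflation and the extension and are invertible by
  \<open>endo_left_iso\<close>.\<close>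

lemma left_iso:
  assumes T: "etri A x B y C \<delta>" and T': "etri A' x' B y C \<delta>'"
  obtains a where "a \<in> isos A A'" "x' \<cdot> a = x" "psh a \<delta> = \<delta>'"
proof -
  note t = etriangleD[OF T] and t' = etriangleD[OF T']
  have *: "\<exists>a \<in> arr A\<^sub>1 A\<^sub>2. x\<^sub>2 \<cdot> a = x\<^sub>1 \<and> psh a \<delta>\<^sub>1 = \<delta>\<^sub>2"
    if 1: "etri A\<^sub>1 x\<^sub>1 B y C \<delta>\<^sub>1" and 2: "etri A\<^sub>2 x\<^sub>2 B y C \<delta>\<^sub>2" for A\<^sub>1 x\<^sub>1 \<delta>\<^sub>1 A\<^sub>2 x\<^sub>2 \<delta>\<^sub>2
  proof -
    note t1 = etriangleD[OF 1] and t2 = etriangleD[OF 2]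
    have "idn C \<cdot> y = y \<cdot> idn B"
      using comp_ident_left[OF t(2,3,5)] comp_ident_right[OF t(2,3,5)] by simp
    then show ?thesis
      using ET3_op[OF 1 2 ident_mor[OF t(2)] ident_mor[OF t(3)]]
        comp_ident_left[OF t1(1,2,4)] ET1_pull_ident[OF t2(3,1,6)] by auto
  qed
  obtain a where a: "a \<in> arr A A'" "x' \<cdot> a = x" "psh a \<delta> = \<delta>'" using *[OF T T'] by blast
  obtain b where b: "b \<in> arr A' A" "x \<cdot> b = x'" "psh b \<delta>' = \<delta>" using *[OF T' T] by blast
  have "b \<cdot> a \<in> isos A A"
    using comp_closed[OF a(1) b(1) t(1) t'(1) t(1)] comp_assoc'[OF a(1) b(1) t(4) t(1) t'(1) t(1,2)]
      push_comp[OF t(6) a(1) b(1) t(3,1) t'(1) t(1)] a b by (intro endo_left_iso[OF T]) auto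
  moreover have "a \<cdot> b \<in> isos A' A'"
    using comp_closed[OF b(1) a(1) t'(1) t(1) t'(1)] comp_assoc'[OF b(1) a(1) t'(4) t'(1) t(1) t'(1,2)]
      push_comp[OF t'(6) b(1) a(1) t'(3,1) t(1) t'(1)] a b by (intro endo_left_iso[OF T']) auto
  ultimately have "a \<in> isos A A'" by (rule iso_morI_two_sided[OF a(1) b(1) _ _ t(1) t'(1)])
  then show thesis using that a by blast
qed

lemma right_iso:
  assumes T: "etri A x B y C \<delta>" and T': "etri A x B y' C' \<delta>'"
  obtains c where "c \<in> isos C C'" "c \<cdot> y = y'" "pll c \<delta>' = \<delta>"
proof -
  note t = etriangleD[OF T] and t' = etriangleD[OF T']
  have *: "\<exists>c \<in> arr C\<^sub>1 C\<^sub>2. c \<cdot> y\<^sub>1 = y\<^sub>2 \<and> pll c \<delta>\<^sub>2 = \<delta>\<^sub>1"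
    if 1: "etri A x B y\<^sub>1 C\<^sub>1 \<delta>\<^sub>1" and 2: "etri A x B y\<^sub>2 C\<^sub>2 \<delta>\<^sub>2" for C\<^sub>1 y\<^sub>1 \<delta>\<^sub>1 C\<^sub>2 y\<^sub>2 \<delta>\<^sub>2
  proof -
    note t1 = etriangleD[OF 1] and t2 = etriangleD[OF 2]
    have "idn B \<cdot> x = x \<cdot> idn A"
      using comp_ident_left[OF t(1,2,4)] comp_ident_right[OF t(1,2,4)] by simp
    then show ?thesis
      using ET3[OF 1 2 ident_mor[OF t(1)] ident_mor[OF t(2)]]
        comp_ident_right[OF t2(2,3,5)] ET1_push_ident[OF t1(3,1,6)] by auto
  qed
  obtain c where c: "c \<in> arr C C'" "c \<cdot> y = y'" "pll c \<delta>' = \<delta>" using *[OF T T'] by blast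
  obtain d where d: "d \<in> arr C' C" "d \<cdot> y' = y" "pll d \<delta> = \<delta>'" using *[OF T' T] by blast
  have "d \<cdot> c \<in> isos C C"
    using comp_closed[OF c(1) d(1) t(3) t'(3) t(3)] comp_assoc'[OF t(5) c(1) d(1) t(2,3) t'(3) t(3)]
      pull_comp[OF t(6) d(1) c(1) t(3) t'(3) t(3,1)] c d by (intro endo_right_iso[OF T]) auto
  moreover have "c \<cdot> d \<in> isos C' C'"
    using comp_closed[OF d(1) c(1) t'(3) t(3) t'(3)] comp_assoc'[OF t'(5) d(1) c(1) t'(2,3) t(3) t'(3)]
      pull_comp[OF t'(6) c(1) d(1) t'(3) t(3) t'(3,1)] c d by (intro endo_right_iso[OF T']) auto
  ultimately have "c \<in> isos C C'" by (rule iso_morI_two_sided[OF c(1) d(1) _ _ t(3) t'(3)])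
  then show thesis using that c by blast
qed

text \<open>(ET2) provides middle maps in both directions, not chosen as mutual inverses. Their
  composites fix inflation and deflation, since the outer maps cancel, and are invertible by
  \<open>endo_mid_iso\<close>.\<close>

lemma mid_iso:
  assumes T: "etri A x B y C \<delta>" and T': "etri A' x' B' y' C' \<delta>'"
    and a: "a \<in> arr A A'" "a' \<in> arr A' A" "a' \<cdot> a = idn A" "a \<cdot> a' = idn A'"
    and c: "c \<in> arr C C'" "c' \<in> arr C' C" "c' \<cdot> c = idn C" "c \<cdot> c' = idn C'"
    and d: "psh a \<delta> = pll c \<delta>'"
  obtains b where "b \<in> isos B' B" "b \<cdot> x' = x \<cdot> a'" "y \<cdot> b = c' \<cdot> y'"
proof -
  note t = etriangleD[OF T] and t' = etriangleD[OF T']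
  have d': "psh a' \<delta>' = pll c' \<delta>"
  proof -
    have "psh a' \<delta>' = pll c' (pll c (psh a' \<delta>'))"
      using pull_comp[OF push_closed[OF t'(6) a(2) t'(3,1) t(1)] c(1,2) t'(3) t(3) t'(3) t(1)]
        ET1_pull_ident[OF t'(3) t(1) push_closed[OF t'(6) a(2) t'(3,1) t(1)]] c(4) by simp
    also have "pll c (psh a' \<delta>') = psh a' (psh a \<delta>)"
      using push_pull[OF t'(6) a(2) c(1) t'(3) t(3) t'(1) t(1)] d by simp
    also have "\<dots> = \<delta>"
      using push_comp[OF t(6) a(1,2) t(3,1) t'(1) t(1)] ET1_push_ident[OF t(3,1,6)] a(3) by simp
    finally show ?thesis .
  qed
  obtain b where b: "b \<in> arr B B'" "b \<cdot> x = x' \<cdot> a" "y' \<cdot> b = c \<cdot> y"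
    using ET2_morphism[OF T T' a(1) c(1) d] by blast
  obtain b' where b': "b' \<in> arr B' B" "b' \<cdot> x' = x \<cdot> a'" "y \<cdot> b' = c' \<cdot> y'"
    using ET2_morphism[OF T' T a(2) c(2) d'] by blast
  have endo: "k \<cdot> h \<in> isos M M"
    if U: "etri P p M q Q \<eta>" and V: "etri P' p' M' q' Q' \<eta>'"
      and u: "u \<in> arr P P'" "u' \<in> arr P' P" "u' \<cdot> u = idn P"
      and v: "v \<in> arr Q Q'" "v' \<in> arr Q' Q" "v' \<cdot> v = idn Q"
      and h: "h \<in> arr M M'" "h \<cdot> p = p' \<cdot> u" "q' \<cdot> h = v \<cdot> q"
      and k: "k \<in> arr M' M" "k \<cdot> p' = p \<cdot> u'" "q \<cdot> k = v' \<cdot> q'"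
    for P p M q Q \<eta> P' p' M' q' Q' \<eta>' u u' v v' h k
  proof -
    note m = etriangleD[OF U] and n = etriangleD[OF V]
    show ?thesis
    proof (rule endo_mid_iso[OF U comp_closed[OF h(1) k(1) m(2) n(2) m(2)]])
      have "(k \<cdot> h) \<cdot> p = (k \<cdot> p') \<cdot> u"
        using comp_assoc'[OF m(4) h(1) k(1) m(1,2) n(2) m(2)] comp_assoc'[OF u(1) n(4) k(1) m(1) n(1,2) m(2)]
          h(2) by simp
      then show "(k \<cdot> h) \<cdot> p = p"
        using comp_assoc'[OF u(1,2) m(4) m(1) n(1) m(1,2)] comp_ident_right[OF m(1,2,4)] u(3) k(2) by simp
      have "q \<cdot> (k \<cdot> h) = v' \<cdot> (q' \<cdot> h)"
        using comp_assoc'[OF h(1) k(1) m(5) m(2) n(2) m(2,3)] comp_assoc'[OF h(1) n(5) v(2) m(2) n(2,3) m(3)]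
          k(3) by simp
      then show "q \<cdot> (k \<cdot> h) = q"
        using comp_assoc'[OF m(5) v(1,2) m(2,3) n(3) m(3)] comp_ident_left[OF m(2,3,5)] v(3) h(3) by simp
    qed
  qed
  have "b' \<cdot> b \<in> isos B B" by (rule endo[OF T T' a(1,2,3) c(1,2,3) b b'])
  moreover have "b \<cdot> b' \<in> isos B' B'" by (rule endo[OF T' T a(2,1,4) c(2,1,4) b' b])
  ultimately have "b' \<in> isos B' B"
    by (intro iso_morI_two_sided[OF b'(1) b(1) _ _ t'(2) t(2)])
  then show thesis using that b' by blast
qed

text \<open>An arbitrary realization of \<open>psh a \<delta>\<close> is compared with the given
  triangle by \<open>mid_iso\<close> and then replaced by the equivalent one with middle term
  \<open>B\<close>.\<close>

lemma etriangle_transport_left: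
  assumes T: "etri A x B y C \<delta>" and A': "A' \<in> obj"
    and a: "a \<in> arr A A'" "a' \<in> arr A' A" "a' \<cdot> a = idn A" "a \<cdot> a' = idn A'"
  shows "etri A' (x \<cdot> a') B y C (psh a \<delta>)"
proof -
  note t = etriangleD[OF T] and i = ident_mor[OF etriangleD(3)[OF T]]
  note d = push_closed[OF t(6) a(1) t(3,1) A']
  obtain B' x' y' where T': "etri A' x' B' y' C (psh a \<delta>)" using ex_etriangle[OF d t(3) A'] .
  note t' = etriangleD[OF T']
  obtain b where b: "b \<in> isos B' B" "b \<cdot> x' = x \<cdot> a'" "y \<cdot> b = idn C \<cdot> y'"
    using mid_iso[OF T T' a i i] comp_ident_left[OF t(3,3) i] ET1_pull_ident[OF t(3) A' d] by auto
  show ?thesis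
    using etriangle_equiv[OF T' b(1,2) _ t(2,5)] b(3) comp_ident_left[OF t'(2,3,5)] by simp
qed

lemma etriangle_transport_right:
  assumes T: "etri A x B y C \<delta>" and C': "C' \<in> obj"
    and c: "c \<in> arr C C'" "c' \<in> arr C' C" "c' \<cdot> c = idn C" "c \<cdot> c' = idn C'"
  shows "etri A x B (c \<cdot> y) C' (pll c' \<delta>)"
proof -
  note t = etriangleD[OF T] and i = ident_mor[OF etriangleD(1)[OF T]]
  note d = pull_closed[OF t(6) c(2) t(3) C' t(1)]
  obtain B' x' y' where T': "etri A x' B' y' C' (pll c' \<delta>)" using ex_etriangle[OF d C' t(1)] .
  note t' = etriangleD[OF T']
  have "psh (idn A) \<delta> = pll c (pll c' \<delta>)"
    using ET1_push_ident[OF t(3,1,6)] ET1_pull_ident[OF t(3,1,6)] pull_comp[OF t(6) c(2,1) t(3) C' t(3,1)] c(3)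
    by simp
  then obtain b where b: "b \<in> isos B' B" "b \<cdot> x' = x \<cdot> idn A" "y \<cdot> b = c' \<cdot> y'"
    using mid_iso[OF T T' i i _ _ c] comp_ident_left[OF t(1,1) i] by auto
  have "(c \<cdot> y) \<cdot> b = c \<cdot> (c' \<cdot> y')"
    using comp_assoc'[OF iso_mor_imp_mor[OF b(1)] t(5) c(1) t'(2) t(2,3) C'] b(3) by simp
  also have "\<dots> = y'"
    using comp_assoc'[OF t'(5) c(2,1) t'(2) C' t(3) C'] c(4) comp_ident_left[OF t'(2,3,5)] by simp
  finally show ?thesis
    using etriangle_equiv[OF T' b(1) _ _ t(2) comp_closed[OF t(5) c(1) t(2,3) C']] b(2)
      comp_ident_right[OF t(1,2,4)] by simp
qed

definition triangles :: "'o \<Rightarrow> 'o \<Rightarrow> 'o \<Rightarrow> ('m \<times> 'm \<times> 'e) set"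
  where "triangles X L Y = {(f, g, \<delta>). etri X f L g Y \<delta>}"

text \<open>An isomorphism from the cocone to \<open>X\<close> can be absorbed into the inflation
  and the extension, so triangles starting exactly at \<open>X\<close> suffice.\<close>

lemma deflations_cocone_eq:
  assumes X: "X \<in> obj"
  shows "deflations_cocone \<C> X L Y = (\<lambda>(f, g, \<delta>). g) ` triangles X L Y"
proof
  show "deflations_cocone \<C> X L Y \<subseteq> (\<lambda>(f, g, \<delta>). g) ` triangles X L Y"
  proof
    fix g assume "g \<in> deflations_cocone \<C> X L Y"
    then obtain A x \<delta> a a' where T: "etri A x L g Y \<delta>" and
      a: "a \<in> arr A X" "a' \<in> arr X A" "a' \<cdot> a = idn A" "a \<cdot> a' = idn X"
      by (fastforce simp: deflations_cocone_def isomorphic_def iso_mor_def)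
    show "g \<in> (\<lambda>(f, g, \<delta>). g) ` triangles X L Y"
      using etriangle_transport_left[OF T X a] by (force simp: triangles_def)
  qed
  show "(\<lambda>(f, g, \<delta>). g) ` triangles X L Y \<subseteq> deflations_cocone \<C> X L Y"
    using iso_mor_ident[OF X] etriangleD(5)
    by (fastforce simp: triangles_def deflations_cocone_def isomorphic_def)
qed

lemma inflations_cone_eq:
  assumes Y: "Y \<in> obj"
  shows "inflations_cone \<C> X L Y = (\<lambda>(f, g, \<delta>). f) ` triangles X L Y"
proof
  show "inflations_cone \<C> X L Y \<subseteq> (\<lambda>(f, g, \<delta>). f) ` triangles X L Y"
  proof
    fix f assume "f \<in> inflations_cone \<C> X L Y"
    then obtain C y \<delta> c c' where T: "etri X f L y C \<delta>" and
      c: "c \<in> arr C Y" "c' \<in> arr Y C" "c' \<cdot> c = idn C" "c \<cdot> c' = idn Y"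
      by (fastforce simp: inflations_cone_def isomorphic_def iso_mor_def)
    show "f \<in> (\<lambda>(f, g, \<delta>). f) ` triangles X L Y"
      using etriangle_transport_right[OF T Y c] by (force simp: triangles_def)
  qed
  show "(\<lambda>(f, g, \<delta>). f) ` triangles X L Y \<subseteq> inflations_cone \<C> X L Y"
    using iso_mor_ident[OF Y] etriangleD(4)
    by (fastforce simp: triangles_def inflations_cone_def isomorphic_def)
qed

lemma push_Aut_cancel:
  assumes a: "a \<in> auts A" and e: "\<delta> \<in> ext C A" "\<epsilon> \<in> ext C A"
    and ob: "C \<in> obj" "A \<in> obj"
  shows "psh a \<delta> = psh a \<epsilon> \<longleftrightarrow> \<delta> = \<epsilon>"
proof -
  have "psh (aut_inv A a) (psh a \<eta>) = \<eta>" if "\<eta> \<in> ext C A" for \<eta>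
    using push_comp[OF that Aut_mor[OF a] Aut_mor[OF aut_inv(1)[OF a]] ob(1,2,2,2)] aut_inv(2)[OF a]
      ET1_push_ident[OF ob that] by simp
  then show ?thesis using e by metis
qed

lemma pull_Aut_cancel:
  assumes c: "c \<in> auts C" and e: "\<delta> \<in> ext C A" "\<epsilon> \<in> ext C A"
    and ob: "C \<in> obj" "A \<in> obj"
  shows "pll c \<delta> = pll c \<epsilon> \<longleftrightarrow> \<delta> = \<epsilon>"
proof -
  have "pll (aut_inv C c) (pll c \<eta>) = \<eta>" if "\<eta> \<in> ext C A" for \<eta>
    using pull_comp[OF that Aut_mor[OF c] Aut_mor[OF aut_inv(1)[OF c]] ob(1,1,1,2)] aut_inv(3)[OF c]
      ET1_pull_ident[OF ob that] by simp
  then show ?thesis using e by metis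
qed

end

section \<open>Orbit counts and comparison of the two weighted sums\<close>

context ext_finite_category
begin

lemma finite_triangles: "\<lbrakk>X \<in> obj; L \<in> obj; Y \<in> obj\<rbrakk> \<Longrightarrow> finite (triangles X L Y)"
  by (rule finite_subset[of _ "arr X L \<times> arr L Y \<times> ext Y X"])
    (auto simp: triangles_def finite_mor finite_Ext1 dest: etriangleD)

context
  fixes X f L g Y \<delta>
  assumes T: "etri X f L g Y \<delta>"
begin

private lemmas cnt_tri = etriangleD[OF T]

lemma card_Aut_left:
  "card (auts X) =
    card {u \<in> arr X X. f \<cdot> u = zhom X L \<and> psh u \<delta> = zext Y X} *
    card {(f', g', \<delta>') \<in> triangles X L Y. g' = g}"
proof -
  interpret HL: abelian_group "Hom \<C> X L" by (rule Hom_abelian_group[OF cnt_tri(1,2)])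
  interpret E: abelian_group "Ext1 \<C> Y X" by (rule Ext1_abelian_group[OF cnt_tri(3,1)])
  note i = ident_mor[OF cnt_tri(1)]
  \<comment> \<open>Acting by \<open>a\<close> pushes the extension forward along \<open>a\<close>
    and therefore changes the inflation by the inverse of \<open>a\<close>; the deflation
    stays.\<close>
  define \<phi> where "\<phi> a = (f \<cdot> aut_inv X a, g, psh a \<delta>)" for a
  have "card (auts X) = card {w \<in> auts X. f \<cdot> w = f \<and> psh w \<delta> = \<delta>} * card (\<phi> ` auts X)"
  proof (rule card_Aut_orbits[OF cnt_tri(1) finite_mor[OF cnt_tri(1,1)]])
    fix a w assume a: "a \<in> auts X" and w: "w \<in> auts X"
    note m = Aut_mor[OF a] Aut_mor[OF w] and v = aut_inv[OF a] aut_inv[OF w]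
    note vm = Aut_mor[OF v(1)] Aut_mor[OF v(4)]
    have "f \<cdot> aut_inv X (a \<cdot> w) = (f \<cdot> aut_inv X w) \<cdot> aut_inv X a"
      using comp_assoc'[OF vm(1,2) cnt_tri(4) cnt_tri(1,1,1,2)] aut_inv_comp[OF w a cnt_tri(1)] by simp
    then have "f \<cdot> aut_inv X (a \<cdot> w) = f \<cdot> aut_inv X a \<longleftrightarrow> f \<cdot> aut_inv X w = f"
      using Aut_cancel_right[OF v(1) comp_closed[OF vm(2) cnt_tri(4) cnt_tri(1,1,2)] cnt_tri(4) cnt_tri(1,2)] by simp
    also have "\<dots> \<longleftrightarrow> f \<cdot> w = f"
      using Aut_cancel_right[OF w comp_closed[OF vm(2) cnt_tri(4) cnt_tri(1,1,2)] cnt_tri(4) cnt_tri(1,2)]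
        comp_assoc'[OF m(2) vm(2) cnt_tri(4) cnt_tri(1,1,1,2)] v(5) comp_ident_right[OF cnt_tri(1,2,4)] by auto
    finally show "\<phi> (a \<cdot> w) = \<phi> a \<longleftrightarrow> f \<cdot> w = f \<and> psh w \<delta> = \<delta>"
      using push_comp[OF cnt_tri(6) m(2,1) cnt_tri(3,1,1,1)] push_Aut_cancel[OF a push_closed[OF cnt_tri(6) m(2) cnt_tri(3,1,1)] cnt_tri(6,3,1)]
      by (simp add: \<phi>_def)
  qed
  moreover have "\<phi> ` auts X = {(f', g', \<delta>') \<in> triangles X L Y. g' = g}"
  proof
    show "\<phi> ` auts X \<subseteq> {(f', g', \<delta>') \<in> triangles X L Y. g' = g}"
      using etriangle_transport_left[OF T cnt_tri(1) Aut_mor Aut_mor[OF aut_inv(1)] aut_inv(2,3)]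
      by (auto simp: \<phi>_def triangles_def)
    show "{(f', g', \<delta>') \<in> triangles X L Y. g' = g} \<subseteq> \<phi> ` auts X"
    proof clarify
      fix f' \<delta>' assume "(f', g, \<delta>') \<in> triangles X L Y"
      then have T': "etri X f' L g Y \<delta>'" by (simp add: triangles_def)
      note t' = etriangleD[OF T']
      obtain a where a: "a \<in> isos X X" "f' \<cdot> a = f" "psh a \<delta> = \<delta>'" using left_iso[OF T T'] .
      have a': "a \<in> auts X" using a by (simp add: Aut_def)
      have "f \<cdot> aut_inv X a = f'"
        using comp_assoc'[OF Aut_mor[OF aut_inv(1)[OF a']] Aut_mor[OF a'] t'(4) cnt_tri(1,1,1,2)]
          aut_inv(3)[OF a'] a(2) comp_ident_right[OF cnt_tri(1,2) t'(4)] by simp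
      then show "(f', g, \<delta>') \<in> \<phi> ` auts X" using a a' by (auto simp: \<phi>_def)
    qed
  qed
  moreover have "card {w \<in> auts X. f \<cdot> w = f \<and> psh w \<delta> = \<delta>} =
    card {u \<in> arr X X. f \<cdot> u = zhom X L \<and> psh u \<delta> = zext Y X}"
  proof (rule card_Aut_translate[OF cnt_tri(1)])
    fix u assume u: "u \<in> arr X X"
    show "f \<cdot> u = zhom X L \<and> psh u \<delta> = zext Y X \<longleftrightarrow>
        f \<cdot> (u \<oplus>\<^bsub>Hom \<C> X X\<^esub> idn X) = f \<and> psh (u \<oplus>\<^bsub>Hom \<C> X X\<^esub> idn X) \<delta> = \<delta>"
      using comp_add_right[OF cnt_tri(4) u i cnt_tri(1,1,2)] comp_ident_right[OF cnt_tri(1,2,4)]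
        comp_closed[OF u cnt_tri(4) cnt_tri(1,1,2)] cnt_tri(4) HL.add.r_cancel_one[of f "f \<cdot> u"]
        push_mor_add[OF cnt_tri(6) u i cnt_tri(3,1,1)] ET1_push_ident[OF cnt_tri(3,1,6)]
        push_closed[OF cnt_tri(6) u cnt_tri(3,1,1)] cnt_tri(6) E.add.r_cancel_one[of \<delta> "psh u \<delta>"] by simp
  qed (use endo_left_iso[OF T] in \<open>simp add: Aut_def\<close>)
  ultimately show ?thesis by simp
qed

lemma card_Aut_right:
  "card (auts Y) =
    card {v \<in> arr Y Y. v \<cdot> g = zhom L Y \<and> pll v \<delta> = zext Y X} *
    card {(f', g', \<delta>') \<in> triangles X L Y. f' = f}"
proof -
  interpret HL: abelian_group "Hom \<C> L Y" by (rule Hom_abelian_group[OF cnt_tri(2,3)])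
  interpret E: abelian_group "Ext1 \<C> Y X" by (rule Ext1_abelian_group[OF cnt_tri(3,1)])
  note i = ident_mor[OF cnt_tri(3)]
  define \<phi> where "\<phi> a = (f, a \<cdot> g, pll (aut_inv Y a) \<delta>)" for a
  have "card (auts Y) = card {w \<in> auts Y. w \<cdot> g = g \<and> pll w \<delta> = \<delta>} * card (\<phi> ` auts Y)"
  proof (rule card_Aut_orbits[OF cnt_tri(3) finite_mor[OF cnt_tri(3,3)]])
    fix a w assume a: "a \<in> auts Y" and w: "w \<in> auts Y"
    note m = Aut_mor[OF a] Aut_mor[OF w] and v = aut_inv[OF a] aut_inv[OF w]
    note vm = Aut_mor[OF v(1)] Aut_mor[OF v(4)]
    have "pll (aut_inv Y (a \<cdot> w)) \<delta> = pll (aut_inv Y a) (pll (aut_inv Y w) \<delta>)"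
      using pull_comp[OF cnt_tri(6) vm(2,1) cnt_tri(3,3,3,1)] aut_inv_comp[OF w a cnt_tri(3)] by simp
    then have "pll (aut_inv Y (a \<cdot> w)) \<delta> = pll (aut_inv Y a) \<delta> \<longleftrightarrow> pll (aut_inv Y w) \<delta> = \<delta>"
      using pull_Aut_cancel[OF v(1) pull_closed[OF cnt_tri(6) vm(2) cnt_tri(3,3,1)] cnt_tri(6,3,1)] by simp
    also have "\<dots> \<longleftrightarrow> pll w \<delta> = \<delta>"
      using pull_Aut_cancel[OF w pull_closed[OF cnt_tri(6) vm(2) cnt_tri(3,3,1)] cnt_tri(6,3,1)]
        pull_comp[OF cnt_tri(6) vm(2) m(2) cnt_tri(3,3,3,1)] v(5) ET1_pull_ident[OF cnt_tri(3,1,6)] by auto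
    finally show "\<phi> (a \<cdot> w) = \<phi> a \<longleftrightarrow> w \<cdot> g = g \<and> pll w \<delta> = \<delta>"
      using comp_assoc'[OF cnt_tri(5) m(2,1) cnt_tri(2,3,3,3)]
        Aut_cancel_left[OF a comp_closed[OF cnt_tri(5) m(2) cnt_tri(2,3,3)] cnt_tri(5,2,3)] by (simp add: \<phi>_def)
  qed
  moreover have "\<phi> ` auts Y = {(f', g', \<delta>') \<in> triangles X L Y. f' = f}"
  proof
    show "\<phi> ` auts Y \<subseteq> {(f', g', \<delta>') \<in> triangles X L Y. f' = f}"
      using etriangle_transport_right[OF T cnt_tri(3) Aut_mor Aut_mor[OF aut_inv(1)] aut_inv(2,3)]
      by (auto simp: \<phi>_def triangles_def)
    show "{(f', g', \<delta>') \<in> triangles X L Y. f' = f} \<subseteq> \<phi> ` auts Y"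
    proof clarify
      fix g' \<delta>' assume "(f, g', \<delta>') \<in> triangles X L Y"
      then have T': "etri X f L g' Y \<delta>'" by (simp add: triangles_def)
      note t' = etriangleD[OF T']
      obtain c where c: "c \<in> isos Y Y" "c \<cdot> g = g'" "pll c \<delta>' = \<delta>" using right_iso[OF T T'] .
      have c': "c \<in> auts Y" using c by (simp add: Aut_def)
      have "pll (aut_inv Y c) \<delta> = \<delta>'"
        using pull_comp[OF t'(6) Aut_mor[OF c'] Aut_mor[OF aut_inv(1)[OF c']] cnt_tri(3,3,3,1)]
          aut_inv(3)[OF c'] c(3) ET1_pull_ident[OF cnt_tri(3,1) t'(6)] by simp
      then show "(f, g', \<delta>') \<in> \<phi> ` auts Y" using c c' by (auto simp: \<phi>_def)
    qed
  qed
  moreover have "card {w \<in> auts Y. w \<cdot> g = g \<and> pll w \<delta> = \<delta>} =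
    card {v \<in> arr Y Y. v \<cdot> g = zhom L Y \<and> pll v \<delta> = zext Y X}"
  proof (rule card_Aut_translate[OF cnt_tri(3)])
    fix u assume u: "u \<in> arr Y Y"
    show "u \<cdot> g = zhom L Y \<and> pll u \<delta> = zext Y X \<longleftrightarrow>
        (u \<oplus>\<^bsub>Hom \<C> Y Y\<^esub> idn Y) \<cdot> g = g \<and> pll (u \<oplus>\<^bsub>Hom \<C> Y Y\<^esub> idn Y) \<delta> = \<delta>"
      using comp_add_left[OF cnt_tri(5) u i cnt_tri(2,3,3)] comp_ident_left[OF cnt_tri(2,3,5)]
        comp_closed[OF cnt_tri(5) u cnt_tri(2,3,3)] cnt_tri(5) HL.add.r_cancel_one[of g "u \<cdot> g"]
        pull_mor_add[OF cnt_tri(6) u i cnt_tri(3,3,1)] ET1_pull_ident[OF cnt_tri(3,1,6)]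
        pull_closed[OF cnt_tri(6) u cnt_tri(3,3,1)] cnt_tri(6) E.add.r_cancel_one[of \<delta> "pll u \<delta>"] by simp
  qed (use endo_right_iso[OF T] in \<open>simp add: Aut_def\<close>)
  ultimately show ?thesis by simp
qed

text \<open>Both sides consist of the extensions arising from endomorphisms of the triangle with
  middle component zero: (ET3) and its dual complete either outer component to such an
  endomorphism.\<close>

lemma connecting_images_eq:
  "(\<lambda>u. psh u \<delta>) ` {u \<in> arr X X. f \<cdot> u = zhom X L} =
   (\<lambda>v. pll v \<delta>) ` {v \<in> arr Y Y. v \<cdot> g = zhom L Y}" (is "?A = ?B")
proof
  note z = zero_mor[OF cnt_tri(2,2)]
  have fz: "(zhom L L) \<cdot> f = zhom X L" by (rule comp_zero_left[OF cnt_tri(4,1,2,2)])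
  have gz: "g \<cdot> (zhom L L) = zhom L Y" by (rule comp_zero_right[OF cnt_tri(5,2,2,3)])
  show "?A \<subseteq> ?B"
  proof clarify
    fix u assume u: "u \<in> arr X X" "f \<cdot> u = zhom X L"
    obtain v where "v \<in> arr Y Y" "v \<cdot> g = g \<cdot> (zhom L L)" "psh u \<delta> = pll v \<delta>"
      using ET3[OF T T u(1) z] fz u(2) by auto
    then show "psh u \<delta> \<in> ?B" using gz by auto
  qed
  show "?B \<subseteq> ?A"
  proof clarify
    fix v assume v: "v \<in> arr Y Y" "v \<cdot> g = zhom L Y"
    obtain u where "u \<in> arr X X" "(zhom L L) \<cdot> f = f \<cdot> u" "psh u \<delta> = pll v \<delta>"
      using ET3_op[OF T T z v(1)] gz v(2) by auto
    then show "pll v \<delta> \<in> ?A" using fz by (auto intro!: image_eqI[of _ _ u])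
  qed
qed

text \<open>The order of each full kernel is that of the part annihilating \<open>\<delta>\<close>
  times that of its image in \<open>Ext1 \<C> Y X\<close>, and the two images coincide.\<close>

lemma card_kernels_proportional:
  "card {u \<in> arr X X. f \<cdot> u = zhom X L \<and> psh u \<delta> = zext Y X} *
     card {v \<in> arr Y Y. v \<cdot> g = zhom L Y} =
   card {v \<in> arr Y Y. v \<cdot> g = zhom L Y \<and> pll v \<delta> = zext Y X} *
     card {u \<in> arr X X. f \<cdot> u = zhom X L}"
proof -
  have "card {u \<in> arr X X. f \<cdot> u = zhom X L} =
      card {u \<in> arr X X. f \<cdot> u = zhom X L \<and> psh u \<delta> = zext Y X} *
      card ((\<lambda>u. psh u \<delta>) ` {u \<in> arr X X. f \<cdot> u = zhom X L})"
    using comp_closed[OF _ cnt_tri(4) cnt_tri(1,1,2)] push_closed[OF cnt_tri(6) _ cnt_tri(3,1,1)] comp_add_right[OF cnt_tri(4) _ _ cnt_tri(1,1,2)]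
      push_mor_add[OF cnt_tri(6) _ _ cnt_tri(3,1,1)]
    by (intro card_kernel_restricted_image Hom_abelian_group Ext1_abelian_group finite_mor cnt_tri(1-3))
  moreover have "card {v \<in> arr Y Y. v \<cdot> g = zhom L Y} =
      card {v \<in> arr Y Y. v \<cdot> g = zhom L Y \<and> pll v \<delta> = zext Y X} *
      card ((\<lambda>v. pll v \<delta>) ` {v \<in> arr Y Y. v \<cdot> g = zhom L Y})"
    using comp_closed[OF cnt_tri(5) _ cnt_tri(2,3,3)] pull_closed[OF cnt_tri(6) _ cnt_tri(3,3,1)] comp_add_left[OF cnt_tri(5) _ _ cnt_tri(2,3,3)]
      pull_mor_add[OF cnt_tri(6) _ _ cnt_tri(3,3,1)]
    by (intro card_kernel_restricted_image Hom_abelian_group Ext1_abelian_group finite_mor cnt_tri(1-3))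
  ultimately show ?thesis using connecting_images_eq by simp
qed

end

text \<open>The weight \<open>w s / c\<close> is the reciprocal of the size of the fibre through
  \<open>s\<close>, so every fibre contributes 1 although the sizes vary.\<close>

lemma sum_over_fibres:
  fixes w :: "'p \<Rightarrow> real"
  assumes "finite S" "c \<noteq> 0" "\<And>s. s \<in> S \<Longrightarrow> w s * real (card {s' \<in> S. h s' = h s}) = c"
  shows "real (card (h ` S)) = (\<Sum>s\<in>S. w s / c)"
proof -
  have "(\<Sum>s\<in>S. w s / c) = (\<Sum>y\<in>h ` S. \<Sum>s\<in>{s \<in> S. h s = y}. w s / c)"
    by (rule sum.image_gen[OF assms(1)])
  also have "\<dots> = (\<Sum>y\<in>h ` S. 1)"
  proof (rule sum.cong[OF refl])
    fix y assume "y \<in> h ` S"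
    then obtain s where s: "s \<in> S" "y = h s" by auto
    let ?F = "{s' \<in> S. h s' = h s}"
    have F: "real (card ?F) \<noteq> 0" using assms(2) assms(3)[OF s(1)] by auto
    have "w s' = c / real (card ?F)" if "s' \<in> ?F" for s'
      using assms(3)[of s'] that F by (simp add: field_simps)
    then have "(\<Sum>s'\<in>?F. w s' / c) = (\<Sum>s'\<in>?F. 1 / real (card ?F))"
      using assms(2) by (intro sum.cong) auto
    then show "(\<Sum>s'\<in>{s \<in> S. h s = y}. w s' / c) = 1" using F s by simp
  qed
  finally show ?thesis by simp
qed

theorem deflations_inflations_formula:
  assumes ob: "X \<in> obj" "L \<in> obj" "Y \<in> obj"
  shows "real (card (deflations_cocone \<C> X L Y)) / real (card (auts Y)) * (euler_form Y Y / euler_form L Y) =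
    real (card (inflations_cone \<C> X L Y)) / real (card (auts X)) * (euler_form X X / euler_form X L)"
proof -
  let ?D = "real (card (deflations_cocone \<C> X L Y))" and ?I = "real (card (inflations_cone \<C> X L Y))"
  let ?S = "triangles X L Y"
  \<comment> \<open>Stabilizer orders for the two actions; they depend on the triangle and serve as
    weights.\<close>
  define SX where "SX = (\<lambda>(f, g :: 'm, \<delta>). real (card {u \<in> arr X X. f \<cdot> u = zhom X L \<and> psh u \<delta> = zext Y X}))"
  define SY where "SY = (\<lambda>(f :: 'm, g, \<delta>). real (card {v \<in> arr Y Y. v \<cdot> g = zhom L Y \<and> pll v \<delta> = zext Y X}))"
  note fin = finite_triangles[OF ob]
  have pos: "euler_form X Y > 0" "euler_form X L > 0" "euler_form L Y > 0"
    using euler_form_pos ob by auto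
  have ident_Aut: "idn V \<in> auts V" if "V \<in> obj" for V
    using iso_mor_ident[OF that] by (simp add: Aut_def)
  have Aut: "card (auts X) \<noteq> 0" "card (auts Y) \<noteq> 0"
    using ident_Aut ob finite_Aut[OF finite_mor] by auto
  have "real (card ((\<lambda>(f, g, \<delta>). g) ` ?S)) = (\<Sum>s\<in>?S. SX s / real (card (auts X)))"
  proof (rule sum_over_fibres[OF fin])
    fix s assume s: "s \<in> ?S"
    obtain f g \<delta> where e: "s = (f, g, \<delta>)" by (cases s)
    have "{s' \<in> ?S. (case s' of (f, g, \<delta>) \<Rightarrow> g) = (case s of (f, g, \<delta>) \<Rightarrow> g)} = {(f', g', \<delta>') \<in> ?S. g' = g}"
      using e by auto
    then show "SX s * real (card {s' \<in> ?S. (case s' of (f, g, \<delta>) \<Rightarrow> g) = (case s of (f, g, \<delta>) \<Rightarrow> g)}) = real (card (auts X))"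
      using card_Aut_left[of X f L g Y \<delta>] s e by (simp add: triangles_def SX_def)
  qed (use Aut in simp)
  then have D: "?D = (\<Sum>s\<in>?S. SX s / real (card (auts X)))"
    using deflations_cocone_eq[OF ob(1)] by simp
  have "real (card ((\<lambda>(f, g, \<delta>). f) ` ?S)) = (\<Sum>s\<in>?S. SY s / real (card (auts Y)))"
  proof (rule sum_over_fibres[OF fin])
    fix s assume s: "s \<in> ?S"
    obtain f g \<delta> where e: "s = (f, g, \<delta>)" by (cases s)
    have "{s' \<in> ?S. (case s' of (f, g, \<delta>) \<Rightarrow> f) = (case s of (f, g, \<delta>) \<Rightarrow> f)} = {(f', g', \<delta>') \<in> ?S. f' = f}"
      using e by auto
    then show "SY s * real (card {s' \<in> ?S. (case s' of (f, g, \<delta>) \<Rightarrow> f) = (case s of (f, g, \<delta>) \<Rightarrow> f)}) = real (card (auts Y))"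
      using card_Aut_right[of X f L g Y \<delta>] s e by (simp add: triangles_def SY_def)
  qed (use Aut in simp)
  then have I: "?I = (\<Sum>s\<in>?S. SY s / real (card (auts Y)))"
    using inflations_cone_eq[OF ob(3)] by simp
  have summand: "SX s * (euler_form Y Y / euler_form L Y) = SY s * (euler_form X X / euler_form X L)"
    if s: "s \<in> ?S" for s
  proof -
    obtain f g \<delta> where e: "s = (f, g, \<delta>)" by (cases s)
    then have T: "etri X f L g Y \<delta>" using s by (simp add: triangles_def)
    have "SX s * real (card {v \<in> arr Y Y. v \<cdot> g = zhom L Y}) =
        SY s * real (card {u \<in> arr X X. f \<cdot> u = zhom X L})"
      using arg_cong[OF card_kernels_proportional[OF T], of real] e by (simp add: SX_def SY_def)
    \<comment> \<open>Both kernel orders contain the positive factor \<open>euler_form X Y\<close>,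
      which cancels.\<close>
    then have "SX s * (euler_form Y Y * euler_form X Y / euler_form L Y) =
        SY s * (euler_form X X * euler_form X Y / euler_form X L)"
      using card_kernel_deflation[OF T ob(3)] card_kernel_inflation[OF T ob(1)] by simp
    then have "euler_form X Y * (SX s * (euler_form Y Y / euler_form L Y)) =
        euler_form X Y * (SY s * (euler_form X X / euler_form X L))"
      by (simp add: ac_simps)
    then show ?thesis using pos(1) by (metis less_irrefl mult_left_cancel)
  qed
  have D': "?D * real (card (auts X)) = (\<Sum>s\<in>?S. SX s)"
    using Aut unfolding D by (simp add: sum_divide_distrib[symmetric])
  have I': "?I * real (card (auts Y)) = (\<Sum>s\<in>?S. SY s)"
    using Aut unfolding I by (simp add: sum_divide_distrib[symmetric])
  have "(?D * real (card (auts X))) * (euler_form Y Y / euler_form L Y) =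
      (\<Sum>s\<in>?S. SX s * (euler_form Y Y / euler_form L Y))"
    unfolding D' by (rule sum_distrib_right)
  also have "\<dots> = (\<Sum>s\<in>?S. SY s * (euler_form X X / euler_form X L))"
    using summand by (rule sum.cong[OF refl])
  also have "\<dots> = (?I * real (card (auts Y))) * (euler_form X X / euler_form X L)"
    unfolding I' by (rule sum_distrib_right[symmetric])
  finally have eq: "(?D * real (card (auts X))) * (euler_form Y Y / euler_form L Y) =
      (?I * real (card (auts Y))) * (euler_form X X / euler_form X L)" .
  have "d / b * e = i / a * e'" if "a \<noteq> 0" "b \<noteq> 0" "(d * a) * e = (i * b) * e'" for a b d e i e' :: real
    using that by (simp add: field_simps)
  from this[OF _ _ eq] show ?thesis using Aut by simp
qed

end

theorem theorem3p8:
  fixes K :: "('k, 'r) ring_scheme"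
    and \<C> :: "('o, 'k, 'm, 'e, 'z) extri_cat_scheme"
    and X Y L :: 'o
  assumes "linear_extriangulated_category K \<C>"
    and "finite (carrier K)"
    and "Krull_Schmidt \<C>"
    and "\<And>U V i. \<lbrakk>U \<in> Ob \<C>; V \<in> Ob \<C>\<rbrakk> \<Longrightarrow> ext_fin_dim K \<C> i U V"
    and "\<And>U V. \<lbrakk>U \<in> Ob \<C>; V \<in> Ob \<C>\<rbrakk> \<Longrightarrow> summable (\<lambda>i. real (ext_dim K \<C> i U V))"
    and "X \<in> Ob \<C>" and "Y \<in> Ob \<C>" and "L \<in> Ob \<C>"
  shows "real (card (deflations_cocone \<C> X L Y)) / real (card (Aut \<C> Y))
           * (euler_square K \<C> L Y / euler_square K \<C> Y Y)
       = real (card (inflations_cone \<C> X L Y)) / real (card (Aut \<C> X))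
           * (euler_square K \<C> X L / euler_square K \<C> X X)"
proof -
  interpret ext_finite_category K \<C>
    using assms(1,2,4,5) by (simp add: ext_finite_category_def ext_finite_category_axioms_def)
  \<comment> \<open>Passing from \<open>euler_form\<close> to its reciprocal
    \<open>euler_square\<close> inverts the quotients.\<close>
  show ?thesis
    using deflations_inflations_formula[OF assms(6,8,7)] by (simp add: euler_square_def euler_form_def)
qed

end
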